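(* Let $M$ be a countable transitive model of $\mathsf{ZFC}$ and let $\mathbb{B}$ be random forcing in its idealized presentation. Then $\equiv^\mathbb{B}_M$ is not (Fréchet) amenable. In particular, $\equiv^\mathbb{B}_M$ is not hyperfinite.
   Context: $\mathbb{B}$ is the partial order, computed in $M$, of all Borel subsets of $2^\omega$ of positive Lebesgue (product) measure, ordered by inclusion. For a Borel set $B$ coded in $M$, $B^M$ denotes its interpretation in $M$ and $B$ its interpretation in $\mathbf{V}$. A real $x\in 2^\omega$ is an $M$-generic random real if $\{B^M\in\mathbb{B}:x\in B\}$ is an $M$-generic filter for $\mathbb{B}$ (equivalently, $x$ lies in every conull Borel set coded in $M$); $\mathcal{R}$ denotes the set of such reals, and $\equiv^\mathbb{B}_M$ is the equivalence relation on $\mathcal{R}$ given by $x\equiv^\mathbb{B}_M y$ iff $M[x]=M[y]$. Hyperfinite means an increasing union of countably many Borel equivalence relations with finite classes. *)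

theory Defs
  imports "HOL-Analysis.Analysis" "HOL-Library.Countable_Set_Type"
begin

section \<open>Hereditarily countable sets\<close>

text \<open>The type \<open>hc\<close> is a copy of the set of all hereditarily countable well-founded sets. All
  elements of a countable transitive set are hereditarily countable, so countable transitive models
  are exactly certain subsets of this type, with \<open>\<lambda>x y. x \<in> elts y\<close> as the true membership
  relation.\<close>

datatype hc = HC (unHC: "hc cset")

definition elts :: "hc \<Rightarrow> hc set" where
  "elts x = rcset (unHC x)"

text \<open>Meaningful for countable arguments only.\<close>

definition hset :: "hc set \<Rightarrow> hc" where
  "hset A = HC (acset A)"

lemma countable_elts [simp]: "countable (elts x)"
  by (simp add: elts_def)

lemma elts_hset [simp]: "countable A \<Longrightarrow> elts (hset A) = A"
  by (simp add: elts_def hset_def acset_inverse)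

lemma hset_elts [simp]: "hset (elts x) = x"
  by (simp add: elts_def hset_def rcset_inverse)

lemma hc_ext: "elts x = elts y \<Longrightarrow> x = y"
  by (metis hset_elts)

lemma wf_elts: "wf {(x, y). x \<in> elts y}"
proof (rule wfUNIVI)
  fix P :: "hc \<Rightarrow> bool" and x
  assume step: "\<forall>x. (\<forall>y. (y, x) \<in> {(x, y). x \<in> elts y} \<longrightarrow> P y) \<longrightarrow> P x"
  show "P x"
  proof (induction x)
    case (HC A)
    have "\<forall>y \<in> elts (HC A). P y"
      using HC by (auto simp: elts_def)
    then show ?case
      using step by simp
  qed
qed

definition hsucc :: "hc \<Rightarrow> hc" where
  "hsucc a = hset (insert a (elts a))"

primrec hnat :: "nat \<Rightarrow> hc" where
  "hnat 0 = hset {}"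
| "hnat (Suc n) = hsucc (hnat n)"

definition hpair :: "hc \<Rightarrow> hc \<Rightarrow> hc" where
  "hpair a b = hset {hset {a}, hset {a, b}}"

lemma hpair_inject [simp]: "hpair a b = hpair c d \<longleftrightarrow> a = c \<and> b = d"
proof -
  have inj: "hset A = hset B \<longleftrightarrow> A = B" if "countable A" "countable B" for A B
    using that by (metis elts_hset)
  show ?thesis
    unfolding hpair_def by (subst inj; simp add: doubleton_eq_iff inj; blast)
qed

definition hbool :: "bool \<Rightarrow> hc" where
  "hbool b = (if b then hnat 1 else hnat 0)"

text \<open>Functions with domain \<open>\<omega>\<close>, and finite binary strings, as sets of ordered pairs.\<close>

definition hseq :: "(nat \<Rightarrow> hc) \<Rightarrow> hc" where
  "hseq f = hset {hpair (hnat n) (f n) | n. True}"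

definition hstring :: "bool list \<Rightarrow> hc" where
  "hstring s = hset {hpair (hnat i) (hbool (s ! i)) | i. i < length s}"

definition hreal :: "(nat \<Rightarrow> bool) \<Rightarrow> hc" where
  "hreal x = hseq (\<lambda>n. hbool (x n))"


section \<open>Countable transitive models of ZFC\<close>

text \<open>First-order formulas of set theory with named variables \<open>v\<^sub>0, v\<^sub>1, \<dots>\<close>, and
  satisfaction in \<open>(M, \<in>)\<close> under an assignment \<open>e\<close>.\<close>

datatype fm = Mem nat nat | Equ nat nat | Neg fm | Conj fm fm | Exi nat fm

primrec sat :: "hc set \<Rightarrow> (nat \<Rightarrow> hc) \<Rightarrow> fm \<Rightarrow> bool" where
  "sat M e (Mem i j) \<longleftrightarrow> e i \<in> elts (e j)"
| "sat M e (Equ i j) \<longleftrightarrow> e i = e j"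
| "sat M e (Neg \<phi>) \<longleftrightarrow> \<not> sat M e \<phi>"
| "sat M e (Conj \<phi> \<psi>) \<longleftrightarrow> sat M e \<phi> \<and> sat M e \<psi>"
| "sat M e (Exi i \<phi>) \<longleftrightarrow> (\<exists>a\<in>M. sat M (e(i := a)) \<phi>)"

text \<open>The single axioms are written out as their relativizations to \<open>M\<close>. In the two schemata the
  formula \<open>\<phi>\<close> speaks about \<open>v\<^sub>0\<close> (and \<open>v\<^sub>1\<close>), and the assignment \<open>e\<close> supplies arbitrary
  parameters from \<open>M\<close> for the other variables.\<close>

definition ax_extensionality :: "hc set \<Rightarrow> bool" where
  "ax_extensionality M \<longleftrightarrow>
     (\<forall>a\<in>M. \<forall>b\<in>M. (\<forall>z\<in>M. z \<in> elts a \<longleftrightarrow> z \<in> elts b) \<longrightarrow> a = b)"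

definition ax_foundation :: "hc set \<Rightarrow> bool" where
  "ax_foundation M \<longleftrightarrow>
     (\<forall>a\<in>M. (\<exists>z\<in>M. z \<in> elts a) \<longrightarrow>
       (\<exists>z\<in>M. z \<in> elts a \<and> \<not> (\<exists>w\<in>M. w \<in> elts z \<and> w \<in> elts a)))"

definition ax_pairing :: "hc set \<Rightarrow> bool" where
  "ax_pairing M \<longleftrightarrow>
     (\<forall>a\<in>M. \<forall>b\<in>M. \<exists>c\<in>M. \<forall>z\<in>M. z \<in> elts c \<longleftrightarrow> z = a \<or> z = b)"

definition ax_union :: "hc set \<Rightarrow> bool" where
  "ax_union M \<longleftrightarrow>
     (\<forall>a\<in>M. \<exists>u\<in>M. \<forall>z\<in>M. z \<in> elts u \<longleftrightarrow> (\<exists>y\<in>M. y \<in> elts a \<and> z \<in> elts y))"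

definition ax_powerset :: "hc set \<Rightarrow> bool" where
  "ax_powerset M \<longleftrightarrow>
     (\<forall>a\<in>M. \<exists>p\<in>M. \<forall>z\<in>M. z \<in> elts p \<longleftrightarrow> (\<forall>w\<in>M. w \<in> elts z \<longrightarrow> w \<in> elts a))"

definition ax_infinity :: "hc set \<Rightarrow> bool" where
  "ax_infinity M \<longleftrightarrow>
     (\<exists>w\<in>M. (\<exists>z\<in>M. z \<in> elts w \<and> (\<forall>u\<in>M. u \<notin> elts z)) \<and>
       (\<forall>x\<in>M. x \<in> elts w \<longrightarrow>
         (\<exists>y\<in>M. y \<in> elts w \<and> (\<forall>z\<in>M. z \<in> elts y \<longleftrightarrow> z \<in> elts x \<or> z = x))))"

definition ax_separation :: "hc set \<Rightarrow> bool" where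
  "ax_separation M \<longleftrightarrow>
     (\<forall>\<phi> e. range e \<subseteq> M \<longrightarrow>
       (\<forall>a\<in>M. \<exists>b\<in>M. \<forall>z\<in>M. z \<in> elts b \<longleftrightarrow> z \<in> elts a \<and> sat M (e(0 := z)) \<phi>))"

definition ax_replacement :: "hc set \<Rightarrow> bool" where
  "ax_replacement M \<longleftrightarrow>
     (\<forall>\<phi> e. range e \<subseteq> M \<longrightarrow>
       (\<forall>a\<in>M. (\<forall>x\<in>M. x \<in> elts a \<longrightarrow> (\<exists>!y. y \<in> M \<and> sat M (e(0 := x, 1 := y)) \<phi>)) \<longrightarrow>
         (\<exists>b\<in>M. \<forall>y\<in>M. y \<in> elts b \<longleftrightarrow>
           (\<exists>x\<in>M. x \<in> elts a \<and> sat M (e(0 := x, 1 := y)) \<phi>))))"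

text \<open>Choice: every family of nonempty pairwise disjoint sets has a transversal.\<close>

definition ax_choice :: "hc set \<Rightarrow> bool" where
  "ax_choice M \<longleftrightarrow>
     (\<forall>a\<in>M.
       (\<forall>x\<in>M. x \<in> elts a \<longrightarrow> (\<exists>z\<in>M. z \<in> elts x)) \<and>
       (\<forall>x\<in>M. \<forall>y\<in>M. x \<in> elts a \<and> y \<in> elts a \<and> x \<noteq> y \<longrightarrow>
          \<not> (\<exists>z\<in>M. z \<in> elts x \<and> z \<in> elts y)) \<longrightarrow>
       (\<exists>c\<in>M. \<forall>x\<in>M. x \<in> elts a \<longrightarrow> (\<exists>!z. z \<in> M \<and> z \<in> elts x \<and> z \<in> elts c)))"

definition models_ZFC :: "hc set \<Rightarrow> bool" where
  "models_ZFC M \<longleftrightarrow>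
     ax_extensionality M \<and> ax_foundation M \<and> ax_pairing M \<and> ax_union M \<and> ax_powerset M \<and>
     ax_infinity M \<and> ax_separation M \<and> ax_replacement M \<and> ax_choice M"

definition transitive_set :: "hc set \<Rightarrow> bool" where
  "transitive_set M \<longleftrightarrow> (\<forall>x\<in>M. elts x \<subseteq> M)"

definition ctm_ZFC :: "hc set \<Rightarrow> bool" where
  "ctm_ZFC M \<longleftrightarrow> countable M \<and> transitive_set M \<and> models_ZFC M"


section \<open>Generic filters and generic extensions\<close>

definition dense_in :: "'a set \<Rightarrow> ('a \<Rightarrow> 'a \<Rightarrow> bool) \<Rightarrow> 'a set \<Rightarrow> bool" where
  "dense_in P le D \<longleftrightarrow> D \<subseteq> P \<and> (\<forall>p\<in>P. \<exists>d\<in>D. le d p)"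

definition filter_in :: "'a set \<Rightarrow> ('a \<Rightarrow> 'a \<Rightarrow> bool) \<Rightarrow> 'a set \<Rightarrow> bool" where
  "filter_in P le G \<longleftrightarrow>
     G \<subseteq> P \<and> G \<noteq> {} \<and>
     (\<forall>p\<in>G. \<forall>q\<in>P. le p q \<longrightarrow> q \<in> G) \<and>
     (\<forall>p\<in>G. \<forall>q\<in>G. \<exists>r\<in>G. le r p \<and> le r q)"

definition generic_filter :: "hc set \<Rightarrow> hc set \<Rightarrow> (hc \<Rightarrow> hc \<Rightarrow> bool) \<Rightarrow> hc set \<Rightarrow> bool" where
  "generic_filter M P le G \<longleftrightarrow>
     filter_in P le G \<and> (\<forall>D\<in>M. dense_in P le (elts D) \<longrightarrow> G \<inter> elts D \<noteq> {})"

lemma hpair_fst_trancl: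
  assumes "hpair s p \<in> elts t"
  shows "(s, t) \<in> {(x, y). x \<in> elts y}\<^sup>+"
proof -
  have "s \<in> elts (hset {s})" "hset {s} \<in> elts (hpair s p)"
    by (simp_all add: hpair_def)
  then show ?thesis
    using assms
    by (blast intro: r_into_trancl trancl_into_trancl)
qed

text \<open>Evaluation of a name \<open>\<tau>\<close> by a filter \<open>G\<close>:
  \<open>\<tau>\<^sub>G = {\<sigma>\<^sub>G | \<exists>p\<in>G. (\<sigma>, p) \<in> \<tau>}\<close>.\<close>

context
  notes image_cong [fundef_cong]
begin

function name_val :: "hc set \<Rightarrow> hc \<Rightarrow> hc" where
  "name_val G \<tau> = hset ((\<lambda>\<sigma>. name_val G \<sigma>) ` {\<sigma>. \<exists>p\<in>G. hpair \<sigma> p \<in> elts \<tau>})"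
  by pat_completeness auto
termination
  by (relation "inv_image ({(x, y). x \<in> elts y}\<^sup>+) snd")
     (auto intro: wf_trancl wf_elts hpair_fst_trancl)

end

declare name_val.simps [simp del]

lemma elts_name_val:
  "elts (name_val G \<tau>) = {name_val G \<sigma> | \<sigma>. \<exists>p\<in>G. hpair \<sigma> p \<in> elts \<tau>}"
proof -
  have "{\<sigma>. \<exists>p\<in>G. hpair \<sigma> p \<in> elts \<tau>} \<subseteq> (\<lambda>z. SOME s. \<exists>p. z = hpair s p) ` elts \<tau>"
    by (force simp: image_iff)
  then have "countable {\<sigma>. \<exists>p\<in>G. hpair \<sigma> p \<in> elts \<tau>}"
    by (meson countable_elts countable_image countable_subset)
  then show ?thesis
    by (subst name_val.simps) auto
qed

definition generic_extension :: "hc set \<Rightarrow> hc set \<Rightarrow> hc set" where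
  "generic_extension M G = name_val G ` M"


section \<open>Borel codes and random forcing\<close>

text \<open>Points of \<open>2\<^sup>\<omega>\<close> are functions \<open>nat \<Rightarrow> bool\<close>.\<close>

definition cylinder :: "bool list \<Rightarrow> (nat \<Rightarrow> bool) set" where
  "cylinder s = {x. \<forall>i < length s. x i = s ! i}"

datatype borel_code = BCyl "bool list" | BCompl borel_code | BUnion "nat \<Rightarrow> borel_code"

text \<open>The interpretation of a code relative to the set \<open>X\<close> of available reals: \<open>X = UNIV\<close> gives the
  Borel set \<open>B\<close> in \<open>V\<close>, and the set \<open>X\<close> of reals of \<open>M\<close> gives \<open>B\<^sup>M\<close>.\<close>

primrec borel_of :: "(nat \<Rightarrow> bool) set \<Rightarrow> borel_code \<Rightarrow> (nat \<Rightarrow> bool) set" where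
  "borel_of X (BCyl s) = X \<inter> cylinder s"
| "borel_of X (BCompl c) = X - borel_of X c"
| "borel_of X (BUnion f) = (\<Union>n. borel_of X (f n))"

text \<open>Codes as sets, so that it makes sense to say that a code belongs to \<open>M\<close>.\<close>

primrec hcode :: "borel_code \<Rightarrow> hc" where
  "hcode (BCyl s) = hpair (hnat 0) (hstring s)"
| "hcode (BCompl c) = hpair (hnat 1) (hcode c)"
| "hcode (BUnion f) = hpair (hnat 2) (hseq (\<lambda>n. hcode (f n)))"

definition reals_in :: "hc set \<Rightarrow> (nat \<Rightarrow> bool) set" where
  "reals_in M = {x. hreal x \<in> M}"

definition codes_in :: "hc set \<Rightarrow> borel_code set" where
  "codes_in M = {c. hcode c \<in> M}"

text \<open>Lebesgue (product, fair coin) outer measure on \<open>2\<^sup>\<omega>\<close> as computed in \<open>M\<close>: the infimum ranges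
  over those coverings by sequences of cylinders that belong to \<open>M\<close>.\<close>

definition lebesgue_in :: "hc set \<Rightarrow> (nat \<Rightarrow> bool) set \<Rightarrow> ennreal" where
  "lebesgue_in M A =
     Inf {(\<Sum>n. ennreal ((1/2) ^ length (s n))) | s.
            hseq (\<lambda>n. hstring (s n)) \<in> M \<and> A \<subseteq> (\<Union>n. cylinder (s n))}"

text \<open>The condition \<open>B\<^sup>M\<close>, as a set (an element of \<open>M\<close>), given by a code in \<open>M\<close>.\<close>

definition borel_cond :: "hc set \<Rightarrow> borel_code \<Rightarrow> hc" where
  "borel_cond M c = hset (hreal ` borel_of (reals_in M) c)"

definition random_forcing :: "hc set \<Rightarrow> hc set" where
  "random_forcing M =
     {borel_cond M c | c. c \<in> codes_in M \<and> lebesgue_in M (borel_of (reals_in M) c) > 0}"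

definition incl_le :: "hc \<Rightarrow> hc \<Rightarrow> bool" where
  "incl_le p q \<longleftrightarrow> elts p \<subseteq> elts q"

definition random_filter :: "hc set \<Rightarrow> (nat \<Rightarrow> bool) \<Rightarrow> hc set" where
  "random_filter M x =
     {borel_cond M c | c. c \<in> codes_in M \<and> borel_cond M c \<in> random_forcing M \<and>
                          x \<in> borel_of UNIV c}"

definition random_reals :: "hc set \<Rightarrow> (nat \<Rightarrow> bool) set" where
  "random_reals M =
     {x. generic_filter M (random_forcing M) incl_le (random_filter M x)}"

text \<open>\<open>x \<equiv> y\<close> iff \<open>M[x] = M[y]\<close>, where \<open>M[x]\<close> is the extension by the generic filter of \<open>x\<close>.\<close>

definition random_equiv :: "hc set \<Rightarrow> ((nat \<Rightarrow> bool) \<times> (nat \<Rightarrow> bool)) set" where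
  "random_equiv M =
     {(x, y). x \<in> random_reals M \<and> y \<in> random_reals M \<and>
              generic_extension M (random_filter M x) = generic_extension M (random_filter M y)}"


section \<open>Hyperfinite and Frechet amenable equivalence relations\<close>

text \<open>The \<open>\<sigma>\<close>-algebra on \<open>2\<^sup>\<omega>\<close> below is \<open>borel\<close> for the product topology.\<close>

definition hyperfinite_on :: "'a::topological_space set \<Rightarrow> ('a \<times> 'a) set \<Rightarrow> bool" where
  "hyperfinite_on X E \<longleftrightarrow>
     (\<exists>F :: nat \<Rightarrow> ('a \<times> 'a) set.
        (\<forall>n. equiv X (F n) \<and> F n \<in> sets (restrict_space borel (X \<times> X)) \<and>
             (\<forall>x\<in>X. finite (F n `` {x})) \<and> F n \<subseteq> F (Suc n)) \<and>
        E = (\<Union>n. F n))"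

text \<open>Amenability with respect to a filter on \<open>\<nat>\<close> (Jackson--Kechris--Louveau): Borel functions
  \<open>f\<^sub>n : E \<rightarrow> [0,\<infinity>)\<close> such that, writing \<open>f\<^sub>n\<^sup>x(y) = f\<^sub>n(x,y)\<close>, each \<open>f\<^sub>n\<^sup>x\<close> has norm 1 in
  \<open>\<ell>\<^sup>1([x])\<close>, and the \<open>\<ell>\<^sup>1\<close>-distance of \<open>f\<^sub>n\<^sup>x\<close> and \<open>f\<^sub>n\<^sup>y\<close> tends to 0 along the filter
  whenever \<open>x E y\<close>.\<close>

definition amenable_wrt ::
    "nat filter \<Rightarrow> 'a::topological_space set \<Rightarrow> ('a \<times> 'a) set \<Rightarrow> bool" where
  "amenable_wrt \<F> X E \<longleftrightarrow>
     (\<exists>f :: nat \<Rightarrow> 'a \<times> 'a \<Rightarrow> real.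
        (\<forall>n. f n \<in> borel_measurable (restrict_space borel E)) \<and>
        (\<forall>n. \<forall>p\<in>E. 0 \<le> f n p) \<and>
        (\<forall>n. \<forall>x\<in>X. ((\<lambda>z. f n (x, z)) has_sum 1) (E `` {x})) \<and>
        (\<forall>(x, y)\<in>E.
           ((\<lambda>n. \<Sum>\<^sub>\<infinity>z\<in>E `` {x}. \<bar>f n (x, z) - f n (y, z)\<bar>) \<longlongrightarrow> 0) \<F>))"

text \<open>The Frechet sum of filters \<open>\<F>\<^sub>m\<close> on \<open>\<nat>\<close>: a set is large iff for all but finitely many \<open>m\<close> its
  \<open>m\<close>-th section is \<open>\<F>\<^sub>m\<close>-large. It lives on \<open>\<nat> \<times> \<nat>\<close>, which is identified with \<open>\<nat>\<close>.\<close>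

definition frechet_sum :: "(nat \<Rightarrow> nat filter) \<Rightarrow> nat filter" where
  "frechet_sum \<F> =
     Abs_filter (\<lambda>P. \<forall>\<^sub>F m in sequentially. \<forall>\<^sub>F n in \<F> m. P (prod_encode (m, n)))"

lemma eventually_frechet_sum:
  "eventually P (frechet_sum \<F>) \<longleftrightarrow>
     (\<forall>\<^sub>F m in sequentially. \<forall>\<^sub>F n in \<F> m. P (prod_encode (m, n)))"
  unfolding frechet_sum_def
proof (rule eventually_Abs_filter, rule is_filter.intro)
  show "\<forall>\<^sub>F m in sequentially. \<forall>\<^sub>F n in \<F> m. True"
    by simp
next
  fix P Q
  assume "\<forall>\<^sub>F m in sequentially. \<forall>\<^sub>F n in \<F> m. P (prod_encode (m, n))"
    and "\<forall>\<^sub>F m in sequentially. \<forall>\<^sub>F n in \<F> m. Q (prod_encode (m, n))"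
  then show "\<forall>\<^sub>F m in sequentially. \<forall>\<^sub>F n in \<F> m. P (prod_encode (m, n)) \<and> Q (prod_encode (m, n))"
    by eventually_elim (rule eventually_conj)
next
  fix P Q :: "nat \<Rightarrow> bool"
  assume "\<forall>x. P x \<longrightarrow> Q x" and "\<forall>\<^sub>F m in sequentially. \<forall>\<^sub>F n in \<F> m. P (prod_encode (m, n))"
  then show "\<forall>\<^sub>F m in sequentially. \<forall>\<^sub>F n in \<F> m. Q (prod_encode (m, n))"
    by (auto elim!: eventually_mono)
qed

text \<open>\<open>frechet_iterate \<alpha> \<F>\<close>: \<open>\<F>\<close> is an \<open>\<alpha>\<close>-th iterate of the Frechet filter, for a countable von
  Neumann ordinal \<open>\<alpha> \<ge> 1\<close>. At limits, every strictly increasing cofinal sequence is admitted.\<close>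

inductive frechet_iterate :: "hc \<Rightarrow> nat filter \<Rightarrow> bool" where
  one: "frechet_iterate (hnat 1) sequentially"
| succ: "frechet_iterate \<alpha> \<F> \<Longrightarrow> frechet_iterate (hsucc \<alpha>) (frechet_sum (\<lambda>_. \<F>))"
| lim: "(\<And>n. frechet_iterate (\<alpha> n) (\<F> n)) \<Longrightarrow> (\<And>n. \<alpha> n \<in> elts (\<alpha> (Suc n))) \<Longrightarrow>
    frechet_iterate (hset (\<Union>n. elts (\<alpha> n))) (frechet_sum \<F>)"

definition frechet_amenable_on ::
    "'a::topological_space set \<Rightarrow> ('a \<times> 'a) set \<Rightarrow> bool" where
  "frechet_amenable_on X E \<longleftrightarrow> (\<exists>\<alpha> \<F>. frechet_iterate \<alpha> \<F> \<and> amenable_wrt \<F> X E)"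

end

theory Submission
  imports Defs "HOL-Probability.Probability"
begin

text \<open>The random reals form a conull set, and \<open>\<equiv>\<close> is a Borel equivalence relation on it whose classes are
  enumerated by countably many Borel maps \<open>T\<^sub>t\<close>, where \<open>T\<^sub>t x\<close> is the real that the name \<open>t \<in> M\<close> denotes
  in \<open>M[x]\<close>. A permutation of the coordinates that belongs to \<open>M\<close> acts on the conditions and names of \<open>M\<close>,
  hence it preserves \<open>M[x]\<close> for almost every \<open>x\<close>. Three suitable involutions of the coordinates thus
  generate a measure-preserving, almost everywhere free action of
  \<open>\<int>/2 * \<int>/2 * \<int>/2\<close> inside \<open>\<equiv>\<close>. Split each class into pieces \<open>A\<^sub>0, A\<^sub>1, A\<^sub>2\<close>, as seen from \<open>x\<close>, according
  to the letter that a reduced word applies to \<open>x\<close> first. The pieces \<open>A\<^sub>i\<close> seen from \<open>x\<close> and from its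
  image under the \<open>i\<close>-th involution cover the class, so in the mean an almost invariant probability gives
  each \<open>A\<^sub>i\<close> at least about \<open>1/2\<close>. But the three pieces are disjoint. The reverse Fatou
  lemma passes through Frechet sums, which is why iterated Frechet filters do not help.\<close>

section \<open>Definability over a countable transitive model\<close>

text \<open>Conditions are the sets B^M, so every measure argument must pass between B^M and B. No
  forcing theorem is used; the bridge is regularity with compactness. An open set coded in M is a
  set of strings; one that covers the reals of M covers all of 2^omega, by Koenig's lemma in M.
  Every coded Borel set is enclosed between a closed and an open set of M up to measure 2^-k. Hence
  an inclusion that holds in M holds almost everywhere in V. Measure bounds enter M through counting
  strings of a given length, so the arguments inside M need no real arithmetic. Pulling Borel codes
  back along a permutation is avoided too: almost every point of a coded set lies in a closed subset
  coded in M, and on closed sets the permutation acts through strings. Two involutions would not do: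
  they generate the infinite dihedral group, which is amenable, and two pieces of mass 1/2 fit into
  1. With three, an invariance error below 1/4 leaves mass at least 3/8 for each piece, and 9/8 >
  1.\<close>

primrec fm_vars :: "fm \<Rightarrow> nat set" where
  "fm_vars (Mem i j) = {i, j}"
| "fm_vars (Equ i j) = {i, j}"
| "fm_vars (Neg \<phi>) = fm_vars \<phi>"
| "fm_vars (Conj \<phi> \<psi>) = fm_vars \<phi> \<union> fm_vars \<psi>"
| "fm_vars (Exi i \<phi>) = insert i (fm_vars \<phi>)"

primrec fm_rename :: "(nat \<Rightarrow> nat) \<Rightarrow> fm \<Rightarrow> fm" where
  "fm_rename r (Mem i j) = Mem (r i) (r j)"
| "fm_rename r (Equ i j) = Equ (r i) (r j)"
| "fm_rename r (Neg \<phi>) = Neg (fm_rename r \<phi>)"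
| "fm_rename r (Conj \<phi> \<psi>) = Conj (fm_rename r \<phi>) (fm_rename r \<psi>)"
| "fm_rename r (Exi i \<phi>) = Exi (r i) (fm_rename r \<phi>)"

lemma finite_fm_vars: "finite (fm_vars \<phi>)"
  by (induction \<phi>) auto

text \<open>Bound variables are renamed as well, so injectivity on all occurring variables is what
  prevents capture.\<close>

lemma sat_fm_rename:
  "inj_on r (fm_vars \<phi>) \<Longrightarrow> (\<And>n. n \<in> fm_vars \<phi> \<Longrightarrow> e (r n) = e' n) \<Longrightarrow>
    sat M e (fm_rename r \<phi>) \<longleftrightarrow> sat M e' \<phi>"
proof (induction \<phi> arbitrary: e e')
  case (Exi i \<phi>)
  have inj: "inj_on r (fm_vars \<phi>)"
    using Exi.prems(1) by (simp add: inj_on_insert)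
  have "sat M (e(r i := a)) (fm_rename r \<phi>) \<longleftrightarrow> sat M (e'(i := a)) \<phi>" for a
  proof (rule Exi.IH[OF inj])
    fix n assume n: "n \<in> fm_vars \<phi>"
    show "(e(r i := a)) (r n) = (e'(i := a)) n"
      using Exi.prems(1) Exi.prems(2)[of n] n by (auto simp: inj_on_def)
  qed
  then show ?case by simp
next
  case (Conj \<phi> \<psi>)
  have "inj_on r (fm_vars \<phi>)" "inj_on r (fm_vars \<psi>)"
    using Conj.prems(1) by (simp_all add: inj_on_Un)
  then have "sat M e (fm_rename r \<phi>) \<longleftrightarrow> sat M e' \<phi>" "sat M e (fm_rename r \<psi>) \<longleftrightarrow> sat M e' \<psi>"
    using Conj.prems(2) by (auto intro!: Conj.IH)
  then show ?case by simp
next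
  case (Neg \<phi>)
  have "sat M e (fm_rename r \<phi>) \<longleftrightarrow> sat M e' \<phi>"
    by (rule Neg.IH) (use Neg.prems in \<open>simp_all\<close>)
  then show ?case by simp
qed simp_all

locale ctm =
  fixes M :: "hc set"
  assumes ctm: "ctm_ZFC M"
begin

lemma countable_M: "countable M" and trans_M: "transitive_set M" and zfc_M: "models_ZFC M"
  using ctm by (auto simp: ctm_ZFC_def)

lemma elts_in_M: "x \<in> M \<Longrightarrow> y \<in> elts x \<Longrightarrow> y \<in> M"
  using trans_M by (auto simp: transitive_set_def)

lemma M_nonempty: "M \<noteq> {}"
proof -
  have "ax_infinity M" using zfc_M by (simp add: models_ZFC_def)
  then show ?thesis unfolding ax_infinity_def by blast
qed

text \<open>Even variables are the arguments of a predicate, odd variables enumerate all of \<open>M\<close> and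
  serve as parameters.\<close>

definition mix :: "(nat \<Rightarrow> hc) \<Rightarrow> nat \<Rightarrow> hc" where
  "mix e n = (if even n then e (n div 2) else from_nat_into M (n div 2))"

text \<open>Definability over \<open>M\<close> with parameters, as a property of HOL predicates.
  Formulas are hardly ever written out; the closure rules below produce them. Only assignments into
  \<open>M\<close> count.\<close>

definition dfn :: "((nat \<Rightarrow> hc) \<Rightarrow> bool) \<Rightarrow> bool" where
  "dfn P \<longleftrightarrow> (\<exists>\<phi>. \<forall>e. range e \<subseteq> M \<longrightarrow> (P e \<longleftrightarrow> sat M (mix e) \<phi>))"

text \<open>Operations enter through their graphs: the value stands at argument 0 and the arguments
  proper are shifted by one.\<close>

definition dft :: "((nat \<Rightarrow> hc) \<Rightarrow> hc) \<Rightarrow> bool" where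
  "dft t \<longleftrightarrow> (\<forall>e. range e \<subseteq> M \<longrightarrow> t e \<in> M) \<and> dfn (\<lambda>e. e 0 = t (\<lambda>n. e (Suc n)))"

lemma range_case_nat: "a \<in> M \<Longrightarrow> range e \<subseteq> M \<Longrightarrow> range (case_nat a e) \<subseteq> M"
  by (simp add: image_subset_iff split: nat.split)

lemma range_mix: "range e \<subseteq> M \<Longrightarrow> range (mix e) \<subseteq> M"
  using from_nat_into[OF M_nonempty] by (auto simp: mix_def)

lemma dfn_congI:
  assumes "dfn P" "\<And>e. range e \<subseteq> M \<Longrightarrow> P e \<longleftrightarrow> Q e"
  shows "dfn Q"
proof -
  obtain \<phi> where "\<forall>e. range e \<subseteq> M \<longrightarrow> (P e \<longleftrightarrow> sat M (mix e) \<phi>)"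
    using assms(1) unfolding dfn_def by auto
  then have "\<forall>e. range e \<subseteq> M \<longrightarrow> (Q e \<longleftrightarrow> sat M (mix e) \<phi>)"
    using assms(2) by metis
  then show ?thesis unfolding dfn_def by (rule exI)
qed

lemma dfn_var_mem: "dfn (\<lambda>e. e i \<in> elts (e j))"
  unfolding dfn_def by (rule exI[of _ "Mem (2 * i) (2 * j)"]) (simp add: mix_def)

lemma dfn_var_eq: "dfn (\<lambda>e. e i = e j)"
  unfolding dfn_def by (rule exI[of _ "Equ (2 * i) (2 * j)"]) (simp add: mix_def)

lemma dfn_not:
  assumes "dfn P" shows "dfn (\<lambda>e. \<not> P e)"
proof -
  obtain \<phi> where "\<forall>e. range e \<subseteq> M \<longrightarrow> (P e \<longleftrightarrow> sat M (mix e) \<phi>)"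
    using assms unfolding dfn_def by auto
  then show ?thesis unfolding dfn_def by (intro exI[of _ "Neg \<phi>"]) simp
qed

lemma dfn_conj:
  assumes "dfn P" "dfn Q" shows "dfn (\<lambda>e. P e \<and> Q e)"
proof -
  obtain \<phi> \<psi> where "\<forall>e. range e \<subseteq> M \<longrightarrow> (P e \<longleftrightarrow> sat M (mix e) \<phi>)"
      "\<forall>e. range e \<subseteq> M \<longrightarrow> (Q e \<longleftrightarrow> sat M (mix e) \<psi>)"
    using assms unfolding dfn_def by auto
  then show ?thesis unfolding dfn_def by (intro exI[of _ "Conj \<phi> \<psi>"]) simp
qed

lemma dfn_disj:
  assumes "dfn P" "dfn Q" shows "dfn (\<lambda>e. P e \<or> Q e)"
proof -
  have "dfn (\<lambda>e. \<not> (\<not> P e \<and> \<not> Q e))" by (intro dfn_not dfn_conj assms)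
  then show ?thesis by simp
qed

lemma dfn_imp:
  assumes "dfn P" "dfn Q" shows "dfn (\<lambda>e. P e \<longrightarrow> Q e)"
  unfolding imp_conv_disj by (intro dfn_not dfn_disj assms)

lemma dfn_iff:
  assumes "dfn P" "dfn Q" shows "dfn (\<lambda>e. P e \<longleftrightarrow> Q e)"
  unfolding iff_conv_conj_imp by (intro dfn_conj dfn_imp assms)

lemma dfn_rename:
  assumes "inj r" "dfn P"
  shows "dfn (\<lambda>e. P (\<lambda>n. e (r n)))"
proof -
  obtain \<phi> where \<phi>: "\<And>e. range e \<subseteq> M \<Longrightarrow> P e \<longleftrightarrow> sat M (mix e) \<phi>"
    using assms(2) unfolding dfn_def by blast
  \<comment> \<open>Arguments live at even variables, so only these move; the odd ones keep their
    parameters.\<close>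
  define \<rho> where "\<rho> n = (if even n then 2 * r (n div 2) else n)" for n
  have inj: "inj \<rho>"
  proof (rule injI)
    fix a b assume "\<rho> a = \<rho> b"
    moreover have "even (\<rho> n) \<longleftrightarrow> even n" for n by (simp add: \<rho>_def)
    ultimately have "even a \<longleftrightarrow> even b" by metis
    then show "a = b"
      using \<open>\<rho> a = \<rho> b\<close> injD[OF assms(1), of "a div 2" "b div 2"]
      by (cases "even a") (auto simp: \<rho>_def elim!: evenE)
  qed
  show ?thesis unfolding dfn_def
  proof (intro exI allI impI)
    fix e :: "nat \<Rightarrow> hc" assume "range e \<subseteq> M"
    then have "P (\<lambda>n. e (r n)) \<longleftrightarrow> sat M (mix (\<lambda>n. e (r n))) \<phi>"
      by (intro \<phi>) auto
    also have "\<dots> \<longleftrightarrow> sat M (mix e) (fm_rename \<rho> \<phi>)"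
    proof (rule sat_fm_rename[symmetric])
      show "inj_on \<rho> (fm_vars \<phi>)" by (rule inj_on_subset[OF inj]) simp
      show "mix e (\<rho> n) = mix (\<lambda>n. e (r n)) n" for n by (simp add: mix_def \<rho>_def)
    qed
    finally show "P (\<lambda>n. e (r n)) \<longleftrightarrow> sat M (mix e) (fm_rename \<rho> \<phi>)" .
  qed
qed

lemma dfn_ex:
  assumes "dfn (\<lambda>e. Q (e 0) (\<lambda>n. e (Suc n)))"
  shows "dfn (\<lambda>e. \<exists>a\<in>M. Q a e)"
proof -
  obtain \<phi> where \<phi>: "\<And>e. range e \<subseteq> M \<Longrightarrow> Q (e 0) (\<lambda>n. e (Suc n)) \<longleftrightarrow> sat M (mix e) \<phi>"
    using assms unfolding dfn_def by blast
  obtain N where N: "\<And>n. n \<in> fm_vars \<phi> \<Longrightarrow> n < 2 * N"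
    using finite_fm_vars[of \<phi>] unfolding finite_nat_set_iff_bounded
    by (metis less_le_trans mult_2 le_add1)
  \<comment> \<open>The formula quantifies over a fresh even variable \<open>2 * N\<close>, which
    takes the role of argument 0. The other arguments move down one place, that is, by 2.\<close>
  define \<rho> where "\<rho> n = (if n = 0 then 2 * N else if even n then n - 2 else n)" for n :: nat
  have inj: "inj_on \<rho> (fm_vars \<phi>)"
  proof (rule inj_onI)
    fix a b assume "a \<in> fm_vars \<phi>" "b \<in> fm_vars \<phi>" "\<rho> a = \<rho> b"
    then have ab: "a < 2 * N" "b < 2 * N" "\<rho> a = \<rho> b" using N by auto
    have "even (\<rho> n) \<longleftrightarrow> even n" for n by (auto simp: \<rho>_def)
    then have "even a \<longleftrightarrow> even b" using ab(3) by metis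
    moreover have "n \<ge> 2" if "n \<noteq> 0" "even n" for n :: nat using that by presburger
    ultimately show "a = b"
      using ab by (cases "a = 0"; cases "b = 0"; cases "even a") (fastforce simp: \<rho>_def)+
  qed
  show ?thesis unfolding dfn_def
  proof (intro exI allI impI)
    fix e :: "nat \<Rightarrow> hc" assume e: "range e \<subseteq> M"
    have "Q a e \<longleftrightarrow> sat M ((mix e)(2 * N := a)) (fm_rename \<rho> \<phi>)" if "a \<in> M" for a
    proof -
      have "range (case_nat a e) \<subseteq> M" using e that by (intro range_case_nat) auto
      from \<phi>[OF this] have "Q a e \<longleftrightarrow> sat M (mix (case_nat a e)) \<phi>" by simp
      also have "\<dots> \<longleftrightarrow> sat M ((mix e)(2 * N := a)) (fm_rename \<rho> \<phi>)"
      proof (rule sat_fm_rename[symmetric, OF inj])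
        fix n assume "n \<in> fm_vars \<phi>"
        then have "n < 2 * N" by (rule N)
        moreover have "n div 2 = Suc ((n - 2) div 2)" if "n \<noteq> 0" "even n"
          using that by presburger
        ultimately show "((mix e)(2 * N := a)) (\<rho> n) = mix (case_nat a e) n"
          by (auto simp: \<rho>_def mix_def)
      qed
      finally show ?thesis .
    qed
    then show "(\<exists>a\<in>M. Q a e) \<longleftrightarrow> sat M (mix e) (Exi (2 * N) (fm_rename \<rho> \<phi>))"
      by simp
  qed
qed

lemma dfn_all:
  assumes "dfn (\<lambda>e. Q (e 0) (\<lambda>n. e (Suc n)))"
  shows "dfn (\<lambda>e. \<forall>a\<in>M. Q a e)"
proof -
  have "dfn (\<lambda>e. \<exists>a\<in>M. \<not> Q a e)"
    by (rule dfn_ex, rule dfn_not, rule assms)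
  from dfn_not[OF this] show ?thesis by simp
qed

lemma dft_in_M: "dft t \<Longrightarrow> range e \<subseteq> M \<Longrightarrow> t e \<in> M"
  by (simp add: dft_def)

lemma dft_var: "dft (\<lambda>e. e i)"
  unfolding dft_def by (auto intro: dfn_var_eq)

lemma dft_const:
  assumes "c \<in> M"
  shows "dft (\<lambda>e. c)"
proof -
  have "range (from_nat_into M) = M"
    using M_nonempty countable_M by (rule range_from_nat_into)
  then obtain k where k: "c = from_nat_into M k" using assms by blast
  \<comment> \<open>The odd variable \<open>2 * k + 1\<close> always holds the \<open>k\<close>-th
    element of \<open>M\<close>.\<close>
  have "dfn (\<lambda>e. e 0 = c)" unfolding dfn_def
    by (rule exI[of _ "Equ 0 (Suc (2 * k))"]) (simp add: mix_def k)
  then show ?thesis using assms by (simp add: dft_def)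
qed

lemma dfn_shift: "dfn P \<Longrightarrow> dfn (\<lambda>e. P (\<lambda>n. e (Suc n)))"
  by (rule dfn_rename) simp_all

lemma dfn_eq_var: "dft t \<Longrightarrow> dfn (\<lambda>e. e 0 = t (\<lambda>n. e (Suc n)))"
  by (simp add: dft_def)

lemma dft_rename:
  assumes "inj r" "dft t"
  shows "dft (\<lambda>e. t (\<lambda>n. e (r n)))"
proof -
  let ?r = "\<lambda>n. case n of 0 \<Rightarrow> 0 | Suc n \<Rightarrow> Suc (r n)"
  have "inj ?r"
  proof (rule injI)
    fix a b assume "?r a = ?r b"
    then show "a = b" using injD[OF assms(1)] by (cases a; cases b) auto
  qed
  from dfn_rename[OF this dfn_eq_var[OF assms(2)]]
  have "dfn (\<lambda>e. e 0 = t (\<lambda>n. e (Suc (r n))))" by simp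
  moreover have "t (\<lambda>n. e (r n)) \<in> M" if "range e \<subseteq> M" for e
    using that by (intro dft_in_M[OF assms(2)]) auto
  ultimately show ?thesis by (simp add: dft_def)
qed

lemma dft_shift: "dft t \<Longrightarrow> dft (\<lambda>e. t (\<lambda>n. e (Suc n)))"
  by (rule dft_rename) simp_all

text \<open>The language has no terms: the value of \<open>t\<close> is introduced by a quantifier
  over \<open>M\<close>, which is correct because the value lies in \<open>M\<close>.\<close>

lemma dfn_subst:
  assumes "dft t" "dfn (\<lambda>e. Q (e 0) (\<lambda>n. e (Suc n)))"
  shows "dfn (\<lambda>e. Q (t e) e)"
proof -
  have "dfn (\<lambda>e. \<exists>a\<in>M. a = t e \<and> Q a e)"
    by (intro dfn_ex dfn_conj assms dfn_eq_var)
  moreover have "(\<exists>a\<in>M. a = t e \<and> Q a e) \<longleftrightarrow> Q (t e) e" if "range e \<subseteq> M" for e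
    using dft_in_M[OF assms(1) that] by auto
  ultimately show ?thesis by (rule dfn_congI)
qed

lemma dfn_subst1: "dfn (\<lambda>e. R (e 0)) \<Longrightarrow> dft s \<Longrightarrow> dfn (\<lambda>e. R (s e))"
  by (rule dfn_subst) 

lemma dfn_subst2:
  assumes "dfn (\<lambda>e. R (e 0) (e 1))" "dft s" "dft t"
  shows "dfn (\<lambda>e. R (s e) (t e))"
proof -
  have "dfn (\<lambda>e. R (e (Suc 0)) (e 0))"
  proof -
    let ?r = "\<lambda>n::nat. if n = 0 then 1 else if n = 1 then 0 else n"
    have "inj ?r" by (auto simp: inj_def)
    from dfn_rename[OF this assms(1)] show ?thesis by simp
  qed
  from dfn_rename[of "\<lambda>n::nat. if n = 0 then 0 else Suc n", OF _ this]
  have *: "dfn (\<lambda>e. R (e 2) (e 0))" by (auto simp: inj_def numeral_2_eq_2)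
  have "dfn (\<lambda>e. R (e 0) (t (\<lambda>n. e (Suc n))))"
  proof (rule dfn_subst[where Q = "\<lambda>b e. R (e 0) b" and t = "\<lambda>e. t (\<lambda>n. e (Suc n))"])
    show "dft (\<lambda>e. t (\<lambda>n. e (Suc n)))" by (rule dft_shift) fact
    show "dfn (\<lambda>e. R (e (Suc 0)) (e 0))" by fact
  qed
  from dfn_subst[where Q = "\<lambda>b e. R b (t e)", OF assms(2) this] show ?thesis .
qed

lemma dfn_mem: "dft s \<Longrightarrow> dft t \<Longrightarrow> dfn (\<lambda>e. s e \<in> elts (t e))"
  by (rule dfn_subst2[where R = "\<lambda>a b. a \<in> elts b", OF dfn_var_mem])

lemma dfn_eq: "dft s \<Longrightarrow> dft t \<Longrightarrow> dfn (\<lambda>e. s e = t e)"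
  by (rule dfn_subst2[where R = "\<lambda>a b. a = b", OF dfn_var_eq])

lemma dfn_bex:
  assumes "dft t" "dfn (\<lambda>e. Q (e 0) (\<lambda>n. e (Suc n)))"
  shows "dfn (\<lambda>e. \<exists>a\<in>elts (t e). Q a e)"
proof -
  have "dfn (\<lambda>e. \<exists>a\<in>M. a \<in> elts (t e) \<and> Q a e)"
    by (rule dfn_ex, rule dfn_conj, rule dfn_mem, rule dft_var, rule dft_shift, rule assms(1), rule assms(2))
  moreover have "(\<exists>a\<in>M. a \<in> elts (t e) \<and> Q a e) \<longleftrightarrow> (\<exists>a\<in>elts (t e). Q a e)" if "range e \<subseteq> M" for e
    using dft_in_M[OF assms(1) that] elts_in_M by blast
  ultimately show ?thesis by (rule dfn_congI)
qed

lemma dfn_ball: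
  assumes "dft t" "dfn (\<lambda>e. Q (e 0) (\<lambda>n. e (Suc n)))"
  shows "dfn (\<lambda>e. \<forall>a\<in>elts (t e). Q a e)"
proof -
  have "dfn (\<lambda>e. \<exists>a\<in>elts (t e). \<not> Q a e)"
    by (rule dfn_bex, rule assms(1), rule dfn_not, rule assms(2))
  from dfn_not[OF this] show ?thesis by simp
qed

lemma dfn_subset:
  assumes "dft s" "dft t"
  shows "dfn (\<lambda>e. elts (s e) \<subseteq> elts (t e))"
  unfolding subset_iff Ball_def[symmetric]
  by (rule dfn_ball, rule assms(1), rule dfn_mem, rule dft_var, rule dft_shift, rule assms(2))

section \<open>Separation and replacement for definable predicates\<close>

lemma separation:
  assumes "dfn (\<lambda>e. Q (e 0) (\<lambda>n. e (Suc n)))" "a \<in> M" "range e \<subseteq> M"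
  shows "hset {z \<in> elts a. Q z e} \<in> M"
proof -
  obtain \<phi> where \<phi>: "\<And>e. range e \<subseteq> M \<Longrightarrow> Q (e 0) (\<lambda>n. e (Suc n)) \<longleftrightarrow> sat M (mix e) \<phi>"
    using assms(1) unfolding dfn_def by auto
  \<comment> \<open>The entry \<open>a\<close> at place 0 is a placeholder that the axiom overwrites
    with \<open>z\<close>.\<close>
  define e0 where "e0 = mix (case_nat a e)"
  have "range e0 \<subseteq> M" unfolding e0_def using assms(2,3) by (intro range_mix range_case_nat)
  moreover have "ax_separation M" using zfc_M by (simp add: models_ZFC_def)
  ultimately have "\<exists>b\<in>M. \<forall>z\<in>M. z \<in> elts b \<longleftrightarrow> z \<in> elts a \<and> sat M (e0(0 := z)) \<phi>"
    using assms(2) unfolding ax_separation_def by simp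
  then obtain b where b: "b \<in> M" "\<And>z. z \<in> M \<Longrightarrow> z \<in> elts b \<longleftrightarrow> z \<in> elts a \<and> sat M (e0(0 := z)) \<phi>"
    by auto
  have "sat M (e0(0 := z)) \<phi> \<longleftrightarrow> Q z e" if "z \<in> M" for z
  proof -
    have "e0(0 := z) = mix (case_nat z e)"
      by (rule ext) (auto simp: e0_def mix_def elim!: evenE split: nat.split)
    moreover have "range (case_nat z e) \<subseteq> M"
      using that assms(3) by (intro range_case_nat)
    ultimately show ?thesis using \<phi>[of "case_nat z e"] by simp
  qed
  then have "z \<in> elts b \<longleftrightarrow> z \<in> elts a \<and> Q z e" for z
    using b elts_in_M[OF b(1), of z] elts_in_M[OF assms(2), of z] by metis
  then have "elts b = {z \<in> elts a. Q z e}" by auto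
  then show ?thesis using b(1) by (metis hset_elts)
qed

lemma replacement:
  assumes "dfn (\<lambda>e. R (e 0) (e 1) (\<lambda>n. e (Suc (Suc n))))" "a \<in> M" "range e \<subseteq> M"
    and "\<And>x. x \<in> elts a \<Longrightarrow> \<exists>!y. y \<in> M \<and> R x y e"
  shows "hset {y \<in> M. \<exists>x\<in>elts a. R x y e} \<in> M"
proof -
  obtain \<phi> where \<phi>: "\<And>e. range e \<subseteq> M \<Longrightarrow> R (e 0) (e 1) (\<lambda>n. e (Suc (Suc n))) \<longleftrightarrow> sat M (mix e) \<phi>"
    using assms(1) unfolding dfn_def by auto
  \<comment> \<open>The axiom speaks about variables 0 and 1, but arguments 0 and 1 sit at the even
    variables 0 and 2, and variable 1 is a parameter. Hence the swap of 1 and 2.\<close>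
  define \<rho> where "\<rho> = (\<lambda>n::nat. if n = 1 then 2 else if n = 2 then 1 else n)"
  have inj: "inj \<rho>" by (auto simp: inj_def \<rho>_def)
  define e0 where "e0 n = mix (case_nat a (case_nat a e)) (\<rho> n)" for n
  have "range (mix (case_nat a (case_nat a e))) \<subseteq> M"
    using assms(2,3) by (intro range_mix range_case_nat)
  then have "range e0 \<subseteq> M" unfolding e0_def by auto
  moreover have "ax_replacement M" using zfc_M by (simp add: models_ZFC_def)
  ultimately have ax: "(\<And>x. x \<in> M \<Longrightarrow> x \<in> elts a \<Longrightarrow> (\<exists>!y. y \<in> M \<and> sat M (e0(0 := x, 1 := y)) (fm_rename \<rho> \<phi>))) \<Longrightarrow>
      \<exists>b\<in>M. \<forall>y\<in>M. y \<in> elts b \<longleftrightarrow> (\<exists>x\<in>M. x \<in> elts a \<and> sat M (e0(0 := x, 1 := y)) (fm_rename \<rho> \<phi>))"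
    using assms(2) unfolding ax_replacement_def by simp
  have R: "sat M (e0(0 := x, 1 := y)) (fm_rename \<rho> \<phi>) \<longleftrightarrow> R x y e" if "x \<in> M" "y \<in> M" for x y
  proof -
    let ?e = "case_nat x (case_nat y e)"
    have "sat M (e0(0 := x, 1 := y)) (fm_rename \<rho> \<phi>) \<longleftrightarrow> sat M (mix ?e) \<phi>"
    proof (rule sat_fm_rename)
      show "inj_on \<rho> (fm_vars \<phi>)" using inj by (rule inj_on_subset) simp
      fix n
      consider "n = 0" | "n = 1" | "n = 2" | "odd n" "n \<noteq> 1" | k where "n = 2 * Suc (Suc k)"
        by (metis evenE not0_implies_Suc mult_0_right mult.right_neutral One_nat_def)
      then show "(e0(0 := x, 1 := y)) (\<rho> n) = mix ?e n"
        by cases (auto simp: e0_def mix_def \<rho>_def)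
    qed
    moreover have "range ?e \<subseteq> M"
      using that assms(3) by (intro range_case_nat)
    ultimately show ?thesis using \<phi>[of ?e] by simp
  qed
  have "\<exists>b\<in>M. \<forall>y\<in>M. y \<in> elts b \<longleftrightarrow> (\<exists>x\<in>M. x \<in> elts a \<and> sat M (e0(0 := x, 1 := y)) (fm_rename \<rho> \<phi>))"
  proof (rule ax)
    fix x assume "x \<in> M" "x \<in> elts a"
    then show "\<exists>!y. y \<in> M \<and> sat M (e0(0 := x, 1 := y)) (fm_rename \<rho> \<phi>)"
      using assms(4)[of x] R[OF \<open>x \<in> M\<close>] by metis
  qed
  then obtain b where b: "b \<in> M" "\<And>y. y \<in> M \<Longrightarrow> y \<in> elts b \<longleftrightarrow>
      (\<exists>x\<in>M. x \<in> elts a \<and> sat M (e0(0 := x, 1 := y)) (fm_rename \<rho> \<phi>))"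
    by auto
  have "y \<in> elts b \<longleftrightarrow> y \<in> M \<and> (\<exists>x\<in>elts a. R x y e)" for y
    using b(2)[of y] elts_in_M[OF b(1), of y] elts_in_M[OF assms(2)] R[of _ y] by metis
  then have "elts b = {y \<in> M. \<exists>x\<in>elts a. R x y e}" by auto
  then show ?thesis using b(1) by (metis hset_elts)
qed

named_theorems dfn_intros

lemma dft_graphI:
  assumes "\<And>e. range e \<subseteq> M \<Longrightarrow> t e \<in> M"
    and "dfn (\<lambda>e. R (e 0) (\<lambda>n. e (Suc n)))"
    and "\<And>e y. range e \<subseteq> M \<Longrightarrow> y \<in> M \<Longrightarrow> R y e \<longleftrightarrow> y = t e"
  shows "dft t"
proof -
  have "dfn (\<lambda>e. e 0 = t (\<lambda>n. e (Suc n)))"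
    using assms(2)
  proof (rule dfn_congI)
    fix e :: "nat \<Rightarrow> hc" assume "range e \<subseteq> M"
    then show "R (e 0) (\<lambda>n. e (Suc n)) \<longleftrightarrow> e 0 = t (\<lambda>n. e (Suc n))"
      by (intro assms(3)) auto
  qed
  with assms(1) show ?thesis unfolding dft_def by simp
qed

text \<open>An element of the transitive \<open>M\<close> is determined by its members in
  \<open>M\<close>, so definable membership yields a definable graph. Most set constructions enter
  the calculus this way.\<close>

lemma dft_eltsI:
  assumes "\<And>e. range e \<subseteq> M \<Longrightarrow> t e \<in> M"
    and "dfn (\<lambda>e. Q (e 0) (\<lambda>n. e (Suc n)))"
    and "\<And>e z. range e \<subseteq> M \<Longrightarrow> z \<in> M \<Longrightarrow> z \<in> elts (t e) \<longleftrightarrow> Q z e"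
  shows "dft t"
  using assms(1)
proof (rule dft_graphI)
  let ?r = "\<lambda>n. case n of 0 \<Rightarrow> 0 | Suc n \<Rightarrow> Suc (Suc n)"
  have "inj ?r" by (auto simp: inj_def split: nat.split_asm)
  from dfn_rename[OF this assms(2)]
  have Q: "dfn (\<lambda>e. Q (e 0) (\<lambda>n. e (Suc (Suc n))))" by simp
  show "dfn (\<lambda>e. \<forall>z\<in>M. z \<in> elts (e 0) \<longleftrightarrow> Q z (\<lambda>n. e (Suc n)))"
    by (rule dfn_all, rule dfn_iff, rule dfn_var_mem, rule Q)
  fix e :: "nat \<Rightarrow> hc" and y assume e: "range e \<subseteq> M" and y: "y \<in> M"
  have "(\<forall>z\<in>M. z \<in> elts y \<longleftrightarrow> Q z e) \<longleftrightarrow> elts y = elts (t e)"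
    using assms(3)[OF e] elts_in_M[OF y] elts_in_M[OF assms(1)[OF e]] by (metis subset_antisym subsetI)
  then show "(\<forall>z\<in>M. z \<in> elts y \<longleftrightarrow> Q z e) \<longleftrightarrow> y = t e"
    using hc_ext by metis
qed

lemma dft_closed: "dft (\<lambda>e. c) \<Longrightarrow> c \<in> M"
  using M_nonempty by (auto simp: dft_def)

lemma dft_subst1:
  assumes "dft (\<lambda>e. f (e 0))" "dft s"
  shows "dft (\<lambda>e. f (s e))"
proof (rule dft_graphI)
  show "f (s e) \<in> M" if "range e \<subseteq> M" for e
    using dft_in_M[OF assms(1), of "\<lambda>_. s e"] dft_in_M[OF assms(2) that] by auto
  have "dfn (\<lambda>e. e 0 = f (e 1))" using dfn_eq_var[OF assms(1)] by simp
  then show "dfn (\<lambda>e. e 0 = f (s (\<lambda>n. e (Suc n))))"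
    by (rule dfn_subst2[where R = "\<lambda>a b. a = f b"]) (rule dft_var, rule dft_shift[OF assms(2)])
qed simp

lemma dfn_subst3:
  assumes "dfn (\<lambda>e. R (e 0) (e 1) (e 2))" "dft s" "dft t" "dft u"
  shows "dfn (\<lambda>e. R (s e) (t e) (u e))"
proof -
  let ?r = "\<lambda>n::nat. if n = 0 then 2 else if n = 1 then 1 else if n = 2 then 0 else n"
  have "inj ?r" by (auto simp: inj_def)
  from dfn_rename[OF this assms(1)] have "dfn (\<lambda>e. R (e (Suc (Suc 0))) (e (Suc 0)) (e 0))"
    by (simp add: numeral_2_eq_2)
  then have "dfn (\<lambda>e. R (e (Suc 0)) (e 0) (u (\<lambda>n. e (Suc (Suc n)))))"
    by (rule dfn_subst[where Q = "\<lambda>c e. R (e (Suc 0)) (e 0) c" and t = "\<lambda>e. u (\<lambda>n. e (Suc (Suc n)))", rotated])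
      (rule dft_rename[of "\<lambda>n. Suc (Suc n)", OF _ assms(4)], simp add: inj_def)
  then have "dfn (\<lambda>e. R (e 0) (t (\<lambda>n. e (Suc n))) (u (\<lambda>n. e (Suc n))))"
    by (rule dfn_subst[where Q = "\<lambda>c e. R (e 0) c (u (\<lambda>n. e (Suc n)))" and t = "\<lambda>e. t (\<lambda>n. e (Suc n))", rotated])
      (rule dft_shift[OF assms(3)])
  then show ?thesis
    by (rule dfn_subst[where Q = "\<lambda>c e. R c (t e) (u e)", rotated]) (rule assms(2))
qed

lemma dft_subst2:
  assumes "dft (\<lambda>e. f (e 0) (e 1))" "dft s" "dft t"
  shows "dft (\<lambda>e. f (s e) (t e))"
proof (rule dft_graphI)
  show "f (s e) (t e) \<in> M" if "range e \<subseteq> M" for e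
    using dft_in_M[OF assms(1), of "case_nat (s e) (\<lambda>_. t e)"] dft_in_M[OF assms(2) that] dft_in_M[OF assms(3) that]
    by (simp add: range_case_nat)
  have "dfn (\<lambda>e. e 0 = f (e 1) (e 2))" using dfn_eq_var[OF assms(1)] by (simp add: numeral_2_eq_2)
  then show "dfn (\<lambda>e. e 0 = f (s (\<lambda>n. e (Suc n))) (t (\<lambda>n. e (Suc n))))"
    by (rule dfn_subst3[where R = "\<lambda>a b c. a = f b c"])
      (rule dft_var, rule dft_shift[OF assms(2)], rule dft_shift[OF assms(3)])
qed simp

lemma dft_if [dfn_intros]:
  assumes "dfn P" "dft s" "dft t"
  shows "dft (\<lambda>e. if P e then s e else t e)"
proof (rule dft_graphI)
  show "(if P e then s e else t e) \<in> M" if "range e \<subseteq> M" for e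
    using dft_in_M[OF assms(2) that] dft_in_M[OF assms(3) that] by simp
  show "dfn (\<lambda>e. P (\<lambda>n. e (Suc n)) \<and> e 0 = s (\<lambda>n. e (Suc n)) \<or> \<not> P (\<lambda>n. e (Suc n)) \<and> e 0 = t (\<lambda>n. e (Suc n)))"
    by (intro dfn_disj dfn_conj dfn_not dfn_shift[OF assms(1)] dfn_eq_var assms)
qed auto

lemmas [dfn_intros] = dfn_not dfn_conj dfn_disj dfn_imp dfn_iff dfn_ex dfn_all dfn_bex dfn_ball
  dfn_mem dfn_eq dfn_subset dft_var

lemma countable_sep [simp]: "countable {z \<in> elts a. P z}"
  by (rule countable_subset[OF _ countable_elts[of a]]) auto

lemma dft_sep [dfn_intros]:
  assumes "dft t" "dfn (\<lambda>e. Q (e 0) (\<lambda>n. e (Suc n)))"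
  shows "dft (\<lambda>e. hset {z \<in> elts (t e). Q z e})"
proof (rule dft_eltsI)
  show "hset {z \<in> elts (t e). Q z e} \<in> M" if "range e \<subseteq> M" for e
    using assms(2) dft_in_M[OF assms(1) that] that by (rule separation)
  show "dfn (\<lambda>e. e 0 \<in> elts (t (\<lambda>n. e (Suc n))) \<and> Q (e 0) (\<lambda>n. e (Suc n)))"
    by (rule dfn_conj, rule dfn_mem, rule dft_var, rule dft_shift, rule assms(1), rule assms(2))
qed simp

text \<open>Replacement for a definable function instead of a relation, so that uniqueness of values
  is automatic; with \<open>dft_sep\<close> it makes set-builder terms definable.\<close>

lemma dft_repl [dfn_intros]:
  assumes "dft t" "dft (\<lambda>e. f (e 0) (\<lambda>n. e (Suc n)))"
  shows "dft (\<lambda>e. hset ((\<lambda>z. f z e) ` elts (t e)))"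
proof (rule dft_eltsI)
  have f: "f z e \<in> M" if "range e \<subseteq> M" "z \<in> M" for e z
    using dft_in_M[OF assms(2), of "case_nat z e"] that by (simp add: range_case_nat)
  have d: "dfn (\<lambda>e. e 0 = f (e 1) (\<lambda>n. e (Suc (Suc n))))"
    using dfn_eq_var[OF assms(2)] by simp
  let ?r = "\<lambda>n::nat. if n = 0 then 1 else if n = 1 then 0 else n"
  have "inj ?r" by (auto simp: inj_def)
  from dfn_rename[OF this d] have d': "dfn (\<lambda>e. e 1 = f (e 0) (\<lambda>n. e (Suc (Suc n))))" by simp
  show "hset ((\<lambda>z. f z e) ` elts (t e)) \<in> M" if e: "range e \<subseteq> M" for e
  proof -
    have t: "t e \<in> M" using dft_in_M[OF assms(1) e] .
    have "hset {y \<in> M. \<exists>x\<in>elts (t e). y = f x e} \<in> M"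
      by (rule replacement[OF d' t e]) (use f[OF e elts_in_M[OF t]] in auto)
    moreover have "{y \<in> M. \<exists>x\<in>elts (t e). y = f x e} = (\<lambda>z. f z e) ` elts (t e)"
      using f[OF e elts_in_M[OF t]] by auto
    ultimately show ?thesis by simp
  qed
  show "dfn (\<lambda>e. \<exists>x\<in>elts (t (\<lambda>n. e (Suc n))). e 0 = f x (\<lambda>n. e (Suc n)))"
    by (rule dfn_bex, rule dft_shift, rule assms(1)) (use d' in simp)
  fix e :: "nat \<Rightarrow> hc" and z
  show "z \<in> elts (hset ((\<lambda>z. f z e) ` elts (t e))) \<longleftrightarrow> (\<exists>x\<in>elts (t e). z = f x e)" by auto
qed

end

section \<open>Set theory inside the model\<close>

abbreviation hmem :: "(hc \<times> hc) set" where
  "hmem \<equiv> {(x, y). x \<in> elts y}"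

definition hup :: "hc \<Rightarrow> hc \<Rightarrow> hc" where "hup a b = hset {a, b}"
definition hUnion :: "hc \<Rightarrow> hc" where "hUnion a = hset (\<Union>x\<in>elts a. elts x)"
definition hUn :: "hc \<Rightarrow> hc \<Rightarrow> hc" where "hUn a b = hset (elts a \<union> elts b)"

text \<open>Here \<open>hUnion\<close> plays the role of a description operator: the union of a singleton is its element.\<close>

definition hfst :: "hc \<Rightarrow> hc" where
  "hfst z = hUnion (hset {a \<in> elts (hUnion z). \<exists>b\<in>elts (hUnion z). z = hpair a b})"
definition hsnd :: "hc \<Rightarrow> hc" where
  "hsnd z = hUnion (hset {b \<in> elts (hUnion z). \<exists>a\<in>elts (hUnion z). z = hpair a b})"

definition happ :: "hc \<Rightarrow> hc \<Rightarrow> hc" where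
  "happ f y = hUnion (hset {v \<in> elts (hUnion (hUnion f)). hpair y v \<in> elts f})"

definition homega :: hc where "homega = hset (range hnat)"

lemma elts_hup [simp]: "elts (hup a b) = {a, b}" by (simp add: hup_def)
lemma elts_hUnion [simp]: "elts (hUnion a) = (\<Union>x\<in>elts a. elts x)" by (simp add: hUnion_def)
lemma elts_hUn [simp]: "elts (hUn a b) = elts a \<union> elts b" by (simp add: hUn_def)
lemma elts_hsucc [simp]: "elts (hsucc a) = insert a (elts a)" by (simp add: hsucc_def)
lemma elts_homega [simp]: "elts homega = range hnat" by (simp add: homega_def)
lemma hpair_hup: "hpair a b = hup (hup a a) (hup a b)" by (simp add: hpair_def hup_def)
lemma elts_hpair: "elts (hpair a b) = {hup a a, hup a b}" by (simp add: hpair_hup)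

lemma hUnion_singleton [simp]: "hUnion (hset {a}) = a"
  by (rule hc_ext) simp

lemma hfst_hpair [simp]: "hfst (hpair a b) = a"
proof -
  have "{x \<in> elts (hUnion (hpair a b)). \<exists>y\<in>elts (hUnion (hpair a b)). hpair a b = hpair x y} = {a}"
    by (auto simp: elts_hpair)
  then show ?thesis by (simp only: hfst_def hUnion_singleton)
qed

lemma hsnd_hpair [simp]: "hsnd (hpair a b) = b"
proof -
  have "{x \<in> elts (hUnion (hpair a b)). \<exists>y\<in>elts (hUnion (hpair a b)). hpair a b = hpair y x} = {b}"
    by (auto simp: elts_hpair)
  then show ?thesis by (simp only: hsnd_def hUnion_singleton)
qed

lemma hpair_in_hUnion: "hpair y v \<in> elts f \<Longrightarrow> y \<in> elts (hUnion (hUnion f)) \<and> v \<in> elts (hUnion (hUnion f))"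
  by (auto simp: elts_hpair) (metis elts_hpair elts_hup insertI1 insertI2)+

lemma happ_eq:
  assumes "hpair y v \<in> elts f" "\<And>w. hpair y w \<in> elts f \<Longrightarrow> w = v"
  shows "happ f y = v"
proof -
  have "{w \<in> elts (hUnion (hUnion f)). hpair y w \<in> elts f} = {v}"
    using assms hpair_in_hUnion by blast
  then show ?thesis by (simp only: happ_def hUnion_singleton)
qed

lemma not_mem_self: "x \<notin> elts x"
  using wf_not_refl[OF wf_elts, of x] by simp

lemma elts_hnat: "elts (hnat n) = hnat ` {..<n}"
  by (induction n) (auto simp: lessThan_Suc)

lemma hnat_inject [simp]: "hnat m = hnat n \<longleftrightarrow> m = n"
proof -
  have "hnat m \<noteq> hnat n" if "m < n" for m n
  proof
    assume "hnat m = hnat n"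
    moreover have "hnat m \<in> elts (hnat n)" using that by (simp add: elts_hnat)
    ultimately show False using not_mem_self by metis
  qed
  then show ?thesis by (metis linorder_neqE_nat)
qed

lemma hnat_mem_hnat [simp]: "hnat m \<in> elts (hnat n) \<longleftrightarrow> m < n"
  by (auto simp: elts_hnat)

lemma hUnion_hsucc_hnat [simp]: "hUnion (hnat (Suc n)) = hnat n"
proof (rule hc_ext)
  show "elts (hUnion (hnat (Suc n))) = elts (hnat n)"
    by (auto simp: elts_hnat simp del: hnat.simps)
qed

lemma hbool_inject [simp]: "hbool a = hbool b \<longleftrightarrow> a = b"
  by (auto simp: hbool_def simp del: hnat.simps)

lemma elts_hseq: "elts (hseq f) = range (\<lambda>n. hpair (hnat n) (f n))"
  by (simp add: hseq_def full_SetCompr_eq)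

lemma hpair_hseq [simp]: "hpair (hnat n) v \<in> elts (hseq f) \<longleftrightarrow> v = f n"
  by (auto simp: elts_hseq)

lemma happ_hseq [simp]: "happ (hseq f) (hnat n) = f n"
  by (rule happ_eq) auto

lemma hseq_inject [simp]: "hseq f = hseq g \<longleftrightarrow> f = g"
  by (metis ext happ_hseq)

text \<open>Elements of type \<open>hc\<close> are countable sets, so this allows the graph of a
  recursion on everything below \<open>x\<close> to be one of them.\<close>

lemma countable_below: "countable {y. (y, x) \<in> hmem\<^sup>*}"
proof (induction x rule: wf_induct[OF wf_elts])
  case (1 x)
  have "{y. (y, x) \<in> hmem\<^sup>*} \<subseteq> insert x (\<Union>z\<in>elts x. {y. (y, z) \<in> hmem\<^sup>*})"
    by (auto elim: rtranclE)
  moreover have "countable (insert x (\<Union>z\<in>elts x. {y. (y, z) \<in> hmem\<^sup>*}))"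
    using 1 by auto
  ultimately show ?case by (rule countable_subset)
qed

section \<open>Closure of the model under basic operations and under recursion along
  membership\<close>

context ctm
begin

lemma hup_in_M:
  assumes "a \<in> M" "b \<in> M" shows "hup a b \<in> M"
proof -
  have "ax_pairing M" using zfc_M by (simp add: models_ZFC_def)
  then obtain c where c: "c \<in> M" "\<forall>z\<in>M. z \<in> elts c \<longleftrightarrow> z = a \<or> z = b"
    using assms unfolding ax_pairing_def by metis
  then have "elts c = {a, b}"
    using assms elts_in_M[OF c(1)] by (intro set_eqI) (auto)
  then have "c = hup a b" by (intro hc_ext) simp
  then show ?thesis using c(1) by simp
qed

lemma dft_hup [dfn_intros]:
  assumes "dft s" "dft t" shows "dft (\<lambda>e. hup (s e) (t e))"
proof (rule dft_subst2[OF _ assms])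
  show "dft (\<lambda>e. hup (e 0) (e 1))"
  proof (rule dft_eltsI)
    show "hup (e 0) (e 1) \<in> M" if "range e \<subseteq> M" for e using that by (auto intro: hup_in_M)
    show "dfn (\<lambda>e. e 0 = e (Suc 0) \<or> e 0 = e (Suc 1))" by (intro dfn_intros)
  qed auto
qed

lemma dft_hpair [dfn_intros]:
  assumes "dft s" "dft t" shows "dft (\<lambda>e. hpair (s e) (t e))"
  unfolding hpair_hup by (intro dfn_intros assms)

lemma hUnion_in_M:
  assumes "a \<in> M" shows "hUnion a \<in> M"
proof -
  have "ax_union M" using zfc_M by (simp add: models_ZFC_def)
  then obtain u where u: "u \<in> M" "\<forall>z\<in>M. z \<in> elts u \<longleftrightarrow> (\<exists>y\<in>M. y \<in> elts a \<and> z \<in> elts y)"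
    using assms unfolding ax_union_def by metis
  have "z \<in> elts u \<longleftrightarrow> z \<in> elts (hUnion a)" for z
    using u(2) elts_in_M[OF u(1), of z] elts_in_M[OF assms] elts_in_M by auto
  then have "u = hUnion a" by (intro hc_ext) blast
  then show ?thesis using u(1) by simp
qed

lemma dft_hUnion [dfn_intros]:
  assumes "dft s" shows "dft (\<lambda>e. hUnion (s e))"
proof (rule dft_subst1[OF _ assms])
  show "dft (\<lambda>e. hUnion (e 0))"
  proof (rule dft_eltsI)
    show "hUnion (e 0) \<in> M" if "range e \<subseteq> M" for e using that by (auto intro: hUnion_in_M)
    show "dfn (\<lambda>e. \<exists>x\<in>elts (e (Suc 0)). e 0 \<in> elts x)" by (intro dfn_intros)
  qed auto
qed

lemma hUn_hUnion: "hUn a b = hUnion (hup a b)"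
  by (rule hc_ext) simp

lemma dft_hUn [dfn_intros]:
  assumes "dft s" "dft t" shows "dft (\<lambda>e. hUn (s e) (t e))"
  unfolding hUn_hUnion by (intro dfn_intros assms)

lemma hsucc_hUn: "hsucc a = hUn a (hup a a)"
  by (rule hc_ext) simp

lemma dft_hsucc [dfn_intros]:
  assumes "dft s" shows "dft (\<lambda>e. hsucc (s e))"
  unfolding hsucc_hUn by (intro dfn_intros assms)

lemma dft_hfst [dfn_intros]:
  assumes "dft s" shows "dft (\<lambda>e. hfst (s e))"
proof (rule dft_subst1[OF _ assms])
  show "dft (\<lambda>e. hfst (e 0))" unfolding hfst_def by (intro dfn_intros)
qed

lemma dft_hsnd [dfn_intros]:
  assumes "dft s" shows "dft (\<lambda>e. hsnd (s e))"
proof (rule dft_subst1[OF _ assms])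
  show "dft (\<lambda>e. hsnd (e 0))" unfolding hsnd_def by (intro dfn_intros)
qed

lemma dft_happ [dfn_intros]:
  assumes "dft s" "dft t" shows "dft (\<lambda>e. happ (s e) (t e))"
proof (rule dft_subst2[OF _ assms])
  show "dft (\<lambda>e. happ (e 0) (e 1))" unfolding happ_def by (intro dfn_intros)
qed

definition hPow :: "hc \<Rightarrow> hc" where "hPow a = hset {z \<in> M. elts z \<subseteq> elts a}"

lemma elts_hPow [simp]: "elts (hPow a) = {z \<in> M. elts z \<subseteq> elts a}"
  unfolding hPow_def using countable_M by (intro elts_hset) (auto intro: countable_subset)

lemma hPow_in_M:
  assumes "a \<in> M" shows "hPow a \<in> M"
proof -
  have "ax_powerset M" using zfc_M by (simp add: models_ZFC_def)
  then obtain p where p: "p \<in> M" "\<forall>z\<in>M. z \<in> elts p \<longleftrightarrow> (\<forall>w\<in>M. w \<in> elts z \<longrightarrow> w \<in> elts a)"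
    using assms unfolding ax_powerset_def by metis
  have "z \<in> elts p \<longleftrightarrow> z \<in> elts (hPow a)" for z
    unfolding elts_hPow mem_Collect_eq subset_iff using p elts_in_M by metis
  then have "p = hPow a" by (intro hc_ext) blast
  then show ?thesis using p(1) by simp
qed

lemma dft_hPow [dfn_intros]:
  assumes "dft s" shows "dft (\<lambda>e. hPow (s e))"
proof (rule dft_subst1[OF _ assms])
  show "dft (\<lambda>e. hPow (e 0))"
  proof (rule dft_eltsI)
    show "hPow (e 0) \<in> M" if "range e \<subseteq> M" for e using that by (auto intro: hPow_in_M)
    show "dfn (\<lambda>e. elts (e 0) \<subseteq> elts (e (Suc 0)))" by (intro dfn_intros)
  qed auto
qed

lemma hempty_in_M: "hset {} \<in> M"
proof -
  obtain a where a: "a \<in> M" using M_nonempty by auto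
  have "hset {z \<in> elts a. z \<noteq> z} \<in> M"
    by (rule dft_closed, intro dfn_intros, rule dft_const, rule a)
  then show ?thesis by simp
qed

lemma hnat_in_M [simp]: "hnat n \<in> M"
proof (induction n)
  case (Suc n)
  have "dft (\<lambda>e. hsucc (hnat n))" by (intro dfn_intros dft_const Suc)
  then show ?case by (simp add: dft_closed)
qed (simp add: hempty_in_M)

lemma homega_in_M [simp]: "homega \<in> M"
proof -
  \<comment> \<open>The axiom of infinity only gives some inductive set; \<omega> is cut out of it
    as the common part of all inductive sets of \<open>M\<close>.\<close>
  define I where "I w \<longleftrightarrow> hnat 0 \<in> elts w \<and> (\<forall>x\<in>elts w. hsucc x \<in> elts w)" for w
  have dI: "dfn (\<lambda>e. I (e 0))" unfolding I_def by (intro dfn_intros; rule dft_const; rule hnat_in_M)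
  have "ax_infinity M" using zfc_M by (simp add: models_ZFC_def)
  then obtain w z where w: "w \<in> M" "z \<in> elts w" "\<forall>u\<in>M. u \<notin> elts z"
    "\<forall>x\<in>M. x \<in> elts w \<longrightarrow> (\<exists>y\<in>M. y \<in> elts w \<and> (\<forall>z\<in>M. z \<in> elts y \<longleftrightarrow> z \<in> elts x \<or> z = x))"
    unfolding ax_infinity_def by metis
  have "elts z = {}" using elts_in_M[of z] elts_in_M[OF w(1,2)] w(3) by blast
  then have "z = hnat 0" by (intro hc_ext) simp
  moreover have "hsucc x \<in> elts w" if x: "x \<in> elts w" for x
  proof -
    have xM: "x \<in> M" using elts_in_M[OF w(1) x] .
    with x w(4) obtain y where y: "y \<in> M" "y \<in> elts w" "\<forall>z\<in>M. z \<in> elts y \<longleftrightarrow> z \<in> elts x \<or> z = x"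
      by metis
    have "z \<in> elts y \<longleftrightarrow> z \<in> elts (hsucc x)" for z
      using y(3) elts_in_M[OF y(1), of z] elts_in_M[OF xM, of z] xM by auto
    then have "y = hsucc x" by (intro hc_ext) blast
    then show ?thesis using y(2) by simp
  qed
  ultimately have Iw: "I w" using w(2) unfolding I_def by simp
  define W where "W = hset {n \<in> elts w. \<forall>J\<in>M. I J \<longrightarrow> n \<in> elts J}"
  have WM: "W \<in> M" unfolding W_def
    by (rule dft_closed, intro dfn_intros dfn_subst1[OF dI] dft_const w(1))
  have W: "elts W = {n \<in> elts w. \<forall>J\<in>M. I J \<longrightarrow> n \<in> elts J}" by (simp add: W_def)
  have IW: "I W" using Iw unfolding I_def W by blast
  have "elts W \<subseteq> range hnat"
  proof
    fix x assume "x \<in> elts W"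
    then show "x \<in> range hnat"
    proof (induction x rule: wf_induct[OF wf_elts])
      case (1 x)
      show ?case
      proof (rule ccontr)
        assume n: "x \<notin> range hnat"
        \<comment> \<open>A membership-minimal element of \<open>W\<close> that is no natural number
          is neither 0 nor the successor of a member of \<open>W\<close>, so deleting it leaves an
          inductive set.\<close>
        define V where "V = hset {n \<in> elts W. n \<noteq> x}"
        have "V \<in> M" unfolding V_def
          by (rule dft_closed, intro dfn_intros dft_const WM elts_in_M[OF WM 1(2)])
        moreover have "I V"
        proof -
          have "hnat 0 \<noteq> x" using n by blast
          moreover have "hsucc y \<noteq> x" if "y \<in> elts W" for y
          proof
            assume x: "hsucc y = x"
            then have "y \<in> elts x" by auto
            then have "y \<in> range hnat" using 1(1) that by simp
            then show False using n x by (metis hnat.simps(2) rangeE rangeI)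
          qed
          ultimately show ?thesis using IW unfolding I_def V_def by simp
        qed
        ultimately have "x \<in> elts V" using 1(2) unfolding W by blast
        then show False unfolding V_def by simp
      qed
    qed
  qed
  moreover have "hnat n \<in> elts W" for n
    by (induction n) (use IW in \<open>auto simp: I_def\<close>)
  ultimately have "elts W = elts homega" by auto
  then have "W = homega" by (rule hc_ext)
  then show ?thesis using WM by simp
qed

lemma finite_in_M:
  assumes "finite A" "A \<subseteq> M" shows "hset A \<in> M"
  using assms
proof (induction rule: finite_induct)
  case empty
  show ?case by (rule hempty_in_M)
next
  case (insert a A)
  have "dft (\<lambda>e. hUn (hset A) (hup a a))"
    by (intro dfn_intros dft_const) (use insert in auto)
  moreover have "hUn (hset A) (hup a a) = hset (insert a A)"
    using insert(1) by (intro hc_ext) (simp add: countable_finite)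
  ultimately show ?case by (simp add: dft_closed)
qed

lemma hpair_in_M: "a \<in> M \<Longrightarrow> b \<in> M \<Longrightarrow> hpair a b \<in> M"
  by (simp add: hpair_hup hup_in_M)

lemma hpair_in_MD: "hpair a b \<in> M \<Longrightarrow> a \<in> M \<and> b \<in> M"
  by (metis elts_hpair elts_hup elts_in_M insertI1 insertI2)

lemma hseqI:
  assumes "dft (\<lambda>e. t (e 0))" "\<And>n. h n = t (hnat n)"
  shows "hseq h \<in> M"
proof -
  have "hset ((\<lambda>z. hpair z (t z)) ` elts homega) \<in> M"
    by (rule dft_closed, intro dfn_intros dft_subst1[OF assms(1)] dft_const homega_in_M)
  moreover have "hset ((\<lambda>z. hpair z (t z)) ` elts homega) = hseq h"
    by (intro hc_ext) (auto simp: elts_hseq assms(2) image_image)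
  ultimately show ?thesis by simp
qed

lemma hseq_value_in_M: "hseq h \<in> M \<Longrightarrow> h n \<in> M"
  by (metis elts_in_M hpair_hseq hpair_in_MD)

text \<open>Recursion along membership inside \<open>M\<close>, for a function \<open>F\<close> of
  HOL whose value at \<open>x\<close> is computed by a definable \<open>H\<close> from any set in
  \<open>M\<close> that agrees with \<open>F\<close> below \<open>x\<close>. The graph of
  \<open>F\<close> becomes definable as "some attempt contains this pair", where attempts are
  partial solutions closed under members; that enough attempts lie in \<open>M\<close> is an
  induction using replacement.\<close>

lemma rec_dft:
  assumes H: "dft (\<lambda>e. H (e 0) (e 1))"
    and F: "\<And>x f. x \<in> M \<Longrightarrow> f \<in> M \<Longrightarrow>
      (\<And>y v. (y, x) \<in> hmem\<^sup>+ \<Longrightarrow> hpair y v \<in> elts f \<longleftrightarrow> v = F y) \<Longrightarrow> H x f = F x"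
  shows "dft (\<lambda>e. F (e 0))"
proof -
  define ap where "ap f \<longleftrightarrow> (\<forall>p\<in>elts f. \<exists>y\<in>M. \<exists>v\<in>M. p = hpair y v \<and> v = H y f \<and>
    (\<forall>u\<in>elts y. \<exists>w\<in>M. hpair u w \<in> elts f))" for f
  have dap: "dfn (\<lambda>e. ap (e 0))"
    unfolding ap_def by (intro dfn_intros dft_subst2[OF H])
  have ap_pair: "v = H y f \<and> (\<forall>u\<in>elts y. \<exists>w\<in>M. hpair u w \<in> elts f)"
    if "ap f" "hpair y v \<in> elts f" for f y v
    using that unfolding ap_def by fastforce
  have below: "\<exists>w. hpair u w \<in> elts f" if ap: "ap f" and "(u, y) \<in> hmem\<^sup>*" "hpair y v \<in> elts f" for f u y v
    using that(2,3)
  proof (induction arbitrary: v rule: rtrancl_induct)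
    case (step z y)
    then have "z \<in> elts y" by simp
    then obtain w where "hpair z w \<in> elts f" using ap_pair[OF ap step.prems] by blast
    then show ?case by (rule step.IH)
  qed auto
  have sound: "v = F y" if fM: "f \<in> M" and ap: "ap f" and "hpair y v \<in> elts f" for f y v
    using that(3)
  proof (induction y arbitrary: v rule: wf_induct[OF wf_trancl[OF wf_elts]])
    case (1 y)
    have "H y f = F y"
    proof (rule F)
      show "y \<in> M" using elts_in_M[OF fM 1(2)] hpair_in_MD by blast
      fix u w assume u: "(u, y) \<in> hmem\<^sup>+"
      then obtain w' where w': "hpair u w' \<in> elts f"
        using below[OF ap trancl_into_rtrancl[OF u] 1(2)] by blast
      have "w'' = F u" if "hpair u w'' \<in> elts f" for w''
        using 1(1) u that by blast
      then show "hpair u w \<in> elts f \<longleftrightarrow> w = F u" using w' by metis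
    qed (rule fM)
    then show ?case using ap_pair[OF ap 1(2)] by simp
  qed
  \<comment> \<open>The attempt on all sets below \<open>x\<close>, formed outside; its membership
    in \<open>M\<close> is proved only later.\<close>
  define G where "G x = hset ((\<lambda>u. hpair u (F u)) ` {u. (u, x) \<in> hmem\<^sup>*})" for x
  have elts_G: "elts (G x) = (\<lambda>u. hpair u (F u)) ` {u. (u, x) \<in> hmem\<^sup>*}" for x
    unfolding G_def by (intro elts_hset countable_image countable_below)
  have pair_G: "hpair u w \<in> elts (G x) \<longleftrightarrow> (u, x) \<in> hmem\<^sup>* \<and> w = F u" for u w x
    unfolding elts_G by auto
  have ap_G: "ap (G x)" if "G x \<in> M" for x
    unfolding ap_def
  proof
    fix p assume p: "p \<in> elts (G x)"
    then obtain u where u: "(u, x) \<in> hmem\<^sup>*" "p = hpair u (F u)" unfolding elts_G by auto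
    have uM: "u \<in> M" "F u \<in> M" using elts_in_M[OF that p] u(2) hpair_in_MD by blast+
    have "H u (G x) = F u"
      by (rule F) (use uM that u(1) in \<open>auto simp: pair_G intro: rtrancl_trans dest!: trancl_into_rtrancl\<close>)
    moreover have "\<exists>w\<in>M. hpair z w \<in> elts (G x)" if z: "z \<in> elts u" for z
    proof -
      have "(z, x) \<in> hmem\<^sup>*" using z u(1) by (auto intro: converse_rtrancl_into_rtrancl)
      then have "hpair z (F z) \<in> elts (G x)" by (simp add: pair_G)
      moreover from this have "F z \<in> M" using elts_in_M[OF \<open>G x \<in> M\<close>] hpair_in_MD by blast
      ultimately show ?thesis by blast
    qed
    ultimately show "\<exists>y\<in>M. \<exists>v\<in>M. p = hpair y v \<and> v = H y (G x) \<and> (\<forall>u\<in>elts y. \<exists>w\<in>M. hpair u w \<in> elts (G x))"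
      using u(2) uM by metis
  qed
  \<comment> \<open>Replacement needs a functional relation, but attempts for \<open>y\<close> are
    not unique. The least one is, and \<open>R_iff\<close> identifies it with
    \<open>G y\<close>.\<close>
  define R where "R y g \<longleftrightarrow> ap g \<and> (\<exists>v\<in>M. hpair y v \<in> elts g) \<and>
    (\<forall>g'\<in>M. ap g' \<and> (\<exists>v\<in>M. hpair y v \<in> elts g') \<longrightarrow> elts g \<subseteq> elts g')" for y g
  have dR: "dfn (\<lambda>e. R (e 0) (e 1))"
    unfolding R_def by (intro dfn_intros dfn_subst1[OF dap])
  have G_least: "elts (G y) \<subseteq> elts g" if "g \<in> M" "ap g" "hpair y v \<in> elts g" for g y v
  proof
    fix p assume "p \<in> elts (G y)"
    then obtain u where u: "(u, y) \<in> hmem\<^sup>*" "p = hpair u (F u)" unfolding elts_G by auto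
    then show "p \<in> elts g" using below[OF that(2) u(1) that(3)] sound[OF that(1,2)] by metis
  qed
  have R_iff: "R y g \<longleftrightarrow> g = G y" if gM: "g \<in> M" and GM: "G y \<in> M" for y g
  proof -
    have *: "hpair y (F y) \<in> elts (G y)" by (simp add: pair_G)
    then have FM: "F y \<in> M" using elts_in_M[OF GM] hpair_in_MD by blast
    show ?thesis
    proof
      assume R: "R y g"
      then have "elts g \<subseteq> elts (G y)" unfolding R_def using ap_G[OF GM] * FM GM by metis
      moreover have "elts (G y) \<subseteq> elts g" using R G_least[OF gM] unfolding R_def by metis
      ultimately show "g = G y" by (intro hc_ext) auto
    next
      assume "g = G y"
      then show "R y g" unfolding R_def using ap_G[OF GM] * FM GM G_least by metis
    qed
  qed
  have GM: "x \<in> M \<Longrightarrow> G x \<in> M" for x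
  proof (induction x rule: wf_induct[OF wf_elts])
    case (1 x)
    have G: "G y \<in> M" if "y \<in> elts x" for y using 1 that elts_in_M by simp
    define f0 where "f0 = hUnion (hset {g \<in> M. \<exists>y\<in>elts x. R y g})"
    have "hset {g \<in> M. \<exists>y\<in>elts x. R y g} \<in> M"
    proof (rule replacement[where R = "\<lambda>y g e. R y g", OF dR 1(2)])
      show "range (\<lambda>_. x) \<subseteq> M" using 1(2) by auto
      show "\<exists>!g. g \<in> M \<and> R y g" if "y \<in> elts x" for y
        using R_iff[OF _ G[OF that]] G[OF that] by metis
    qed
    then have f0M: "f0 \<in> M" unfolding f0_def by (rule hUnion_in_M)
    have "countable {g \<in> M. \<exists>y\<in>elts x. R y g}" using countable_M by (auto intro: countable_subset)
    moreover have "{g \<in> M. \<exists>y\<in>elts x. R y g} = G ` elts x"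
      using R_iff[OF _ G] G by blast
    ultimately have f0: "elts f0 = (\<Union>y\<in>elts x. elts (G y))"
      unfolding f0_def by simp
    have "H x f0 = F x"
    proof (rule F[OF 1(2) f0M])
      fix u v assume "(u, x) \<in> hmem\<^sup>+"
      then obtain z where "(u, z) \<in> hmem\<^sup>*" "z \<in> elts x" by (auto dest: tranclD2)
      then show "hpair u v \<in> elts f0 \<longleftrightarrow> v = F u" unfolding f0 by (auto simp: pair_G)
    qed
    moreover have "H x f0 \<in> M"
      using dft_in_M[OF H, of "case_nat x (\<lambda>_. f0)"] 1(2) f0M by (simp add: range_case_nat)
    ultimately have FM: "F x \<in> M" by simp
    have "dft (\<lambda>e. hUn f0 (hup (hpair x (F x)) (hpair x (F x))))"
      by (intro dfn_intros dft_const f0M FM 1(2))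
    moreover have "hUn f0 (hup (hpair x (F x)) (hpair x (F x))) = G x"
    proof (rule hc_ext)
      have "{u. (u, x) \<in> hmem\<^sup>*} = insert x (\<Union>y\<in>elts x. {u. (u, y) \<in> hmem\<^sup>*})"
        by (auto elim: rtranclE intro: rtrancl_into_rtrancl)
      then show "elts (hUn f0 (hup (hpair x (F x)) (hpair x (F x)))) = elts (G x)"
        by (auto simp: f0 elts_G)
    qed
    ultimately show ?case by (simp add: dft_closed)
  qed
  show ?thesis
  proof (rule dft_graphI)
    have Gx: "hpair x (F x) \<in> elts (G x)" for x by (simp add: pair_G)
    have FM: "F x \<in> M" if "x \<in> M" for x
      using elts_in_M[OF GM[OF that] Gx] hpair_in_MD by metis
    show "F (e 0) \<in> M" if "range e \<subseteq> M" for e using that by (auto intro: FM)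
    show "dfn (\<lambda>e. \<exists>f\<in>M. ap f \<and> hpair (e (Suc 0)) (e 0) \<in> elts f)"
      by (intro dfn_intros dfn_subst1[OF dap])
    fix e :: "nat \<Rightarrow> hc" and y assume "range e \<subseteq> M" "y \<in> M"
    then have x: "e 0 \<in> M" by auto
    show "(\<exists>f\<in>M. ap f \<and> hpair (e 0) y \<in> elts f) \<longleftrightarrow> y = F (e 0)"
      using sound GM[OF x] ap_G[OF GM[OF x]] Gx[of "e 0"] by metis
  qed
qed

end

section \<open>Sequences, hereditarily finite sets, strings and reals of the model\<close>

text \<open>The antidiagonal enumeration of pairs, written as the iteration of one step, since
  \<open>hseq_iterate\<close> carries exactly this form into \<open>M\<close>.\<close>

fun pair_enum :: "nat \<Rightarrow> nat \<times> nat" where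
  "pair_enum 0 = (0, 0)"
| "pair_enum (Suc n) = (case pair_enum n of (a, b) \<Rightarrow> if b = 0 then (0, Suc a) else (Suc a, b - 1))"

lemma pair_enum_bound: "fst (pair_enum n) + snd (pair_enum n) \<le> n"
  by (induction n) (auto split: prod.split)

lemma pair_enum_surj: "\<exists>n. pair_enum n = (a, b)"
proof (induction "(a + b, a)" arbitrary: a b rule: wf_induct_rule[OF wf_lex_prod[OF wf_less wf_less]])
  case (1 a b)
  consider "a = 0" "b = 0" | c where "a = Suc c" | c where "a = 0" "b = Suc c"
    by (cases a; cases b) auto
  then show ?case
  proof cases
    case 1
    then show ?thesis by (metis pair_enum.simps(1))
  next
    case 2
    obtain n where "pair_enum n = (c, Suc b)" using 1[of c "Suc b"] 2 by auto
    then have "pair_enum (Suc n) = (a, b)" using 2 by simp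
    then show ?thesis ..
  next
    case 3
    obtain n where "pair_enum n = (c, 0)" using 1[of c 0] 3 by auto
    then have "pair_enum (Suc n) = (a, b)" using 3 by simp
    then show ?thesis ..
  qed
qed

text \<open>Hereditarily finite sets arise from the empty set by adjoining one set to another. Entry
  \<open>Suc n\<close> does so with two entries of index at most \<open>n\<close>; every pair of
  entries gets its turn, and repetitions occur.\<close>

function hf_enum :: "nat \<Rightarrow> hc" where
  "hf_enum 0 = hset {}"
| "hf_enum (Suc n) = hUn (hf_enum (fst (pair_enum n)))
    (hup (hf_enum (snd (pair_enum n))) (hf_enum (snd (pair_enum n))))"
  by pat_completeness auto
termination
proof (relation less_than)
  fix n
  have "fst (pair_enum n) \<le> n" "snd (pair_enum n) \<le> n" using pair_enum_bound[of n] by auto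
  then show "(fst (pair_enum n), Suc n) \<in> less_than" "(snd (pair_enum n), Suc n) \<in> less_than"
      "(snd (pair_enum n), Suc n) \<in> less_than" by simp_all
qed simp

lemma hf_empty: "hset {} \<in> range hf_enum"
  by (rule range_eqI[of _ _ 0]) simp

lemma hf_adjoin: "x \<in> range hf_enum \<Longrightarrow> y \<in> range hf_enum \<Longrightarrow> hUn x (hup y y) \<in> range hf_enum"
proof -
  assume "x \<in> range hf_enum" "y \<in> range hf_enum"
  then obtain a b where ab: "x = hf_enum a" "y = hf_enum b" by auto
  obtain n where "pair_enum n = (a, b)" using pair_enum_surj by blast
  then have "hf_enum (Suc n) = hUn x (hup y y)" using ab by simp
  then show ?thesis by (metis rangeI)
qed

lemma hf_finite: "finite A \<Longrightarrow> A \<subseteq> range hf_enum \<Longrightarrow> hset A \<in> range hf_enum"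
proof (induction rule: finite_induct)
  case empty
  show ?case by (rule hf_empty)
next
  case (insert a A)
  have "hUn (hset A) (hup a a) = hset (insert a A)"
    using insert(1) by (intro hc_ext) (simp add: countable_finite)
  then show ?case using hf_adjoin[of "hset A" a] insert by simp
qed

lemma hf_hnat: "hnat n \<in> range hf_enum"
proof (induction n)
  case 0
  then show ?case by (simp add: hf_empty del: hf_enum.simps)
next
  case (Suc n)
  have "hsucc (hnat n) = hUn (hnat n) (hup (hnat n) (hnat n))" by (rule hc_ext) simp
  then show ?case using hf_adjoin[OF Suc Suc] by simp
qed

lemma hf_hpair:
  assumes "a \<in> range hf_enum" "b \<in> range hf_enum"
  shows "hpair a b \<in> range hf_enum"
proof -
  have "hset {a} \<in> range hf_enum" "hset {a, b} \<in> range hf_enum"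
    using assms by (simp_all add: hf_finite)
  then show ?thesis unfolding hpair_def by (intro hf_finite) simp_all
qed

lemma elts_hstring: "elts (hstring s) = (\<lambda>i. hpair (hnat i) (hbool (s ! i))) ` {..<length s}"
  unfolding hstring_def by (subst elts_hset) (auto simp: setcompr_eq_image)

lemma hpair_hstring [simp]: "hpair a (hbool b) \<in> elts (hstring s) \<longleftrightarrow> (\<exists>i<length s. a = hnat i \<and> s ! i = b)"
  by (auto simp: elts_hstring)

lemma elts_hreal: "elts (hreal x) = range (\<lambda>i. hpair (hnat i) (hbool (x i)))"
  by (simp add: hreal_def elts_hseq)

lemma hpair_hreal [simp]: "hpair a (hbool b) \<in> elts (hreal x) \<longleftrightarrow> (\<exists>i. a = hnat i \<and> x i = b)"
  by (auto simp: elts_hreal)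

lemma hreal_inject [simp]: "hreal x = hreal y \<longleftrightarrow> x = y"
  by (auto simp: hreal_def fun_eq_iff)

lemma hstring_subset_iff:
  "elts (hstring s) \<subseteq> elts (hstring t) \<longleftrightarrow> (\<forall>i<length s. i < length t \<and> t ! i = s ! i)"
  unfolding elts_hstring[of s] by auto

lemma hstring_inject [simp]: "hstring s = hstring t \<longleftrightarrow> s = t"
proof
  assume "hstring s = hstring t"
  then have st: "\<forall>i<length s. i < length t \<and> t ! i = s ! i" "\<forall>i<length t. i < length s \<and> s ! i = t ! i"
    unfolding hstring_subset_iff[symmetric] by simp_all
  have "length s \<le> length t" using st(1) by (meson not_le order_less_irrefl)
  moreover have "length t \<le> length s" using st(2) by (meson not_le order_less_irrefl)
  ultimately show "s = t" using st(1) by (intro nth_equalityI) auto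
qed simp

lemma hstring_hreal_iff: "elts (hstring s) \<subseteq> elts (hreal x) \<longleftrightarrow> x \<in> cylinder s"
  unfolding elts_hstring cylinder_def by auto

lemma hf_hstring: "hstring s \<in> range hf_enum"
proof -
  have "hstring s = hset (elts (hstring s))" by simp
  also have "\<dots> \<in> range hf_enum"
    by (rule hf_finite) (auto simp: elts_hstring hbool_def simp del: hnat.simps intro!: hf_hpair hf_hnat)
  finally show ?thesis .
qed

lemma hf_hreal: "elts (hreal x) \<subseteq> range hf_enum"
  by (auto simp: elts_hreal hbool_def simp del: hnat.simps intro!: hf_hpair hf_hnat)

text \<open>One definable description for strings and reals: binary functions on a natural number or
  on \<omega>. With it \<open>M\<close> separates strings from the hereditarily finite sets, and its
  reals from their power set.\<close>

definition binfun :: "hc \<Rightarrow> hc \<Rightarrow> bool" where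
  "binfun n z \<longleftrightarrow> (\<forall>u\<in>elts z. \<exists>j\<in>elts n. u = hpair j (hbool False) \<or> u = hpair j (hbool True)) \<and>
     (\<forall>j\<in>elts n. hpair j (hbool False) \<in> elts z \<longleftrightarrow> hpair j (hbool True) \<notin> elts z)"

lemma binfun_hstring: "binfun (hnat (length s)) (hstring s)"
  unfolding binfun_def
proof (intro conjI ballI)
  fix u assume "u \<in> elts (hstring s)"
  then obtain i where "i < length s" "u = hpair (hnat i) (hbool (s ! i))" unfolding elts_hstring by blast
  then show "\<exists>j\<in>elts (hnat (length s)). u = hpair j (hbool False) \<or> u = hpair j (hbool True)"
    by (intro bexI[of _ "hnat i"]) (cases "s ! i", auto)
next
  fix j assume "j \<in> elts (hnat (length s))"
  then obtain i where "i < length s" "j = hnat i" unfolding elts_hnat by blast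
  then show "hpair j (hbool False) \<in> elts (hstring s) \<longleftrightarrow> hpair j (hbool True) \<notin> elts (hstring s)" by simp
qed

lemma binfun_hreal: "binfun homega (hreal x)"
  unfolding binfun_def
proof (intro conjI ballI)
  fix u assume "u \<in> elts (hreal x)"
  then obtain i where "u = hpair (hnat i) (hbool (x i))" unfolding elts_hreal by blast
  then show "\<exists>j\<in>elts homega. u = hpair j (hbool False) \<or> u = hpair j (hbool True)"
    by (intro bexI[of _ "hnat i"]) (cases "x i", auto)
next
  fix j assume "j \<in> elts homega"
  then obtain i where "j = hnat i" by auto
  then show "hpair j (hbool False) \<in> elts (hreal x) \<longleftrightarrow> hpair j (hbool True) \<notin> elts (hreal x)" by simp
qed

lemma binfun_hnatD:
  assumes "binfun (hnat n) z"
  obtains s where "z = hstring s" "length s = n"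
proof
  let ?s = "map (\<lambda>j. hpair (hnat j) (hbool True) \<in> elts z) [0..<n]"
  have *: "hpair (hnat j) (hbool b) \<in> elts z \<longleftrightarrow> b = (hpair (hnat j) (hbool True) \<in> elts z)" if "j < n" for j b
    using assms that unfolding binfun_def elts_hnat by (cases b) auto
  show "z = hstring ?s"
  proof (rule hc_ext, intro set_eqI)
    fix u
    have "u \<in> elts z \<longleftrightarrow> (\<exists>j<n. u = hpair (hnat j) (hbool (?s ! j)))"
    proof
      assume u: "u \<in> elts z"
      then obtain j b where j: "j < n" "u = hpair (hnat j) (hbool b)"
        using assms unfolding binfun_def elts_hnat by blast
      then have "b = (?s ! j)" using *[OF j(1), of b] u by simp
      then show "\<exists>j<n. u = hpair (hnat j) (hbool (?s ! j))" using j by blast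
    next
      assume "\<exists>j<n. u = hpair (hnat j) (hbool (?s ! j))"
      then obtain j where j: "j < n" "u = hpair (hnat j) (hbool (?s ! j))" by blast
      then show "u \<in> elts z" using *[OF j(1), of "?s ! j"] by simp
    qed
    also have "\<dots> \<longleftrightarrow> u \<in> elts (hstring ?s)"
      unfolding elts_hstring by (simp add: image_iff Bex_def cong: conj_cong)
    finally show "u \<in> elts z \<longleftrightarrow> u \<in> elts (hstring ?s)" .
  qed
qed simp

lemma binfun_homegaD:
  assumes "binfun homega z"
  obtains x where "z = hreal x"
proof
  let ?x = "\<lambda>j. hpair (hnat j) (hbool True) \<in> elts z"
  have *: "hpair (hnat j) (hbool b) \<in> elts z \<longleftrightarrow> b = ?x j" for j b
    using assms unfolding binfun_def by (cases b) auto
  show "z = hreal ?x"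
  proof (rule hc_ext, intro set_eqI)
    fix u
    have "u \<in> elts z \<longleftrightarrow> (\<exists>j. u = hpair (hnat j) (hbool (?x j)))"
    proof
      assume u: "u \<in> elts z"
      then obtain j b where j: "u = hpair (hnat j) (hbool b)"
        using assms unfolding binfun_def elts_homega by blast
      then have "b = ?x j" using *[of j b] u by simp
      then show "\<exists>j. u = hpair (hnat j) (hbool (?x j))" using j by blast
    next
      assume "\<exists>j. u = hpair (hnat j) (hbool (?x j))"
      then obtain j where j: "u = hpair (hnat j) (hbool (?x j))" by blast
      then show "u \<in> elts z" using *[of j "?x j"] by simp
    qed
    also have "\<dots> \<longleftrightarrow> u \<in> elts (hreal ?x)"
      unfolding elts_hreal by (simp add: image_iff)
    finally show "u \<in> elts z \<longleftrightarrow> u \<in> elts (hreal ?x)" .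
  qed
qed

definition hS :: "bool list set \<Rightarrow> hc" where "hS A = hset (hstring ` A)"
definition hX :: "(nat \<Rightarrow> bool) set \<Rightarrow> hc" where "hX B = hset (hreal ` B)"
definition ucyl :: "bool list set \<Rightarrow> (nat \<Rightarrow> bool) set" where "ucyl A = (\<Union>s\<in>A. cylinder s)"
text \<open>The domain inside \<omega>, which for a string is the von Neumann number of its
  length.\<close>

definition hlen :: "hc \<Rightarrow> hc" where
  "hlen z = hset {j \<in> elts homega. hpair j (hbool False) \<in> elts z \<or> hpair j (hbool True) \<in> elts z}"

lemma elts_hS [simp]: "elts (hS A) = hstring ` A"
  by (simp add: hS_def)

lemma hS_inject [simp]: "hS A = hS B \<longleftrightarrow> A = B"
  by (metis elts_hS hstring_inject inj_image_eq_iff injI)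

lemma hlen_hstring [simp]: "hlen (hstring s) = hnat (length s)"
proof (rule hc_ext)
  have "hpair j (hbool False) \<in> elts (hstring s) \<or> hpair j (hbool True) \<in> elts (hstring s) \<longleftrightarrow>
      (\<exists>i<length s. j = hnat i)" for j
    unfolding hpair_hstring by blast
  then show "elts (hlen (hstring s)) = elts (hnat (length s))"
    unfolding hlen_def by (auto simp: elts_hnat simp del: hpair_hstring)
qed

section \<open>Recursion on the naturals, strings, reals and countable choice inside the
  model\<close>

context ctm
begin

lemma countable_M_sep [simp]: "countable {z \<in> M. P z}"
  by (rule countable_subset[OF _ countable_M]) auto

lemma hbool_in_M [simp]: "hbool b \<in> M"
  unfolding hbool_def using hnat_in_M by (auto simp del: hnat.simps)

text \<open>Recursion on \<omega> is recursion along membership with a default value off \<omega>: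
  the values below \<open>n\<close> are those at the members of \<open>hnat n\<close>.\<close>

lemma hseq_rec:
  assumes H: "dft (\<lambda>e. H (e 0) (e 1))"
    and h: "\<And>n f. f \<in> M \<Longrightarrow> (\<And>m v. m < n \<Longrightarrow> hpair (hnat m) v \<in> elts f \<longleftrightarrow> v = h m) \<Longrightarrow> H (hnat n) f = h n"
  shows "hseq h \<in> M"
proof -
  define F where "F x = (if x \<in> elts homega then h (THE n. x = hnat n) else hnat 0)" for x
  have F: "F (hnat n) = h n" for n by (simp add: F_def)
  have "dft (\<lambda>e. F (e 0))"
  proof (rule rec_dft)
    show "dft (\<lambda>e. if e 0 \<in> elts homega then H (e 0) (e 1) else hnat 0)"
      by (intro dfn_intros dft_subst2[OF H] dft_const homega_in_M hnat_in_M)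
    fix x f assume xf: "x \<in> M" "f \<in> M"
      "\<And>y v. (y, x) \<in> hmem\<^sup>+ \<Longrightarrow> hpair y v \<in> elts f \<longleftrightarrow> v = F y"
    show "(if x \<in> elts homega then H x f else hnat 0) = F x"
    proof (cases "x \<in> elts homega")
      case True
      then obtain n where n: "x = hnat n" by auto
      have "H (hnat n) f = h n"
      proof (rule h[OF xf(2)])
        fix m v assume "m < n"
        then have "(hnat m, x) \<in> hmem\<^sup>+" using n by (intro r_into_trancl) simp
        then show "hpair (hnat m) v \<in> elts f \<longleftrightarrow> v = h m" using xf(3) by (simp add: F)
      qed
      then show ?thesis using n by (simp add: F)
    next
      case False
      then show ?thesis unfolding F_def by (simp only: if_False)
    qed
  qed
  then show ?thesis by (rule hseqI) (simp add: F)
qed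

lemma hseq_iterate:
  assumes "h 0 \<in> M" "dft (\<lambda>e. S (e 0))" "\<And>n. h (Suc n) = S (h n)"
  shows "hseq h \<in> M"
proof (rule hseq_rec)
  \<comment> \<open>On positive naturals \<open>hUnion\<close> is the predecessor.\<close>
  show "dft (\<lambda>e. if e 0 = hnat 0 then h 0 else S (happ (e 1) (hUnion (e 0))))"
    by (intro dfn_intros dft_subst1[OF assms(2)] dft_const hnat_in_M assms(1))
  fix n f assume f: "f \<in> M" "\<And>m v. m < n \<Longrightarrow> hpair (hnat m) v \<in> elts f \<longleftrightarrow> v = h m"
  show "(if hnat n = hnat 0 then h 0 else S (happ f (hUnion (hnat n)))) = h n"
  proof (cases n)
    case (Suc m)
    have "happ f (hnat m) = h m" by (rule happ_eq) (use f(2)[of m] Suc in auto)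
    then show ?thesis using assms(3) Suc by (simp del: hnat.simps)
  qed simp
qed

lemma range_in_M:
  assumes "hseq h \<in> M" shows "hset (range h) \<in> M"
proof -
  have "hset ((\<lambda>z. happ (hseq h) z) ` elts homega) \<in> M"
    by (rule dft_closed, intro dfn_intros dft_const homega_in_M assms)
  then show ?thesis by (simp add: image_image)
qed

lemma pair_enum_in_M: "hseq (\<lambda>n. hpair (hnat (fst (pair_enum n))) (hnat (snd (pair_enum n)))) \<in> M"
proof (rule hseq_iterate)
  show "dft (\<lambda>e. if hsnd (e 0) = hnat 0 then hpair (hnat 0) (hsucc (hfst (e 0)))
      else hpair (hsucc (hfst (e 0))) (hUnion (hsnd (e 0))))"
    by (intro dfn_intros dft_const hnat_in_M)
  fix n
  obtain a b where ab: "pair_enum n = (a, b)" by force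
  show "hpair (hnat (fst (pair_enum (Suc n)))) (hnat (snd (pair_enum (Suc n)))) =
    (if hsnd (hpair (hnat (fst (pair_enum n))) (hnat (snd (pair_enum n)))) = hnat 0
      then hpair (hnat 0) (hsucc (hfst (hpair (hnat (fst (pair_enum n))) (hnat (snd (pair_enum n))))))
      else hpair (hsucc (hfst (hpair (hnat (fst (pair_enum n))) (hnat (snd (pair_enum n))))))
        (hUnion (hsnd (hpair (hnat (fst (pair_enum n))) (hnat (snd (pair_enum n)))))))"
    unfolding ab hfst_hpair hsnd_hpair fst_conv snd_conv hnat_inject hnat.simps(2)[symmetric]
    by (cases b) (simp_all add: ab del: hnat.simps)
qed (simp add: hpair_in_M del: hnat.simps)

lemma hf_enum_in_M: "hseq hf_enum \<in> M"
proof (rule hseq_rec)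
  let ?P = "hseq (\<lambda>n. hpair (hnat (fst (pair_enum n))) (hnat (snd (pair_enum n))))"
  show "dft (\<lambda>e. if e 0 = hnat 0 then hset {} else hUn (happ (e 1) (hfst (happ ?P (hUnion (e 0)))))
     (hup (happ (e 1) (hsnd (happ ?P (hUnion (e 0))))) (happ (e 1) (hsnd (happ ?P (hUnion (e 0)))))))"
    by (intro dfn_intros dft_const pair_enum_in_M hnat_in_M hempty_in_M)
  fix n f assume f: "f \<in> M" "\<And>m v. m < n \<Longrightarrow> hpair (hnat m) v \<in> elts f \<longleftrightarrow> v = hf_enum m"
  show "(if hnat n = hnat 0 then hset {} else hUn (happ f (hfst (happ ?P (hUnion (hnat n)))))
     (hup (happ f (hsnd (happ ?P (hUnion (hnat n))))) (happ f (hsnd (happ ?P (hUnion (hnat n))))))) = hf_enum n"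
  proof (cases n)
    case (Suc m)
    have app: "happ f (hnat k) = hf_enum k" if "k \<le> m" for k
      by (rule happ_eq) (use f(2)[of k] Suc that in auto)
    have "fst (pair_enum m) \<le> m" "snd (pair_enum m) \<le> m" using pair_enum_bound[of m] by auto
    then show ?thesis using Suc by (simp add: app del: hnat.simps)
  qed simp
qed

lemma hf_in_M [simp]: "hset (range hf_enum) \<in> M"
  using hf_enum_in_M by (rule range_in_M)

lemma hf_elem_in_M: "x \<in> range hf_enum \<Longrightarrow> x \<in> M"
  using elts_in_M[OF hf_in_M] by simp

lemma hstring_in_M [simp]: "hstring s \<in> M"
  using hf_hstring hf_elem_in_M by blast

lemma dfn_binfun [dfn_intros]:
  assumes "dft s" "dft t" shows "dfn (\<lambda>e. binfun (s e) (t e))"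
proof (rule dfn_subst2[OF _ assms])
  show "dfn (\<lambda>e. binfun (e 0) (e 1))"
    unfolding binfun_def by (intro dfn_intros dft_const hbool_in_M)
qed

lemma dft_hlen [dfn_intros]:
  assumes "dft s" shows "dft (\<lambda>e. hlen (s e))"
proof (rule dft_subst1[OF _ assms])
  show "dft (\<lambda>e. hlen (e 0))"
    unfolding hlen_def by (intro dfn_intros dft_const hbool_in_M homega_in_M)
qed

lemma strings_in_M [simp]: "hS UNIV \<in> M"
proof -
  have "hset {z \<in> elts (hset (range hf_enum)). \<exists>n\<in>elts homega. binfun n z} \<in> M"
    by (rule dft_closed, intro dfn_intros dft_const homega_in_M hf_in_M)
  moreover have "hset {z \<in> elts (hset (range hf_enum)). \<exists>n\<in>elts homega. binfun n z} = hS UNIV"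
    using hf_hstring binfun_hstring by (intro hc_ext) (auto elim!: binfun_hnatD simp del: hnat.simps)
  ultimately show ?thesis by simp
qed

lemma elts_hX [simp]: "B \<subseteq> reals_in M \<Longrightarrow> elts (hX B) = hreal ` B"
proof -
  assume "B \<subseteq> reals_in M"
  then have "hreal ` B \<subseteq> M" by (auto simp: reals_in_def)
  then show ?thesis unfolding hX_def by (intro elts_hset countable_subset[OF _ countable_M])
qed

lemma hX_inject: "A \<subseteq> reals_in M \<Longrightarrow> B \<subseteq> reals_in M \<Longrightarrow> hX A = hX B \<longleftrightarrow> A = B"
  by (metis elts_hX hreal_inject inj_image_eq_iff injI)

lemma reals_in_M [simp]: "hX (reals_in M) \<in> M"
proof -
  have "hset {z \<in> elts (hPow (hset (range hf_enum))). binfun homega z} \<in> M"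
    by (rule dft_closed, intro dfn_intros dft_const homega_in_M hf_in_M)
  moreover have "hset {z \<in> elts (hPow (hset (range hf_enum))). binfun homega z} = hX (reals_in M)"
    using hf_hreal binfun_hreal by (intro hc_ext) (auto simp: reals_in_def elim!: binfun_homegaD)
  ultimately show ?thesis by simp
qed

text \<open>Codes in \<open>M\<close> of open sets. A set of strings describes the same open set in
  \<open>M\<close> and in V, which makes these the common ground for comparing the two
  interpretations of a Borel code.\<close>

definition OM :: "bool list set set" where "OM = {A. hS A \<in> M}"

lemma OM_I:
  assumes "dfn (\<lambda>e. P (e 0))" "\<And>s. s \<in> A \<longleftrightarrow> P (hstring s)"
  shows "A \<in> OM"
proof -
  have "hset {z \<in> elts (hS UNIV). P z} \<in> M"
    by (rule dft_closed, intro dfn_intros dfn_subst1[OF assms(1)] dft_const strings_in_M)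
  moreover have "hset {z \<in> elts (hS UNIV). P z} = hS A"
    using assms(2) by (intro hc_ext) auto
  ultimately show ?thesis by (simp add: OM_def)
qed

lemma OM_D: "A \<in> OM \<Longrightarrow> hS A \<in> M"
  by (simp add: OM_def)

lemma UNIV_OM [simp]: "UNIV \<in> OM"
  using strings_in_M unfolding OM_def by simp

lemma elts_hPow_strings: "elts (hPow (hS UNIV)) = hS ` OM"
proof -
  have *: "z \<in> hS ` OM" if "z \<in> M" "elts z \<subseteq> range hstring" for z
  proof -
    have z: "z = hS {s. hstring s \<in> elts z}" by (rule hc_ext) (use that(2) in auto)
    then have "{s. hstring s \<in> elts z} \<in> OM" using that(1) unfolding OM_def by simp
    then show ?thesis using z by (rule rev_image_eqI)
  qed
  show ?thesis
  proof (intro equalityI subsetI)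
    fix z assume "z \<in> elts (hPow (hS UNIV))"
    then have "z \<in> M" "elts z \<subseteq> range hstring" by simp_all
    then show "z \<in> hS ` OM" by (rule *)
  next
    fix z assume "z \<in> hS ` OM"
    then show "z \<in> elts (hPow (hS UNIV))" by (auto simp: OM_def)
  qed
qed

lemma finite_OM: "finite A \<Longrightarrow> A \<in> OM"
  unfolding OM_def hS_def by (auto intro!: finite_in_M)

lemma Un_OM:
  assumes "A \<in> OM" "B \<in> OM" shows "A \<union> B \<in> OM"
  by (rule OM_I[where P = "\<lambda>z. z \<in> elts (hS A) \<or> z \<in> elts (hS B)"])
    (intro dfn_intros dft_const OM_D assms, auto)

lemma reals_in_I:
  assumes "dfn (\<lambda>e. P (e 0))" "\<And>n. x n \<longleftrightarrow> P (hnat n)"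
  shows "x \<in> reals_in M"
proof -
  have "hseq (\<lambda>n. hbool (x n)) \<in> M"
  proof (rule hseqI)
    show "dft (\<lambda>e. if P (e 0) then hbool True else hbool False)"
      by (intro dfn_intros assms(1) dft_const hbool_in_M)
  qed (simp add: assms(2))
  then show ?thesis by (simp add: reals_in_def hreal_def)
qed

lemma choose_seq:
  assumes R: "dfn (\<lambda>e. R (e 0) (e 1))" and Y: "Y \<in> M"
    and ex: "\<And>n. \<exists>y\<in>elts Y. R (hnat n) y"
  obtains h where "hseq h \<in> M" "\<And>n. h n \<in> elts Y" "\<And>n. R (hnat n) (h n)"
proof -
  \<comment> \<open>Tagging with \<open>n\<close> makes the family disjoint, as the transversal form
    of choice requires.\<close>
  define B where "B n = hset ((\<lambda>y. hpair n y) ` elts (hset {y \<in> elts Y. R n y}))" for n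
  have B: "elts (B n) = hpair n ` {y \<in> elts Y. R n y}" for n by (simp add: B_def)
  define a where "a = hset (B ` elts homega)"
  have aM: "a \<in> M" unfolding a_def B_def
    by (rule dft_closed, intro dfn_intros dfn_subst2[OF R] dft_const homega_in_M Y)
  have ea: "elts a = range (\<lambda>n. B (hnat n))" by (simp add: a_def image_image)
  have in_a: "B (hnat n) \<in> elts a" for n by (simp add: ea)
  have BM: "B (hnat n) \<in> M" for n using elts_in_M[OF aM in_a] .
  have zM: "z \<in> M" if "z \<in> elts (B (hnat n))" for z n using elts_in_M[OF BM that] .
  have ne: "\<exists>z\<in>M. z \<in> elts (B (hnat n))" for n
  proof -
    obtain y where "y \<in> elts Y" "R (hnat n) y" using ex by blast
    then have "hpair (hnat n) y \<in> elts (B (hnat n))" by (simp add: B)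
    then show ?thesis using zM by blast
  qed
  have "ax_choice M" using zfc_M by (simp add: models_ZFC_def)
  then have ax: "(\<forall>x\<in>M. x \<in> elts a \<longrightarrow> (\<exists>z\<in>M. z \<in> elts x)) \<and>
       (\<forall>x\<in>M. \<forall>y\<in>M. x \<in> elts a \<and> y \<in> elts a \<and> x \<noteq> y \<longrightarrow>
          \<not> (\<exists>z\<in>M. z \<in> elts x \<and> z \<in> elts y)) \<longrightarrow>
       (\<exists>c\<in>M. \<forall>x\<in>M. x \<in> elts a \<longrightarrow> (\<exists>!z. z \<in> M \<and> z \<in> elts x \<and> z \<in> elts c))"
    using aM unfolding ax_choice_def by (rule bspec)
  have c1: "\<forall>x\<in>M. x \<in> elts a \<longrightarrow> (\<exists>z\<in>M. z \<in> elts x)"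
  proof (intro ballI impI)
    fix x assume "x \<in> elts a"
    then obtain n where "x = B (hnat n)" unfolding ea by (rule rangeE)
    then show "\<exists>z\<in>M. z \<in> elts x" using ne by simp
  qed
  have c2: "\<forall>x\<in>M. \<forall>y\<in>M. x \<in> elts a \<and> y \<in> elts a \<and> x \<noteq> y \<longrightarrow> \<not> (\<exists>z\<in>M. z \<in> elts x \<and> z \<in> elts y)"
  proof (intro ballI impI notI)
    fix x y assume xy: "x \<in> elts a \<and> y \<in> elts a \<and> x \<noteq> y" and "\<exists>z\<in>M. z \<in> elts x \<and> z \<in> elts y"
    then obtain z where z: "z \<in> elts x" "z \<in> elts y" by blast
    obtain n m where "x = B (hnat n)" "y = B (hnat m)" using xy unfolding ea by blast
    then show False using z xy by (auto simp: B)
  qed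
  from mp[OF ax conjI[OF c1 c2]] obtain c where cM: "c \<in> M"
    and c0: "\<forall>x\<in>M. x \<in> elts a \<longrightarrow> (\<exists>!z. z \<in> M \<and> z \<in> elts x \<and> z \<in> elts c)"
    by (rule bexE)
  note c = cM c0[rule_format]
  have "\<exists>y. y \<in> elts Y \<and> R (hnat n) y \<and> hpair (hnat n) y \<in> elts c \<and>
      (\<forall>z\<in>elts (B (hnat n)). z \<in> elts c \<longrightarrow> z = hpair (hnat n) y)" for n
  proof -
    obtain z where z: "z \<in> elts (B (hnat n))" "z \<in> elts c"
      "\<And>z'. z' \<in> M \<Longrightarrow> z' \<in> elts (B (hnat n)) \<Longrightarrow> z' \<in> elts c \<Longrightarrow> z' = z"
      using c(2)[OF BM in_a, of n] by metis
    obtain y where "z = hpair (hnat n) y" "y \<in> elts Y" "R (hnat n) y" using z(1) unfolding B by auto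
    then show ?thesis using z zM by metis
  qed
  then obtain h where h: "\<And>n. h n \<in> elts Y" "\<And>n. R (hnat n) (h n)" "\<And>n. hpair (hnat n) (h n) \<in> elts c"
    "\<And>n z. z \<in> elts (B (hnat n)) \<Longrightarrow> z \<in> elts c \<Longrightarrow> z = hpair (hnat n) (h n)"
    by metis
  have "hset {z \<in> elts (hUnion a). z \<in> elts c} \<in> M"
    by (rule dft_closed, intro dfn_intros dft_const aM c(1))
  moreover have "hset {z \<in> elts (hUnion a). z \<in> elts c} = hseq h"
  proof (rule hc_ext)
    have "hpair (hnat n) (h n) \<in> elts (B (hnat n))" for n using h(1,2) by (simp add: B)
    then have "z \<in> elts (hUnion a) \<and> z \<in> elts c \<longleftrightarrow> (\<exists>n. z = hpair (hnat n) (h n))" for z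
      unfolding elts_hUnion ea using h(3,4) by blast
    then show "elts (hset {z \<in> elts (hUnion a). z \<in> elts c}) = elts (hseq h)"
      unfolding elts_hset[OF countable_sep] elts_hseq by blast
  qed
  ultimately have "hseq h \<in> M" by simp
  then show ?thesis using h(1,2) by (rule that)
qed

end

section \<open>The fair coin measure\<close>

text \<open>With a countable base on \<open>bool\<close>, the product sigma-algebra of
  \<open>coin\<close> is the Borel algebra of the statement.\<close>

instance bool :: second_countable_topology
proof
  have "open = generate_topology (Collect (open :: bool set \<Rightarrow> bool))"
  proof (intro ext iffI)
    fix S :: "bool set" assume "generate_topology (Collect open) S"
    then show "open S" by induction auto
  qed (auto intro: generate_topology.Basis)
  then show "\<exists>B :: bool set set. countable B \<and> open = generate_topology B"
    by (intro exI[of _ "Collect open"]) (simp add: countable_finite)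
qed

definition coin :: "(nat \<Rightarrow> bool) measure" where
  "coin = PiM UNIV (\<lambda>_. measure_pmf (bernoulli_pmf (1 / 2)))"

abbreviation mu :: "(nat \<Rightarrow> bool) set \<Rightarrow> real" where
  "mu \<equiv> measure coin"

interpretation coin: prob_space coin
  unfolding coin_def by (intro prob_space_PiM prob_space_measure_pmf)

lemma space_coin [simp]: "space coin = UNIV"
  by (simp add: coin_def space_PiM)

lemma sets_coin [simp, measurable_cong]: "sets coin = sets borel"
proof -
  have "sets (borel :: bool measure) = UNIV"
  proof -
    have "A \<in> sets (borel :: bool measure)" for A
      by (rule sets.countable) auto
    then show ?thesis by auto
  qed
  then have "sets (borel :: bool measure) = sets (measure_pmf (bernoulli_pmf (1 / 2)))" by simp
  then have "sets coin = sets (PiM UNIV (\<lambda>_. borel :: bool measure))"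
    unfolding coin_def by (intro sets_PiM_cong) simp_all
  also have "\<dots> = sets borel" by (rule sets_PiM_equal_borel)
  finally show ?thesis .
qed

lemma emeasure_coin_finite:
  assumes "finite J"
  shows "emeasure coin {x. \<forall>i\<in>J. x i = f i} = ennreal ((1 / 2) ^ card J)"
proof -
  interpret product_prob_space "\<lambda>_. measure_pmf (bernoulli_pmf (1 / 2))" "UNIV :: nat set"
    by unfold_locales
  have "emeasure coin {x \<in> space coin. \<forall>i\<in>J. x i \<in> {f i}} =
      (\<Prod>i\<in>J. emeasure (measure_pmf (bernoulli_pmf (1 / 2))) {f i})"
    unfolding coin_def using assms by (intro emeasure_PiM_Collect) auto
  also have "\<dots> = (\<Prod>i\<in>J. ennreal (1 / 2))"
  proof (intro prod.cong refl)
    show "emeasure (measure_pmf (bernoulli_pmf (1 / 2))) {f i} = ennreal (1 / 2)" for i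
      by (cases "f i") (simp_all add: emeasure_pmf_single)
  qed
  also have "\<dots> = ennreal ((1 / 2) ^ card J)" 
    unfolding prod_constant by (rule ennreal_power) simp
  finally show ?thesis by simp
qed

lemma mu_finite: "finite J \<Longrightarrow> mu {x. \<forall>i\<in>J. x i = f i} = (1 / 2) ^ card J"
  by (simp add: measure_def emeasure_coin_finite)

lemma mu_cylinder [simp]: "mu (cylinder s) = (1 / 2) ^ length s"
proof -
  have "cylinder s = {x. \<forall>i\<in>{..<length s}. x i = s ! i}" by (auto simp: cylinder_def)
  then show ?thesis by (simp add: mu_finite)
qed

lemma sets_cylinder [measurable, simp]: "cylinder s \<in> sets borel"
proof -
  have "{x \<in> space coin. \<forall>i\<in>{..<length s}. x i = s ! i} \<in> sets coin"
    unfolding coin_def by measurable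
  moreover have "cylinder s = {x \<in> space coin. \<forall>i\<in>{..<length s}. x i = s ! i}"
    by (auto simp: cylinder_def)
  ultimately show ?thesis by simp
qed

lemma sets_ucyl [measurable, simp]: "ucyl A \<in> sets borel"
  unfolding ucyl_def by (intro sets.countable_UN' countableI_type) auto

lemma sets_borel_of [measurable, simp]: "borel_of UNIV c \<in> sets borel"
  by (induction c) auto

lemma distr_coin_permute:
  assumes "inj \<pi>"
  shows "distr coin coin (\<lambda>x n. x (\<pi> n)) = coin"
  unfolding coin_def
  using distr_PiM_reindex[of UNIV "\<lambda>_. measure_pmf (bernoulli_pmf (1 / 2))" \<pi> UNIV,
      OF prob_space_measure_pmf assms] by (simp add: restrict_UNIV)

lemma measurable_permute [measurable]: "(\<lambda>x n. x (\<pi> n)) \<in> coin \<rightarrow>\<^sub>M coin"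
  unfolding coin_def by (rule measurable_PiM_single') (auto simp: space_PiM)

text \<open>The 2^n possible patterns at the \<open>a j\<close> each fix 2n distinct coordinates and
  so have measure 2^-2n; together they have at most 2^-n.\<close>

lemma mu_coincidences:
  fixes a b :: "nat \<Rightarrow> nat"
  assumes inj: "inj_on a {..<n}" "inj_on b {..<n}" "a ` {..<n} \<inter> b ` {..<n} = {}"
  shows "mu {x. \<forall>j<n. x (a j) = x (b j)} \<le> (1 / 2) ^ n"
proof -
  let ?L = "{v :: bool list. length v = n}"
  define F where "F v = {x. \<forall>i\<in>a ` {..<n} \<union> b ` {..<n}. x i =
    (if i \<in> a ` {..<n} then v ! the_inv_into {..<n} a i else v ! the_inv_into {..<n} b i)}" for v :: "bool list"
  have sets: "F v \<in> sets borel" for v :: "bool list"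
  proof -
    have "{x \<in> space coin. \<forall>i\<in>a ` {..<n} \<union> b ` {..<n}. x i =
      (if i \<in> a ` {..<n} then v ! the_inv_into {..<n} a i else v ! the_inv_into {..<n} b i)} \<in> sets coin"
      unfolding coin_def by measurable
    then show ?thesis by (simp add: F_def)
  qed
  have L: "finite ?L" "card ?L = 2 ^ n"
    using finite_lists_length_eq[of "UNIV :: bool set" n] card_lists_length_eq[of "UNIV :: bool set" n] by simp_all
  have "card (a ` {..<n} \<union> b ` {..<n}) = 2 * n"
    using inj by (simp add: card_Un_disjoint card_image)
  then have muF: "mu (F v) = (1 / 2) ^ (2 * n)" for v :: "bool list"
    unfolding F_def by (subst mu_finite) auto
  have sub: "{x. \<forall>j<n. x (a j) = x (b j)} \<subseteq> (\<Union>v\<in>?L. F v)"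
  proof
    fix x :: "nat \<Rightarrow> bool" assume x: "x \<in> {x. \<forall>j<n. x (a j) = x (b j)}"
    let ?v = "map (\<lambda>j. x (a j)) [0..<n]"
    have "x \<in> F ?v" unfolding F_def
    proof (intro CollectI ballI)
      fix i assume i: "i \<in> a ` {..<n} \<union> b ` {..<n}"
      show "x i = (if i \<in> a ` {..<n} then ?v ! the_inv_into {..<n} a i else ?v ! the_inv_into {..<n} b i)"
      proof (cases "i \<in> a ` {..<n}")
        case True
        then obtain j where "j < n" "i = a j" by auto
        then show ?thesis using True the_inv_into_f_f[OF inj(1), of j] by simp
      next
        case False
        then obtain j where "j < n" "i = b j" using i by auto
        then show ?thesis using False x the_inv_into_f_f[OF inj(2), of j] by simp
      qed
    qed
    then show "x \<in> (\<Union>v\<in>?L. F v)" by (rule UN_I[rotated]) simp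
  qed
  have "mu {x. \<forall>j<n. x (a j) = x (b j)} \<le> mu (\<Union>v\<in>?L. F v)"
    by (rule coin.finite_measure_mono[OF sub]) (use L sets in \<open>auto intro!: sets.finite_UN\<close>)
  also have "\<dots> \<le> (\<Sum>v\<in>?L. mu (F v))"
    by (rule coin.finite_measure_subadditive_finite) (use L sets in auto)
  also have "\<dots> = (1 / 2) ^ n"
  proof -
    have "(2::real) ^ n * (1 / 2) ^ (2 * n) = (2 * (1 / 2) ^ 2) ^ n"
      by (simp only: power_mult power_mult_distrib)
    then show ?thesis using L by (simp add: muF power2_eq_square)
  qed
  finally show ?thesis .
qed

section \<open>Open sets as sets of strings, and their measure by counting\<close>

definition pre :: "bool list \<Rightarrow> bool list \<Rightarrow> bool" where
  "pre s t \<longleftrightarrow> (\<forall>i<length s. i < length t \<and> t ! i = s ! i)"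

definition level :: "bool list set \<Rightarrow> nat \<Rightarrow> bool list set" where
  "level A m = {t. length t = m \<and> (\<exists>s\<in>A. pre s t)}"

lemma hstring_image_iff [simp]: "hstring s \<in> hstring ` A \<longleftrightarrow> s \<in> A"
  by (rule inj_image_mem_iff) (simp add: inj_def)

lemma pre_hstring: "elts (hstring s) \<subseteq> elts (hstring t) \<longleftrightarrow> pre s t"
  by (simp add: hstring_subset_iff pre_def)

lemma pre_refl [simp]: "pre s s" by (simp add: pre_def)

lemma pre_trans: "pre s t \<Longrightarrow> pre t u \<Longrightarrow> pre s u"
  by (auto simp: pre_def)

lemma pre_cylinder: "pre s t \<Longrightarrow> cylinder t \<subseteq> cylinder s"
  by (auto simp: pre_def cylinder_def)

lemma cylinder_restrict: "x \<in> cylinder (map x [0..<m])"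
  by (simp add: cylinder_def)

lemma pre_restrict: "x \<in> cylinder s \<Longrightarrow> length s \<le> m \<Longrightarrow> pre s (map x [0..<m])"
  by (auto simp: pre_def cylinder_def)

lemma cylinder_same_length:
  "x \<in> cylinder s \<Longrightarrow> x \<in> cylinder t \<Longrightarrow> length s = length t \<Longrightarrow> s = t"
  by (rule nth_equalityI) (auto simp: cylinder_def)

lemma finite_strings_length [simp]: "finite {t :: bool list. length t = m}"
  using finite_lists_length_eq[of "UNIV :: bool set" m] by simp

lemma finite_level [simp]: "finite (level A m)"
  by (rule finite_subset[OF _ finite_strings_length[of m]]) (auto simp: level_def)

lemma mu_same_length:
  assumes "finite T" "\<And>t. t \<in> T \<Longrightarrow> length t = m"
  shows "mu (ucyl T) = card T * (1 / 2) ^ m"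
proof -
  have "disjoint_family_on cylinder T"
    using assms(2) cylinder_same_length unfolding disjoint_family_on_def by blast
  then have "mu (ucyl T) = (\<Sum>t\<in>T. mu (cylinder t))"
    unfolding ucyl_def by (intro coin.finite_measure_finite_Union assms(1)) auto
  then show ?thesis using assms(2) by simp
qed

lemma ucyl_mono: "(\<And>t. t \<in> A \<Longrightarrow> \<exists>s\<in>B. pre s t) \<Longrightarrow> ucyl A \<subseteq> ucyl B"
  unfolding ucyl_def using pre_cylinder by blast

lemma mu_level: "mu (ucyl (level A m)) = card (level A m) * (1 / 2) ^ m"
  by (rule mu_same_length) (auto simp: level_def)

lemma mu_level_le: "card (level A m) * (1 / 2) ^ m \<le> mu (ucyl A)"
proof -
  have "ucyl (level A m) \<subseteq> ucyl A" by (rule ucyl_mono) (auto simp: level_def)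
  then have "mu (ucyl (level A m)) \<le> mu (ucyl A)" by (rule coin.finite_measure_mono) simp
  then show ?thesis by (simp add: mu_level)
qed

lemma level_restrict:
  assumes "x \<in> cylinder s" "s \<in> A" "length s \<le> m"
  shows "x \<in> ucyl (level A m)"
proof -
  have "map x [0..<m] \<in> level A m"
    using pre_restrict[OF assms(1,3)] assms(2) unfolding level_def by auto
  then show ?thesis unfolding ucyl_def using cylinder_restrict by blast
qed

lemma mu_level_tendsto: "(\<lambda>m. card (level A m) * (1 / 2) ^ m) \<longlonglongrightarrow> mu (ucyl A)"
proof -
  have "ucyl A = (\<Union>m. ucyl (level A m))"
  proof
    show "(\<Union>m. ucyl (level A m)) \<subseteq> ucyl A"
      by (intro UN_least ucyl_mono) (auto simp: level_def)
    show "ucyl A \<subseteq> (\<Union>m. ucyl (level A m))"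
    proof
      fix x assume "x \<in> ucyl A"
      then obtain s where "s \<in> A" "x \<in> cylinder s" by (auto simp: ucyl_def)
      then have "x \<in> ucyl (level A (length s))" by (intro level_restrict) auto
      then show "x \<in> (\<Union>m. ucyl (level A m))" by blast
    qed
  qed
  moreover have "incseq (\<lambda>m. ucyl (level A m))"
  proof (rule incseq_SucI, rule subsetI)
    fix m x assume "x \<in> ucyl (level A m)"
    then obtain t s where "s \<in> A" "pre s t" "length t = m" "x \<in> cylinder t"
      by (auto simp: ucyl_def level_def)
    moreover from this have "length s \<le> m" unfolding pre_def by (meson not_le order_less_irrefl)
    ultimately show "x \<in> ucyl (level A (Suc m))"
      using pre_cylinder level_restrict[of x s A "Suc m"] by auto
  qed
  ultimately have "(\<lambda>m. mu (ucyl (level A m))) \<longlonglongrightarrow> mu (ucyl A)"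
    using coin.finite_Lim_measure_incseq[of "\<lambda>m. ucyl (level A m)"] by (simp add: image_subset_iff)
  then show ?thesis by (simp add: mu_level)
qed

text \<open>The measure of an open set is the increasing limit of the densities of its levels, so a
  bound on it becomes a statement about cardinalities of finite sets of strings, which
  \<open>M\<close> can express. Only large \<open>m\<close> matter, hence the free start
  \<open>k\<close>.\<close>

lemma mu_le_iff_level:
  fixes q :: real
  shows "mu (ucyl A) \<le> q \<longleftrightarrow> (\<forall>m\<ge>k. card (level A m) \<le> q * 2 ^ m)"
proof
  assume q: "mu (ucyl A) \<le> q"
  show "\<forall>m\<ge>k. card (level A m) \<le> q * 2 ^ m"
  proof (intro allI impI)
    fix m
    have "card (level A m) * (1 / 2) ^ m \<le> q" using mu_level_le[of A m] q by simp
    then show "card (level A m) \<le> q * 2 ^ m" by (simp add: field_simps power_divide)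
  qed
next
  assume q: "\<forall>m\<ge>k. card (level A m) \<le> q * 2 ^ m"
  have "eventually (\<lambda>m. card (level A m) * (1 / 2) ^ m \<le> q) sequentially"
    using q by (intro eventually_sequentiallyI[of k]) (simp add: field_simps power_divide)
  with mu_level_tendsto show "mu (ucyl A) \<le> q"
    by (intro tendsto_upperbound) auto
qed

lemma ucyl_Un: "ucyl (A \<union> B) = ucyl A \<union> ucyl B"
  by (auto simp: ucyl_def)

text \<open>The intersection of two open sets is generated by common extensions of their strings;
  the strings common to \<open>A\<close> and \<open>B\<close> would not be enough.\<close>

definition smeet :: "bool list set \<Rightarrow> bool list set \<Rightarrow> bool list set" where
  "smeet A B = {t. (\<exists>s\<in>A. pre s t) \<and> (\<exists>s\<in>B. pre s t)}"

lemma ucyl_smeet: "ucyl (smeet A B) = ucyl A \<inter> ucyl B"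
proof
  show "ucyl (smeet A B) \<subseteq> ucyl A \<inter> ucyl B"
    unfolding smeet_def ucyl_def using pre_cylinder by blast
  show "ucyl A \<inter> ucyl B \<subseteq> ucyl (smeet A B)"
  proof
    fix x assume "x \<in> ucyl A \<inter> ucyl B"
    then obtain s t where st: "s \<in> A" "x \<in> cylinder s" "t \<in> B" "x \<in> cylinder t"
      by (auto simp: ucyl_def)
    then have "pre s (map x [0..<max (length s) (length t)])" "pre t (map x [0..<max (length s) (length t)])"
      by (simp_all add: pre_restrict)
    then have "map x [0..<max (length s) (length t)] \<in> smeet A B"
      unfolding smeet_def using st by blast
    then show "x \<in> ucyl (smeet A B)" using cylinder_restrict unfolding ucyl_def by blast
  qed
qed

text \<open>Yardsticks inside \<open>M\<close>: among the strings of length \<open>m\<close>, those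
  starting with \<open>k\<close> zeros have proportion 2^-k and the others 1 - 2^-k, so measure
  bounds become comparisons of cardinalities.\<close>

lemma level_zeros:
  assumes "k \<le> m"
  shows "card (level {replicate k False} m) = (2::real) ^ m * (1 / 2) ^ k"
    and "card {t :: bool list. length t = m \<and> \<not> pre (replicate k False) t} = (2::real) ^ m * (1 - (1 / 2) ^ k)"
proof -
  let ?z = "replicate k False"
  have "ucyl (level {?z} m) = cylinder ?z"
  proof
    have "ucyl (level {?z} m) \<subseteq> ucyl {?z}" by (rule ucyl_mono) (auto simp: level_def)
    then show "ucyl (level {?z} m) \<subseteq> cylinder ?z" by (simp add: ucyl_def)
    show "cylinder ?z \<subseteq> ucyl (level {?z} m)" using level_restrict[of _ ?z "{?z}" m] assms by auto
  qed
  then have "card (level {?z} m) * (1 / 2) ^ m = mu (cylinder ?z)" using mu_level[of "{?z}" m] by simp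
  then show *: "card (level {?z} m) = (2::real) ^ m * (1 / 2) ^ k" by (simp add: field_simps power_divide)
  have L: "finite {t :: bool list. length t = m}" "card {t :: bool list. length t = m} = 2 ^ m"
    using finite_lists_length_eq[of "UNIV :: bool set" m] card_lists_length_eq[of "UNIV :: bool set" m] by simp_all
  have "{t. length t = m \<and> \<not> pre ?z t} = {t. length t = m} - level {?z} m" by (auto simp: level_def)
  moreover have "level {?z} m \<subseteq> {t. length t = m}" by (auto simp: level_def)
  ultimately have "card {t. length t = m \<and> \<not> pre ?z t} = 2 ^ m - card (level {?z} m)"
    using L by (simp add: card_Diff_subset)
  moreover have "card (level {?z} m) \<le> 2 ^ m"
    using card_mono[OF L(1), of "level {?z} m"] L(2) by (auto simp: level_def)
  ultimately show "card {t. length t = m \<and> \<not> pre ?z t} = (2::real) ^ m * (1 - (1 / 2) ^ k)"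
    using * by (simp add: of_nat_diff right_diff_distrib)
qed

definition hzeros :: "hc \<Rightarrow> hc" where
  "hzeros k = hset ((\<lambda>j. hpair j (hbool False)) ` elts k)"

lemma hzeros_hnat [simp]: "hzeros (hnat k) = hstring (replicate k False)"
  unfolding hzeros_def by (rule hc_ext) (auto simp: elts_hnat elts_hstring image_iff)

lemma hstring_snoc:
  "hUn (hstring s) (hup (hpair (hnat (length s)) (hbool b)) (hpair (hnat (length s)) (hbool b))) = hstring (s @ [b])"
proof (rule hc_ext)
  have "{..<length (s @ [b])} = insert (length s) {..<length s}" by auto
  then show "elts (hUn (hstring s) (hup (hpair (hnat (length s)) (hbool b)) (hpair (hnat (length s)) (hbool b)))) =
    elts (hstring (s @ [b]))"
    by (auto simp: elts_hstring nth_append)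
qed

lemma hup_hS: "hup (hstring s) (hstring s) = hS {s}"
  by (rule hc_ext) simp

definition hlevel :: "hc \<Rightarrow> hc \<Rightarrow> hc" where
  "hlevel a m = hset {t \<in> elts (hS UNIV). hlen t = m \<and> (\<exists>s\<in>elts a. elts s \<subseteq> elts t)}"

definition hmeet :: "hc \<Rightarrow> hc \<Rightarrow> hc" where
  "hmeet a b = hset {t \<in> elts (hS UNIV). (\<exists>s\<in>elts a. elts s \<subseteq> elts t) \<and> (\<exists>s\<in>elts b. elts s \<subseteq> elts t)}"

lemma hlevel_hS [simp]: "hlevel (hS A) (hnat m) = hS (level A m)"
  unfolding hlevel_def level_def by (rule hc_ext) (auto simp: pre_hstring)

lemma hmeet_hS [simp]: "hmeet (hS A) (hS B) = hS (smeet A B)"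
  unfolding hmeet_def smeet_def by (rule hc_ext) (auto simp: pre_hstring)

section \<open>Measure bounds and compactness expressed in the model\<close>

context ctm
begin

text \<open>Comparison of cardinalities by a total relation in which distinct arguments share no
  value in \<open>y\<close>; \<open>hinj_iff\<close> selects an injection from it.\<close>

definition hinj :: "hc \<Rightarrow> hc \<Rightarrow> bool" where
  "hinj x y \<longleftrightarrow> (\<exists>f\<in>M. (\<forall>u\<in>elts x. \<exists>v\<in>elts y. hpair u v \<in> elts f) \<and>
    (\<forall>u\<in>elts x. \<forall>u'\<in>elts x. \<forall>v\<in>elts y. hpair u v \<in> elts f \<and> hpair u' v \<in> elts f \<longrightarrow> u = u'))"

lemma dfn_hinj [dfn_intros]:
  assumes "dft s" "dft t" shows "dfn (\<lambda>e. hinj (s e) (t e))"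
  by (rule dfn_subst2[OF _ assms]) (unfold hinj_def, intro dfn_intros)

lemma hinj_iff:
  assumes fin: "finite (elts x)" "finite (elts y)" and M: "elts x \<subseteq> M" "elts y \<subseteq> M"
  shows "hinj x y \<longleftrightarrow> card (elts x) \<le> card (elts y)"
proof
  assume "hinj x y"
  then obtain f where f: "\<And>u. u \<in> elts x \<Longrightarrow> \<exists>v\<in>elts y. hpair u v \<in> elts f"
    "\<And>u u' v. u \<in> elts x \<Longrightarrow> u' \<in> elts x \<Longrightarrow> v \<in> elts y \<Longrightarrow> hpair u v \<in> elts f \<Longrightarrow> hpair u' v \<in> elts f \<Longrightarrow> u = u'"
    unfolding hinj_def by metis
  obtain g where g: "\<And>u. u \<in> elts x \<Longrightarrow> g u \<in> elts y \<and> hpair u (g u) \<in> elts f"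
    using f(1) by metis
  have "inj_on g (elts x)" by (rule inj_onI) (metis f(2) g)
  then show "card (elts x) \<le> card (elts y)" using g fin by (intro card_inj_on_le[of g]) auto
next
  assume "card (elts x) \<le> card (elts y)"
  then obtain g where g: "g ` elts x \<subseteq> elts y" "inj_on g (elts x)"
    using card_le_inj[OF fin] by blast
  let ?f = "hset ((\<lambda>u. hpair u (g u)) ` elts x)"
  have "?f \<in> M" using g(1) M fin by (intro finite_in_M) (auto intro!: hpair_in_M)
  moreover have f: "hpair u v \<in> elts ?f \<longleftrightarrow> u \<in> elts x \<and> v = g u" for u v by auto
  have "\<forall>u\<in>elts x. \<exists>v\<in>elts y. hpair u v \<in> elts ?f" unfolding f using g(1) by blast
  moreover have "\<forall>u\<in>elts x. \<forall>u'\<in>elts x. \<forall>v\<in>elts y. hpair u v \<in> elts ?f \<and> hpair u' v \<in> elts ?f \<longrightarrow> u = u'"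
    unfolding f using g(2) by (simp add: inj_on_def)
  ultimately show "hinj x y" unfolding hinj_def by blast
qed

text \<open>On codes this is measure at most 2^-k: at every length from \<open>k\<close> on, the
  level injects into the strings that start with \<open>k\<close> zeros.\<close>

definition hsmall :: "hc \<Rightarrow> hc \<Rightarrow> bool" where
  "hsmall a k \<longleftrightarrow> (\<forall>m\<in>elts homega. k \<in> elts m \<or> k = m \<longrightarrow>
     hinj (hlevel a m) (hlevel (hup (hzeros k) (hzeros k)) m))"

text \<open>On codes this is measure at most 1 - 2^-k. That some \<open>k\<close> satisfies it means
  that the complementary closed set has positive measure.\<close>

definition hcosmall :: "hc \<Rightarrow> hc \<Rightarrow> bool" where
  "hcosmall a k \<longleftrightarrow> (\<forall>m\<in>elts homega. k \<in> elts m \<or> k = m \<longrightarrow>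
     hinj (hlevel a m) (hset {t \<in> elts (hS UNIV). hlen t = m \<and> \<not> elts (hzeros k) \<subseteq> elts t}))"

lemma dft_hlevel [dfn_intros]:
  assumes "dft s" "dft t" shows "dft (\<lambda>e. hlevel (s e) (t e))"
  by (rule dft_subst2[OF _ assms]) (unfold hlevel_def, intro dfn_intros dft_const strings_in_M)

lemma dft_hmeet [dfn_intros]:
  assumes "dft s" "dft t" shows "dft (\<lambda>e. hmeet (s e) (t e))"
  by (rule dft_subst2[OF _ assms]) (unfold hmeet_def, intro dfn_intros dft_const strings_in_M)

lemma dft_hzeros [dfn_intros]:
  assumes "dft s" shows "dft (\<lambda>e. hzeros (s e))"
  by (rule dft_subst1[OF _ assms]) (unfold hzeros_def, intro dfn_intros dft_const hbool_in_M)

lemma dfn_hsmall [dfn_intros]: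
  assumes "dft s" "dft t" shows "dfn (\<lambda>e. hsmall (s e) (t e))"
  by (rule dfn_subst2[OF _ assms]) (unfold hsmall_def, intro dfn_intros dft_const homega_in_M)

lemma dfn_hcosmall [dfn_intros]:
  assumes "dft s" "dft t" shows "dfn (\<lambda>e. hcosmall (s e) (t e))"
  by (rule dfn_subst2[OF _ assms]) (unfold hcosmall_def, intro dfn_intros dft_const homega_in_M strings_in_M)

lemma hinj_hS: "finite A \<Longrightarrow> finite B \<Longrightarrow> hinj (hS A) (hS B) \<longleftrightarrow> card A \<le> card B"
  by (subst hinj_iff) (auto simp: card_image inj_on_def)

lemma hsmall_iff: "hsmall (hS A) (hnat k) \<longleftrightarrow> mu (ucyl A) \<le> (1 / 2) ^ k"
proof -
  have "hsmall (hS A) (hnat k) \<longleftrightarrow> (\<forall>m\<ge>k. card (level A m) \<le> card (level {replicate k False} m))"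
    unfolding hsmall_def by (simp add: hup_hS hinj_hS order_le_less del: hnat.simps)
  also have "\<dots> \<longleftrightarrow> (\<forall>m\<ge>k. real (card (level A m)) \<le> (1 / 2) ^ k * 2 ^ m)"
  proof -
    have "card (level A m) \<le> card (level {replicate k False} m) \<longleftrightarrow> real (card (level A m)) \<le> (1 / 2) ^ k * 2 ^ m" if "k \<le> m" for m
    proof -
      have "card (level A m) \<le> card (level {replicate k False} m) \<longleftrightarrow> real (card (level A m)) \<le> real (card (level {replicate k False} m))"
        by (simp only: of_nat_le_iff)
      then show ?thesis using level_zeros(1)[OF that] by (simp only: mult.commute)
    qed
    then show ?thesis by blast
  qed
  also have "\<dots> \<longleftrightarrow> mu (ucyl A) \<le> (1 / 2) ^ k" by (rule mu_le_iff_level[symmetric])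
  finally show ?thesis .
qed

lemma hcosmall_iff: "hcosmall (hS A) (hnat k) \<longleftrightarrow> mu (ucyl A) \<le> 1 - (1 / 2) ^ k"
proof -
  let ?C = "\<lambda>m. {t :: bool list. length t = m \<and> \<not> pre (replicate k False) t}"
  have C: "hset {t \<in> elts (hS UNIV). hlen t = hnat m \<and> \<not> elts (hzeros (hnat k)) \<subseteq> elts t} = hS (?C m)" for m
  proof (rule hc_ext, intro set_eqI)
    fix z
    show "z \<in> elts (hset {t \<in> elts (hS UNIV). hlen t = hnat m \<and> \<not> elts (hzeros (hnat k)) \<subseteq> elts t}) \<longleftrightarrow>
        z \<in> elts (hS (?C m))"
    proof (cases "z \<in> range hstring")
      case True
      then obtain t where "z = hstring t" by blast
      then show ?thesis unfolding elts_hset[OF countable_sep] hzeros_hnat by (simp add: pre_hstring)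
    qed auto
  qed
  have fin: "finite (?C m)" for m
    by (rule finite_subset[OF _ finite_strings_length[of m]]) auto
  have "hcosmall (hS A) (hnat k) \<longleftrightarrow> (\<forall>m\<ge>k. card (level A m) \<le> card (?C m))"
  proof -
    have "hnat k \<in> elts (hnat m) \<or> hnat k = hnat m \<longleftrightarrow> k \<le> m" for m by auto
    moreover have "hcosmall (hS A) (hnat k) \<longleftrightarrow> (\<forall>m. hnat k \<in> elts (hnat m) \<or> hnat k = hnat m \<longrightarrow>
      hinj (hlevel (hS A) (hnat m)) (hset {t \<in> elts (hS UNIV). hlen t = hnat m \<and> \<not> elts (hzeros (hnat k)) \<subseteq> elts t}))"
      unfolding hcosmall_def elts_homega by blast
    ultimately show ?thesis unfolding C hlevel_hS hinj_hS[OF finite_level fin] by simp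
  qed
  also have "\<dots> \<longleftrightarrow> (\<forall>m\<ge>k. real (card (level A m)) \<le> (1 - (1 / 2) ^ k) * 2 ^ m)"
  proof -
    have "card (level A m) \<le> card (?C m) \<longleftrightarrow> real (card (level A m)) \<le> (1 - (1 / 2) ^ k) * 2 ^ m" if "k \<le> m" for m
    proof -
      have "card (level A m) \<le> card (?C m) \<longleftrightarrow> real (card (level A m)) \<le> real (card (?C m))"
        by (simp only: of_nat_le_iff)
      then show ?thesis using level_zeros(2)[OF that] by (simp only: mult.commute)
    qed
    then show ?thesis by blast
  qed
  also have "\<dots> \<longleftrightarrow> mu (ucyl A) \<le> 1 - (1 / 2) ^ k" by (rule mu_le_iff_level[symmetric])
  finally show ?thesis .
qed

lemma smeet_OM:
  assumes "A \<in> OM" "B \<in> OM" shows "smeet A B \<in> OM"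
proof -
  have "hmeet (hS A) (hS B) \<in> M"
    by (rule dft_closed, intro dfn_intros dft_const OM_D assms)
  then show ?thesis by (simp add: OM_def)
qed

text \<open>Koenig's lemma in \<open>M\<close>. If arbitrarily long strings avoided
  \<open>A\<close>, a definable branch through them would be a real of \<open>M\<close> outside
  \<open>ucyl A\<close>. So all strings from some length on extend a member of \<open>A\<close>, and
  this finite fact is the same in V.\<close>

lemma compact_OM:
  assumes A: "A \<in> OM" and cover: "reals_in M \<subseteq> ucyl A"
  shows "ucyl A = UNIV"
proof -
  define ext where "ext s \<longleftrightarrow> (\<forall>m. \<exists>t. m \<le> length t \<and> pre s t \<and> (\<forall>a\<in>A. \<not> pre a t))" for s
  define hext where "hext z \<longleftrightarrow> (\<forall>m\<in>elts homega. \<exists>t\<in>elts (hS UNIV). elts m \<subseteq> elts (hlen t) \<and> elts z \<subseteq> elts t \<and>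
    (\<forall>a\<in>elts (hS A). \<not> elts a \<subseteq> elts t))" for z
  have dh: "dfn (\<lambda>e. hext (e 0))"
    unfolding hext_def by (intro dfn_intros dft_const homega_in_M strings_in_M OM_D A)
  have hnat_subset: "elts (hnat m) \<subseteq> elts (hnat n) \<longleftrightarrow> m \<le> n" for m n
  proof -
    have "hnat ` {..<m} \<subseteq> hnat ` {..<n} \<longleftrightarrow> {..<m} \<subseteq> {..<n}" by (rule inj_image_subset_iff) (simp add: inj_def)
    then show ?thesis by (simp add: elts_hnat)
  qed
  have hext: "hext (hstring s) \<longleftrightarrow> ext s" for s
    unfolding hext_def ext_def by (simp add: hnat_subset pre_hstring)
  define snoc where "snoc z b = hUn z (hup (hpair (hlen z) (hbool b)) (hpair (hlen z) (hbool b)))" for z b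
  have snoc: "snoc (hstring s) b = hstring (s @ [b])" for s b
    unfolding snoc_def hlen_hstring by (rule hstring_snoc)
  \<comment> \<open>The leftmost choice makes the branch definable, hence an element of
    \<open>M\<close>. It stays among the strings with long extensions only under
    \<open>ext []\<close>, which is refuted below.\<close>
  define br where "br = rec_nat [] (\<lambda>_ s. s @ [\<not> ext (s @ [False])])"
  have br: "br 0 = []" "br (Suc n) = br n @ [\<not> ext (br n @ [False])]" for n
    by (simp_all add: br_def)
  have "hseq (\<lambda>n. hstring (br n)) \<in> M"
  proof (rule hseq_iterate)
    show "dft (\<lambda>e. if hext (snoc (e 0) False) then snoc (e 0) False else snoc (e 0) True)"
      unfolding snoc_def by (intro dfn_intros dfn_subst1[OF dh] dft_const hbool_in_M)
    show "hstring (br (Suc n)) = (if hext (snoc (hstring (br n)) False) then snoc (hstring (br n)) False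
        else snoc (hstring (br n)) True)" for n
      by (simp add: br snoc hext)
  qed simp
  then have R: "hset (range (\<lambda>n. hstring (br n))) \<in> M" by (rule range_in_M)
  have len: "length (br n) = n" for n by (induction n) (simp_all add: br)
  define x where "x n = br (Suc n) ! n" for n
  have br_x: "br k = map x [0..<k]" for k
  proof (induction k)
    case (Suc k)
    then show ?case using len[of k] by (simp add: br x_def nth_append)
  qed (simp add: br)
  have "x \<in> reals_in M"
  proof (rule reals_in_I)
    show "dfn (\<lambda>e. hpair (e 0) (hbool True) \<in> elts (hUnion (hset (range (\<lambda>n. hstring (br n))))))"
      by (intro dfn_intros dft_const R hbool_in_M)
    show "x n \<longleftrightarrow> hpair (hnat n) (hbool True) \<in> elts (hUnion (hset (range (\<lambda>n. hstring (br n)))))" for n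
    proof -
      have "hpair (hnat n) (hbool True) \<in> elts (hUnion (hset (range (\<lambda>n. hstring (br n))))) \<longleftrightarrow>
          (\<exists>k. n < k \<and> map x [0..<k] ! n)" by (simp add: br_x)
      also have "\<dots> \<longleftrightarrow> x n" by (metis add_0 diff_zero lessI nth_map_upt)
      finally show ?thesis by simp
    qed
  qed
  then obtain a where a: "a \<in> A" "x \<in> cylinder a" using cover unfolding ucyl_def by blast
  have "\<not> ext []"
  proof
    assume e0: "ext []"
    have "ext (br n)" for n
    proof (induction n)
      case (Suc n)
      show ?case
      proof (cases "ext (br n @ [False])")
        case False
        then obtain m0 where m0: "\<And>t. m0 \<le> length t \<Longrightarrow> pre (br n @ [False]) t \<Longrightarrow> \<exists>a\<in>A. pre a t"
          unfolding ext_def by blast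
        have "ext (br n @ [True])" unfolding ext_def
        proof
          fix m
          \<comment> \<open>Length at least \<open>m0\<close> rules out the left successor, and
            length above \<open>n\<close> guarantees a bit at place \<open>n\<close>, which must
            then be \<open>True\<close>.\<close>
          obtain t where t: "max (max m m0) (Suc n) \<le> length t" "pre (br n) t" "\<forall>a\<in>A. \<not> pre a t"
            using Suc unfolding ext_def by blast
          have ext1: "pre (br n @ [b]) t \<longleftrightarrow> t ! n = b" for b
            using t(1,2) len[of n] unfolding pre_def by (auto simp: nth_append less_Suc_eq)
          have "\<not> pre (br n @ [False]) t" using m0[of t] t by auto
          then have "pre (br n @ [True]) t" by (simp add: ext1)
          then show "\<exists>t. m \<le> length t \<and> pre (br n @ [True]) t \<and> (\<forall>a\<in>A. \<not> pre a t)" using t by auto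
        qed
        then show ?thesis using False by (simp add: br)
      qed (simp add: br)
    qed (simp add: br e0)
    then have "ext (map x [0..<length a])" using br_x by metis
    then obtain t where "pre (map x [0..<length a]) t" "\<forall>a\<in>A. \<not> pre a t" unfolding ext_def by blast
    then show False using a pre_trans pre_restrict[OF a(2) order_refl] by blast
  qed
  then obtain m where m: "\<And>t. m \<le> length t \<Longrightarrow> \<exists>a\<in>A. pre a t" unfolding ext_def pre_def by auto
  have "y \<in> ucyl A" for y
  proof -
    obtain a where "a \<in> A" "pre a (map y [0..<m])" using m[of "map y [0..<m]"] by auto
    then show ?thesis using pre_cylinder cylinder_restrict[of y m] unfolding ucyl_def by blast
  qed
  then show ?thesis by auto
qed

end

section \<open>Borel codes of the model\<close>

text \<open>Recursion runs along the transitive closure of membership, since the components of a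
  pair lie two membership steps below it.\<close>

lemma wfrec_hmem:
  assumes "\<And>F G. (\<And>y. (y, x) \<in> hmem\<^sup>+ \<Longrightarrow> F y = G y) \<Longrightarrow> body F x = body G x"
  shows "wfrec (hmem\<^sup>+) body x = body (wfrec (hmem\<^sup>+) body) x"
  by (subst wfrec[OF wf_trancl[OF wf_elts]]) (auto intro: assms simp: cut_apply)

lemma hpair_snd_below: "(b, hpair a b) \<in> hmem\<^sup>+"
proof -
  have "b \<in> elts (hup a b)" "hup a b \<in> elts (hpair a b)" by (simp_all add: elts_hpair)
  then have "(b, hup a b) \<in> hmem\<^sup>+" "(hup a b, hpair a b) \<in> hmem\<^sup>+" by (auto intro: r_into_trancl)
  then show ?thesis by (rule trancl_trans)
qed

lemma elts_below: "x \<in> elts y \<Longrightarrow> (x, y) \<in> hmem\<^sup>+"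
  by auto

text \<open>Evaluation of codes as a recursion on sets instead of the datatype, so that it can be
  carried out in \<open>M\<close>. The tags are those of \<open>hcode\<close>; values at sets that
  are no codes have no meaning.\<close>

definition cval_body :: "hc \<Rightarrow> (hc \<Rightarrow> hc) \<Rightarrow> hc \<Rightarrow> hc" where
  "cval_body X F x = (if x = hpair (hfst x) (hsnd x) then
     if hfst x = hnat 0 then hset {z \<in> elts X. elts (hsnd x) \<subseteq> elts z}
     else if hfst x = hnat 1 then hset {z \<in> elts X. z \<notin> elts (F (hsnd x))}
     else hset {z \<in> elts X. \<exists>u\<in>elts (hsnd x). u = hpair (hfst u) (hsnd u) \<and> z \<in> elts (F (hsnd u))}
   else hset {})"

definition cval :: "hc \<Rightarrow> hc \<Rightarrow> hc" where "cval X = wfrec (hmem\<^sup>+) (cval_body X)"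

lemma cval_body_cong:
  assumes "\<And>y. (y, x) \<in> hmem\<^sup>+ \<Longrightarrow> F y = G y"
  shows "cval_body X F x = cval_body X G x"
proof (cases "x = hpair (hfst x) (hsnd x)")
  case True
  have s: "(hsnd x, x) \<in> hmem\<^sup>+" by (subst (2) True) (rule hpair_snd_below)
  have "F (hsnd u) = G (hsnd u)" if "u \<in> elts (hsnd x)" "u = hpair (hfst u) (hsnd u)" for u
  proof (rule assms)
    have "(hsnd u, u) \<in> hmem\<^sup>+" by (subst (2) that(2)) (rule hpair_snd_below)
    then show "(hsnd u, x) \<in> hmem\<^sup>+" using elts_below[OF that(1)] s by (meson trancl_trans)
  qed
  then have "(\<exists>u\<in>elts (hsnd x). u = hpair (hfst u) (hsnd u) \<and> z \<in> elts (F (hsnd u))) \<longleftrightarrow>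
      (\<exists>u\<in>elts (hsnd x). u = hpair (hfst u) (hsnd u) \<and> z \<in> elts (G (hsnd u)))" for z by metis
  then show ?thesis unfolding cval_body_def assms[OF s] by simp
next
  case False
  then show ?thesis unfolding cval_body_def by (simp only: if_False)
qed

lemma cval_unfold: "cval X x = cval_body X (cval X) x"
  unfolding cval_def by (rule wfrec_hmem) (rule cval_body_cong)

lemma borel_of_subset: "borel_of X c \<subseteq> X"
  by (induction c) auto

text \<open>Entries of \<open>hf_enum\<close> that are no member of \<open>A\<close> get the code of
  the empty set, the complement of the full cylinder. Following \<open>hf_enum\<close> makes the
  code definable from \<open>A\<close>.\<close>

definition ocode :: "bool list set \<Rightarrow> borel_code" where
  "ocode A = BUnion (\<lambda>n. if hf_enum n \<in> hstring ` A then BCyl (inv hstring (hf_enum n)) else BCompl (BCyl []))"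

lemma inv_hstring [simp]: "inv hstring (hstring s) = s"
  by (rule inv_f_f) (simp add: inj_def)

lemma borel_of_ocode [simp]: "borel_of X (ocode A) = X \<inter> ucyl A"
proof -
  have "x \<in> borel_of X (ocode A) \<longleftrightarrow> x \<in> X \<and> (\<exists>n. \<exists>s\<in>A. hf_enum n = hstring s \<and> x \<in> cylinder s)" for x
  proof -
    have "x \<in> borel_of X (if hf_enum n \<in> hstring ` A then BCyl (inv hstring (hf_enum n)) else BCompl (BCyl [])) \<longleftrightarrow>
        x \<in> X \<and> (\<exists>s\<in>A. hf_enum n = hstring s \<and> x \<in> cylinder s)" for n
      by (cases "hf_enum n \<in> hstring ` A") (auto simp: cylinder_def)
    then show ?thesis unfolding ocode_def by auto
  qed
  moreover have "\<exists>n. hf_enum n = hstring s" for s using hf_hstring[of s] by auto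
  ultimately show ?thesis unfolding ucyl_def by blast
qed

definition bint :: "borel_code \<Rightarrow> borel_code \<Rightarrow> borel_code" where
  "bint c d = BCompl (BUnion (\<lambda>n. if n = 0 then BCompl c else BCompl d))"

lemma borel_of_bint [simp]: "borel_of X (bint c d) = borel_of X c \<inter> borel_of X d"
  unfolding bint_def using borel_of_subset[of X c] borel_of_subset[of X d] by (auto split: if_splits)

lemma le_zero_if_small:
  fixes x :: real
  assumes "\<And>k. x \<le> (1 / 2) ^ k"
  shows "x \<le> 0"
proof (rule LIMSEQ_le_const[of "\<lambda>k. (1 / 2) ^ k"])
  show "(\<lambda>k. (1 / 2 :: real) ^ k) \<longlonglongrightarrow> 0" by (rule LIMSEQ_realpow_zero) auto
qed (use assms in auto)

lemma mu_mono: "A \<subseteq> B \<Longrightarrow> B \<in> sets borel \<Longrightarrow> mu A \<le> mu B"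
  by (rule coin.finite_measure_mono) simp_all

lemma mu_Un_le: "A \<in> sets borel \<Longrightarrow> B \<in> sets borel \<Longrightarrow> mu (A \<union> B) \<le> mu A + mu B"
  by (rule measure_Un_le) simp_all

lemma mu_UN_zero:
  assumes "\<And>n :: nat. A n \<in> sets borel" "\<And>n. mu (A n) = 0"
  shows "mu (\<Union>n. A n) = 0"
proof -
  have "(\<Union>n. A n) \<in> null_sets coin"
    by (rule null_sets_UN) (use assms in \<open>auto simp: null_sets_def coin.emeasure_eq_measure\<close>)
  then show ?thesis by (simp add: null_sets_def coin.emeasure_eq_measure)
qed

section \<open>Interpretation and regularity of coded Borel sets\<close>

context ctm
begin

text \<open>Definability is checked with a set of pairs in place of the recursive calls; the
  exchange is sound because \<open>body\<close> looks only at values below its argument.\<close>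

lemma wfrec_dft:
  assumes "dft (\<lambda>e. body (\<lambda>y. happ (e 1) y) (e 0))"
    and "\<And>F G x. (\<And>y. (y, x) \<in> hmem\<^sup>+ \<Longrightarrow> F y = G y) \<Longrightarrow> body F x = body G x"
  shows "dft (\<lambda>e. wfrec (hmem\<^sup>+) body (e 0))"
proof (rule rec_dft[OF assms(1)])
  fix x f assume f: "\<And>y v. (y, x) \<in> hmem\<^sup>+ \<Longrightarrow> hpair y v \<in> elts f \<longleftrightarrow> v = wfrec (hmem\<^sup>+) body y"
  have "body (\<lambda>y. happ f y) x = body (wfrec (hmem\<^sup>+) body) x"
    by (rule assms(2)) (rule happ_eq, auto simp: f)
  also have "\<dots> = wfrec (hmem\<^sup>+) body x"
    by (rule wfrec_hmem[symmetric]) (rule assms(2))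
  finally show "body (\<lambda>y. happ f y) x = wfrec (hmem\<^sup>+) body x" .
qed

abbreviation XM :: "(nat \<Rightarrow> bool) set" where "XM \<equiv> reals_in M"
abbreviation bM :: "borel_code \<Rightarrow> (nat \<Rightarrow> bool) set" where "bM c \<equiv> borel_of XM c"
abbreviation bV :: "borel_code \<Rightarrow> (nat \<Rightarrow> bool) set" where "bV c \<equiv> borel_of UNIV c"

lemma borel_cond_hX: "borel_cond M c = hX (bM c)"
  by (simp add: borel_cond_def hX_def)

lemma elts_borel_cond: "elts (borel_cond M c) = hreal ` bM c"
  by (simp add: borel_cond_hX borel_of_subset)

lemma borel_cond_eq_iff: "borel_cond M c = borel_cond M d \<longleftrightarrow> bM c = bM d"
  by (simp add: borel_cond_hX hX_inject borel_of_subset)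

lemma dft_cval [dfn_intros]:
  assumes "dft s" shows "dft (\<lambda>e. cval (hX XM) (s e))"
proof (rule dft_subst1[OF _ assms])
  show "dft (\<lambda>e. cval (hX XM) (e 0))"
    unfolding cval_def
  proof (rule wfrec_dft)
    show "dft (\<lambda>e. cval_body (hX XM) (\<lambda>y. happ (e 1) y) (e 0))"
      unfolding cval_body_def by (intro dfn_intros dft_const hnat_in_M hempty_in_M reals_in_M)
  qed (rule cval_body_cong)
qed

lemma cval_hcode: "cval (hX XM) (hcode c) = borel_cond M c"
proof (induction c)
  case (BCyl s)
  have "cval (hX XM) (hcode (BCyl s)) = hset {z \<in> hreal ` XM. elts (hstring s) \<subseteq> elts z}"
    by (subst cval_unfold) (simp add: cval_body_def)
  also have "{z \<in> hreal ` XM. elts (hstring s) \<subseteq> elts z} = hreal ` bM (BCyl s)"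
  proof -
    have "{z \<in> hreal ` XM. Q z} = hreal ` {x \<in> XM. Q (hreal x)}" for Q by auto
    then show ?thesis by (simp add: hstring_hreal_iff Int_def)
  qed
  finally show ?case by (simp add: borel_cond_def)
next
  case (BCompl c)
  have "cval (hX XM) (hcode (BCompl c)) = hset {z \<in> hreal ` XM. z \<notin> elts (borel_cond M c)}"
    by (subst cval_unfold) (simp add: cval_body_def BCompl del: hnat.simps)
  also have "{z \<in> hreal ` XM. z \<notin> elts (borel_cond M c)} = hreal ` bM (BCompl c)"
    by (auto simp: elts_borel_cond)
  finally show ?case by (simp add: borel_cond_def)
next
  case (BUnion f)
  have "cval (hX XM) (hcode (BUnion f)) =
      hset {z \<in> hreal ` XM. \<exists>u\<in>elts (hseq (\<lambda>n. hcode (f n))). u = hpair (hfst u) (hsnd u) \<and> z \<in> elts (cval (hX XM) (hsnd u))}"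
    by (subst cval_unfold) (simp add: cval_body_def del: hnat.simps)
  also have "{z \<in> hreal ` XM. \<exists>u\<in>elts (hseq (\<lambda>n. hcode (f n))). u = hpair (hfst u) (hsnd u) \<and> z \<in> elts (cval (hX XM) (hsnd u))}
    = hreal ` bM (BUnion f)"
    using borel_of_subset[of XM] by (auto simp: elts_hseq BUnion elts_borel_cond)
  finally show ?case by (simp add: borel_cond_def)
qed

lemma BCompl_codes: "BCompl c \<in> codes_in M \<longleftrightarrow> c \<in> codes_in M"
  by (auto simp: codes_in_def hpair_in_M simp del: hnat.simps dest: hpair_in_MD)

lemma BUnion_codes: "BUnion f \<in> codes_in M \<longleftrightarrow> hseq (\<lambda>n. hcode (f n)) \<in> M"
  by (auto simp: codes_in_def hpair_in_M simp del: hnat.simps dest: hpair_in_MD)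

lemma BCyl_codes [simp]: "BCyl s \<in> codes_in M"
  by (auto simp: codes_in_def hpair_in_M simp del: hnat.simps)

lemma BUnion_codesD: "BUnion f \<in> codes_in M \<Longrightarrow> f n \<in> codes_in M"
  unfolding BUnion_codes using hseq_value_in_M[of "\<lambda>n. hcode (f n)" n] by (simp add: codes_in_def)

lemma bint_codes:
  assumes "c \<in> codes_in M" "d \<in> codes_in M" shows "bint c d \<in> codes_in M"
proof -
  have M: "hcode (BCompl c) \<in> M" "hcode (BCompl d) \<in> M"
    using assms BCompl_codes unfolding codes_in_def by simp_all
  have "hseq (\<lambda>n. hcode (if n = 0 then BCompl c else BCompl d)) \<in> M"
  proof (rule hseqI)
    show "dft (\<lambda>e. if e 0 = hnat 0 then hcode (BCompl c) else hcode (BCompl d))"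
      by (intro dfn_intros dft_const hnat_in_M M)
  qed (simp del: hnat.simps hcode.simps)
  then show ?thesis unfolding bint_def BCompl_codes BUnion_codes .
qed

definition hocode :: "hc \<Rightarrow> hc" where
  "hocode a = hpair (hnat 2) (hset ((\<lambda>n. hpair n (if happ (hseq hf_enum) n \<in> elts a
     then hpair (hnat 0) (happ (hseq hf_enum) n) else hpair (hnat 1) (hpair (hnat 0) (hstring [])))) ` elts homega))"

lemma dft_hocode [dfn_intros]:
  assumes "dft s" shows "dft (\<lambda>e. hocode (s e))"
  by (rule dft_subst1[OF _ assms])
    (unfold hocode_def, intro dfn_intros dft_const hnat_in_M homega_in_M hf_enum_in_M hstring_in_M)

lemma hocode_hS: "hocode (hS A) = hcode (ocode A)"
proof -
  have *: "hset ((\<lambda>n. hpair n (t n)) ` elts homega) = hseq (\<lambda>n. t (hnat n))" for t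
    by (rule hc_ext) (simp add: elts_hseq image_image)
  show ?thesis
    unfolding hocode_def ocode_def hcode.simps *
    by (intro arg_cong2[of _ _ _ _ hpair] arg_cong[of _ _ hseq] refl ext) (auto simp del: hnat.simps)
qed

lemma ocode_codes: "A \<in> OM \<Longrightarrow> ocode A \<in> codes_in M"
proof -
  assume A: "A \<in> OM"
  have "hocode (hS A) \<in> M"
    by (rule dft_closed, intro dfn_intros dft_const OM_D A)
  then show ?thesis by (simp add: hocode_hS codes_in_def)
qed

lemma shift_seq_in_M: "hseq (\<lambda>n. hnat (n + k)) \<in> M"
proof (rule hseq_iterate)
  show "dft (\<lambda>e. hsucc (e 0))" by (intro dfn_intros)
qed simp_all

text \<open>Regularity: inside and outside approximations by open sets of the model, valid both for the
  interpretation of the code in the model and, up to null sets, for the real one.\<close>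

definition approximable :: "borel_code \<Rightarrow> bool" where
  "approximable c \<longleftrightarrow> (\<forall>k. \<exists>A\<in>OM. \<exists>B\<in>OM. bM c \<subseteq> ucyl A \<and> XM - bM c \<subseteq> ucyl B \<and>
     mu (ucyl A \<inter> ucyl B) \<le> (1 / 2) ^ k \<and> mu (bV c - ucyl A) = 0 \<and> mu (- bV c - ucyl B) = 0)"

text \<open>If \<open>B\<close> encloses the complement in \<open>M\<close>, then \<open>W\<close>
  and \<open>B\<close> together cover the reals of \<open>M\<close>, hence everything by
  compactness. So a point off \<open>W\<close> lies in \<open>B\<close>, and what the true set has
  there is in the small overlap of \<open>A\<close> and \<open>B\<close> or in a null set.\<close>

lemma approximable_outer:
  assumes "approximable c" "W \<in> OM" "bM c \<subseteq> ucyl W"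
  shows "mu (bV c - ucyl W) = 0"
proof -
  have "mu (bV c - ucyl W) \<le> (1 / 2) ^ k" for k
  proof -
    obtain A B where AB: "A \<in> OM" "B \<in> OM" "bM c \<subseteq> ucyl A" "XM - bM c \<subseteq> ucyl B"
      "mu (ucyl A \<inter> ucyl B) \<le> (1 / 2) ^ k" "mu (bV c - ucyl A) = 0"
      using assms(1) unfolding approximable_def by meson
    have "XM \<subseteq> ucyl (W \<union> B)" using AB(4) assms(3) by (auto simp: ucyl_Un)
    then have "ucyl (W \<union> B) = UNIV" using compact_OM Un_OM assms(2) AB(2) by blast
    then have "bV c - ucyl W \<subseteq> (bV c - ucyl A) \<union> (ucyl A \<inter> ucyl B)" by (auto simp: ucyl_Un)
    then have "mu (bV c - ucyl W) \<le> mu ((bV c - ucyl A) \<union> (ucyl A \<inter> ucyl B))"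
      by (rule mu_mono) auto
    also have "\<dots> \<le> mu (bV c - ucyl A) + mu (ucyl A \<inter> ucyl B)" by (rule mu_Un_le) auto
    finally show ?thesis using AB(5,6) by simp
  qed
  then show ?thesis using le_zero_if_small measure_nonneg[of coin "bV c - ucyl W"] by (meson order_antisym)
qed

lemma approximable_BCompl:
  assumes "approximable c" shows "approximable (BCompl c)"
  unfolding approximable_def
proof
  fix k
  obtain A B where AB: "A \<in> OM" "B \<in> OM" "bM c \<subseteq> ucyl A" "XM - bM c \<subseteq> ucyl B"
      "mu (ucyl A \<inter> ucyl B) \<le> (1 / 2) ^ k" "mu (bV c - ucyl A) = 0" "mu (- bV c - ucyl B) = 0"
    using assms(1) unfolding approximable_def by meson
  have "XM - (XM - bM c) = bM c" using borel_of_subset[of XM c] by blast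
  then show "\<exists>A\<in>OM. \<exists>B\<in>OM. bM (BCompl c) \<subseteq> ucyl A \<and> XM - bM (BCompl c) \<subseteq> ucyl B \<and>
     mu (ucyl A \<inter> ucyl B) \<le> (1 / 2) ^ k \<and> mu (bV (BCompl c) - ucyl A) = 0 \<and> mu (- bV (BCompl c) - ucyl B) = 0"
    using AB by (intro bexI[of _ B] bexI[of _ A]) (auto simp: Int_commute Compl_eq_Diff_UNIV Diff_Diff_Int)
qed

lemma finite_meet_OM:
  fixes N :: nat
  assumes "\<And>n. B n \<in> OM"
  shows "\<exists>D\<in>OM. ucyl D = (\<Inter>n<N. ucyl (B n))"
proof (induction N)
  case 0
  have "ucyl UNIV = UNIV" by (auto simp: ucyl_def cylinder_def intro!: exI[of _ "[]"])
  then show ?case by (intro bexI[of _ UNIV]) auto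
next
  case (Suc N)
  then obtain D where "D \<in> OM" "ucyl D = (\<Inter>n<N. ucyl (B n))" by blast
  then show ?case using smeet_OM[OF _ assms, of D N]
    by (intro bexI[of _ "smeet D (B N)"]) (auto simp: ucyl_smeet lessThan_Suc)
qed

lemma approximable_BCyl: "approximable (BCyl s)"
  unfolding approximable_def
proof
  fix k
  let ?B = "{t. length t = length s \<and> t \<noteq> s}"
  have "finite ?B" by (rule finite_subset[OF _ finite_strings_length[of "length s"]]) auto
  then have B: "?B \<in> OM" by (rule finite_OM)
  have "x \<in> ucyl ?B \<longleftrightarrow> x \<notin> cylinder s" for x
  proof
    assume "x \<in> ucyl ?B"
    then show "x \<notin> cylinder s" unfolding ucyl_def using cylinder_same_length by auto
  next
    assume "x \<notin> cylinder s"
    then have "map x [0..<length s] \<in> ?B" using cylinder_restrict[of x "length s"] by auto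
    then show "x \<in> ucyl ?B" unfolding ucyl_def using cylinder_restrict by blast
  qed
  then have uB: "ucyl ?B = - cylinder s" by auto
  have uA: "ucyl {s} = cylinder s" by (simp add: ucyl_def)
  show "\<exists>A\<in>OM. \<exists>B\<in>OM. bM (BCyl s) \<subseteq> ucyl A \<and> XM - bM (BCyl s) \<subseteq> ucyl B \<and>
     mu (ucyl A \<inter> ucyl B) \<le> (1 / 2) ^ k \<and> mu (bV (BCyl s) - ucyl A) = 0 \<and> mu (- bV (BCyl s) - ucyl B) = 0"
    by (intro bexI[of _ "{s}"] bexI[of _ ?B] B finite_OM) (auto simp: uA uB)
qed

lemma pairs_in_M:
  obtains Y where "Y \<in> M" "elts Y = {hpair (hS A) (hS B) | A B. A \<in> OM \<and> B \<in> OM}"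
proof
  let ?P = "hPow (hS UNIV)"
  let ?Y = "hUnion (hset ((\<lambda>a. hset ((\<lambda>b. hpair a b) ` elts ?P)) ` elts ?P))"
  show "?Y \<in> M"
    by (rule dft_closed, intro dfn_intros dft_const strings_in_M)
  show "elts ?Y = {hpair (hS A) (hS B) | A B. A \<in> OM \<and> B \<in> OM}"
  proof -
    have "elts ?Y = (\<Union>a\<in>elts ?P. hpair a ` elts ?P)"
      unfolding elts_hUnion elts_hset[OF countable_image[OF countable_elts]] by simp
    then show ?thesis unfolding elts_hPow_strings by blast
  qed
qed

lemma approximable_BUnion:
  assumes f: "BUnion f \<in> codes_in M" and IH: "\<And>n. approximable (f n)"
  shows "approximable (BUnion f)"
  unfolding approximable_def
proof
  fix k
  define g where "g = hseq (\<lambda>n. hcode (f n))"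
  have gM: "g \<in> M" using f unfolding BUnion_codes g_def .
  \<comment> \<open>Error 2^-(n + k + 2) at stage \<open>n\<close>: these sum to at most 2^-(k + 1),
    and the other half of 2^-k is kept for the tail of the union.\<close>
  define L where "L = hseq (\<lambda>n. hnat (n + (k + 2)))"
  have LM: "L \<in> M" unfolding L_def by (rule shift_seq_in_M)
  \<comment> \<open>Approximations found one by one outside need not form a sequence in
    \<open>M\<close>. Stated definably, the requirement lets \<open>M\<close> choose them all at
    once, so that their union is coded in \<open>M\<close>.\<close>
  define R where "R n y \<longleftrightarrow> (\<forall>z\<in>elts (cval (hX XM) (happ g n)). \<exists>s\<in>elts (hfst y). elts s \<subseteq> elts z) \<and>
    (\<forall>z\<in>elts (hX XM). z \<notin> elts (cval (hX XM) (happ g n)) \<longrightarrow> (\<exists>s\<in>elts (hsnd y). elts s \<subseteq> elts z)) \<and>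
    hsmall (hmeet (hfst y) (hsnd y)) (happ L n)" for n y
  have dR: "dfn (\<lambda>e. R (e 0) (e 1))"
    unfolding R_def by (intro dfn_intros dft_const gM LM reals_in_M)
  have cov: "(\<forall>z\<in>hreal ` Z. \<exists>s\<in>elts (hS A). elts s \<subseteq> elts z) \<longleftrightarrow> Z \<subseteq> ucyl A" for Z A
    by (auto simp: hstring_hreal_iff ucyl_def)
  have R: "R (hnat n) (hpair (hS A) (hS B)) \<longleftrightarrow> bM (f n) \<subseteq> ucyl A \<and> XM - bM (f n) \<subseteq> ucyl B \<and>
      mu (ucyl A \<inter> ucyl B) \<le> (1 / 2) ^ (n + (k + 2))" for n A B
  proof -
    have "(\<forall>z\<in>elts (hX XM). z \<notin> hreal ` bM (f n) \<longrightarrow> (\<exists>s\<in>elts (hS B). elts s \<subseteq> elts z)) \<longleftrightarrow>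
        (\<forall>z\<in>hreal ` (XM - bM (f n)). \<exists>s\<in>elts (hS B). elts s \<subseteq> elts z)" by auto
    then show ?thesis
      unfolding R_def g_def L_def happ_hseq cval_hcode elts_borel_cond hfst_hpair hsnd_hpair cov
        hmeet_hS hsmall_iff ucyl_smeet by (simp only: cov)
  qed
  obtain Y where Y: "Y \<in> M" "elts Y = {hpair (hS A) (hS B) | A B. A \<in> OM \<and> B \<in> OM}" by (rule pairs_in_M)
  have "\<exists>y\<in>elts Y. R (hnat n) y" for n
  proof -
    obtain A B where "A \<in> OM" "B \<in> OM" "bM (f n) \<subseteq> ucyl A" "XM - bM (f n) \<subseteq> ucyl B"
      "mu (ucyl A \<inter> ucyl B) \<le> (1 / 2) ^ (n + (k + 2))"
      using IH[of n] unfolding approximable_def by meson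
    then show ?thesis unfolding Y(2) using R by blast
  qed
  then obtain h where h: "hseq h \<in> M" "\<And>n. h n \<in> elts Y" "\<And>n. R (hnat n) (h n)"
    using choose_seq[OF dR Y(1)] by metis
  have "\<exists>A B. A \<in> OM \<and> B \<in> OM \<and> h n = hpair (hS A) (hS B)" for n using h(2)[of n] unfolding Y(2) by blast
  then obtain A B where AB: "\<And>n. A n \<in> OM" "\<And>n. B n \<in> OM" "\<And>n. h n = hpair (hS (A n)) (hS (B n))" by metis
  have RAB: "bM (f n) \<subseteq> ucyl (A n)" "XM - bM (f n) \<subseteq> ucyl (B n)"
      "mu (ucyl (A n) \<inter> ucyl (B n)) \<le> (1 / 2) ^ (n + (k + 2))" for n
    using h(3)[of n] unfolding AB(3) R by auto
  define A' where "A' = (\<Union>n. A n)"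
  have "hUnion (hset ((\<lambda>n. hfst (happ (hseq h) n)) ` elts homega)) \<in> M"
    by (rule dft_closed, intro dfn_intros dft_const h(1) homega_in_M)
  moreover have "hUnion (hset ((\<lambda>n. hfst (happ (hseq h) n)) ` elts homega)) = hS A'"
    by (rule hc_ext) (auto simp: AB(3) A'_def image_image)
  ultimately have A': "A' \<in> OM" by (simp add: OM_def)
  have uA': "ucyl A' = (\<Union>n. ucyl (A n))" by (auto simp: ucyl_def A'_def)
  define V where "V N = (\<Union>n<N. ucyl (A n))" for N :: nat
  have sV: "V N \<in> sets borel" for N unfolding V_def by auto
  have "incseq V" unfolding V_def incseq_def by force
  then have "(\<lambda>N. mu (V N)) \<longlonglongrightarrow> mu (\<Union>N. V N)"
    by (intro coin.finite_Lim_measure_incseq) (use sV in auto)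
  moreover have "(\<Union>N. V N) = ucyl A'" unfolding V_def uA' by auto
  ultimately have "(\<lambda>N. mu (V N)) \<longlonglongrightarrow> mu (ucyl A')" by simp
  then have "eventually (\<lambda>N. mu (ucyl A') - (1 / 2) ^ (k + 1) < mu (V N)) sequentially"
    by (rule order_tendstoD(1)) simp
  then obtain N where N: "mu (ucyl A') - (1 / 2) ^ (k + 1) < mu (V N)"
    by (auto simp: eventually_sequentially)
  have VA: "V N \<subseteq> ucyl A'" unfolding V_def uA' by auto
  have small: "mu (ucyl A' - V N) \<le> (1 / 2) ^ (k + 1)"
    using N coin.finite_measure_Diff[of "ucyl A'" "V N"] VA sV by simp
  \<comment> \<open>The intersection of all \<open>B n\<close> need not be open. Finitely many
    suffice, because \<open>V N\<close> is nearly all of \<open>ucyl A'\<close>.\<close>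
  obtain D where D: "D \<in> OM" "ucyl D = (\<Inter>n<N. ucyl (B n))" using finite_meet_OM[of B N] AB(2) by blast
  have "mu (\<Union>n<N. ucyl (A n) \<inter> ucyl (B n)) \<le> (\<Sum>n<N. mu (ucyl (A n) \<inter> ucyl (B n)))"
    by (rule coin.finite_measure_subadditive_finite) auto
  also have "\<dots> \<le> (\<Sum>n<N. (1 / 2) ^ (n + (k + 2)))" by (rule sum_mono) (rule RAB(3))
  also have "\<dots> = (1 / 2) ^ (k + 2) * (\<Sum>n<N. (1 / 2 :: real) ^ n)"
    by (simp add: sum_distrib_left power_add mult.commute)
  also have "\<dots> \<le> (1 / 2) ^ (k + 2) * 2"
    by (intro mult_left_mono) (simp_all add: sum_gp_strict)
  finally have "mu (\<Union>n<N. ucyl (A n) \<inter> ucyl (B n)) \<le> (1 / 2) ^ (k + 1)" by simp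
  moreover have "mu (ucyl A' \<inter> ucyl D) \<le> mu ((ucyl A' - V N) \<union> (\<Union>n<N. ucyl (A n) \<inter> ucyl (B n)))"
    by (rule mu_mono) (use sV in \<open>auto simp: V_def D(2)\<close>)
  moreover have "\<dots> \<le> mu (ucyl A' - V N) + mu (\<Union>n<N. ucyl (A n) \<inter> ucyl (B n))"
    by (rule mu_Un_le) (use sV in auto)
  ultimately have meet: "mu (ucyl A' \<inter> ucyl D) \<le> (1 / 2) ^ k" using small by simp
  \<comment> \<open>The chosen pairs are only known to satisfy what \<open>M\<close> can express;
    the null conditions are recovered for them by \<open>approximable_outer\<close>.\<close>
  have "mu (\<Union>n. bV (f n) - ucyl (A n)) = 0"
    by (rule mu_UN_zero) (auto intro!: approximable_outer IH AB(1) RAB(1))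
  moreover have "mu (bV (BUnion f) - ucyl A') \<le> mu (\<Union>n. bV (f n) - ucyl (A n))"
    by (rule mu_mono) (auto simp: uA')
  ultimately have null1: "mu (bV (BUnion f) - ucyl A') = 0"
    using measure_nonneg[of coin "bV (BUnion f) - ucyl A'"] by linarith
  have "mu (\<Union>n. bV (BCompl (f n)) - ucyl (B n)) = 0"
  proof (rule mu_UN_zero)
    show "mu (bV (BCompl (f n)) - ucyl (B n)) = 0" for n
      by (rule approximable_outer[OF approximable_BCompl[OF IH] AB(2)]) (use RAB(2) in simp)
  qed auto
  moreover have "mu (- bV (BUnion f) - ucyl D) \<le> mu (\<Union>n. bV (BCompl (f n)) - ucyl (B n))"
    by (rule mu_mono) (auto simp: D(2))
  ultimately have null2: "mu (- bV (BUnion f) - ucyl D) = 0"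
    using measure_nonneg[of coin "- bV (BUnion f) - ucyl D"] by linarith
  have "bM (BUnion f) \<subseteq> ucyl A'" using RAB(1) unfolding uA' by auto
  moreover have "XM - bM (BUnion f) \<subseteq> ucyl D" using RAB(2) unfolding D(2) by auto
  ultimately show "\<exists>A\<in>OM. \<exists>B\<in>OM. bM (BUnion f) \<subseteq> ucyl A \<and> XM - bM (BUnion f) \<subseteq> ucyl B \<and>
     mu (ucyl A \<inter> ucyl B) \<le> (1 / 2) ^ k \<and> mu (bV (BUnion f) - ucyl A) = 0 \<and> mu (- bV (BUnion f) - ucyl B) = 0"
    using A' D(1) meet null1 null2 by blast
qed

lemma approximable_code: "c \<in> codes_in M \<Longrightarrow> approximable c"
proof (induction c)
  case (BCyl s)
  show ?case by (rule approximable_BCyl)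
next
  case (BCompl c)
  then show ?case using approximable_BCompl BCompl_codes by blast
next
  case (BUnion f)
  then show ?case using approximable_BUnion BUnion_codesD by blast
qed

end

section \<open>Random reals form a conull set\<close>

lemma inj_hcode: "inj hcode"
proof (rule injI)
  fix c d assume "hcode c = hcode d"
  then show "c = d"
  proof (induction c arbitrary: d)
    case (BCyl s)
    then show ?case by (cases d) (simp_all del: hnat.simps)
  next
    case (BCompl c)
    then show ?case by (cases d) (simp_all del: hnat.simps)
  next
    case (BUnion f)
    then show ?case by (cases d) (auto simp: fun_eq_iff simp del: hnat.simps)
  qed
qed

lemma AE_coin_not:
  assumes "S \<in> sets borel" "mu S = 0" shows "AE x in coin. x \<notin> S"
  by (rule AE_not_in) (use assms in \<open>simp add: null_sets_def coin.emeasure_eq_measure\<close>)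

lemma ex_power_less:
  fixes x :: real
  assumes "0 < x" shows "\<exists>k. (1 / 2) ^ k < x"
  using real_arch_pow_inv[OF assms, of "1 / 2"] by auto

lemma mu_UNIV [simp]: "mu UNIV = 1"
  using coin.prob_space by simp

lemma mu_le_1: "mu A \<le> 1" by (rule coin.prob_le_1)

lemma mu_compl: "A \<in> sets borel \<Longrightarrow> mu (- A) = 1 - mu A"
  using coin.prob_compl[of A] by (simp add: Compl_eq_Diff_UNIV)

text \<open>The complements are pairwise almost disjoint and have measure at least \<open>q\<close>,
  so their measures add up.\<close>

lemma disjoint_family_card_bound:
  fixes q :: real
  assumes "finite \<A>" "\<And>A. A \<in> \<A> \<Longrightarrow> mu (ucyl A) \<le> 1 - q"
    "\<And>A B. A \<in> \<A> \<Longrightarrow> B \<in> \<A> \<Longrightarrow> A \<noteq> B \<Longrightarrow> mu (ucyl A \<union> ucyl B) = 1"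
  shows "card \<A> * q \<le> mu (\<Union>A\<in>\<A>. - ucyl A)"
  using assms
proof (induction rule: finite_induct)
  case (insert a \<A>)
  let ?G = "\<Union>A\<in>\<A>. - ucyl A"
  have sG: "?G \<in> sets borel" using insert(1) by (intro sets.finite_UN) auto
  have "mu (- ucyl a \<inter> ?G) \<le> (\<Sum>A\<in>\<A>. mu (- ucyl a \<inter> - ucyl A))"
    unfolding Int_UN_distrib by (rule coin.finite_measure_subadditive_finite) (use insert(1) in auto)
  also have "\<dots> = 0"
  proof (rule sum.neutral, rule ballI)
    fix A assume "A \<in> \<A>"
    then have "mu (ucyl a \<union> ucyl A) = 1" using insert by auto
    then have "mu (- (ucyl a \<union> ucyl A)) = 0" using mu_compl[of "ucyl a \<union> ucyl A"] by simp
    then show "mu (- ucyl a \<inter> - ucyl A) = 0" by simp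
  qed
  finally have null: "mu (- ucyl a \<inter> ?G) = 0" using measure_nonneg[of coin "- ucyl a \<inter> ?G"] by linarith
  have "mu (- ucyl a) + mu (?G - - ucyl a) = mu (- ucyl a \<union> ?G)"
    using coin.finite_measure_Union'[of "- ucyl a" ?G] sG by simp
  moreover have "mu (?G - - ucyl a) = mu ?G - mu (?G \<inter> - ucyl a)"
    by (rule coin.finite_measure_Diff') (use sG in auto)
  moreover have "card \<A> * q \<le> mu ?G" using insert by auto
  moreover have "mu (- ucyl a) \<ge> q" using insert(4)[of a] by (simp add: mu_compl)
  ultimately have "card (insert a \<A>) * q \<le> mu (- ucyl a \<union> ?G)"
    using insert(1,2) null by (simp add: Int_commute distrib_right)
  then show ?case by simp
qed simp

section \<open>Measure as computed in the model, dense sets and genericity\<close>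

context ctm
begin

lemma countable_codes: "countable (codes_in M)"
proof -
  have "countable (hcode ` codes_in M)"
    by (rule countable_subset[OF _ countable_M]) (auto simp: codes_in_def)
  then show ?thesis using inj_hcode by (meson countable_image_inj_on inj_on_subset subset_UNIV)
qed

text \<open>Absoluteness up to null sets: an open hull of the larger set in \<open>M\<close> is a
  hull of the smaller one too, and in V both sets respect it almost everywhere.\<close>

lemma null_diff:
  assumes "c \<in> codes_in M" "d \<in> codes_in M" "bM c \<subseteq> bM d"
  shows "mu (bV c - bV d) = 0"
proof -
  have "mu (bV c - bV d) \<le> (1 / 2) ^ k" for k
  proof -
    obtain A B where AB: "A \<in> OM" "B \<in> OM" "bM d \<subseteq> ucyl A" "mu (ucyl A \<inter> ucyl B) \<le> (1 / 2) ^ k"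
      "mu (- bV d - ucyl B) = 0"
      using approximable_code[OF assms(2)] unfolding approximable_def by meson
    have "mu (bV c - ucyl A) = 0"
      using approximable_outer[OF approximable_code[OF assms(1)] AB(1)] AB(3) assms(3) by blast
    moreover have "mu (bV c - bV d) \<le> mu ((bV c - ucyl A) \<union> ((ucyl A \<inter> ucyl B) \<union> (- bV d - ucyl B)))"
      by (rule mu_mono) auto
    moreover have "\<dots> \<le> mu (bV c - ucyl A) + mu ((ucyl A \<inter> ucyl B) \<union> (- bV d - ucyl B))"
      by (rule mu_Un_le) auto
    moreover have "mu ((ucyl A \<inter> ucyl B) \<union> (- bV d - ucyl B)) \<le> mu (ucyl A \<inter> ucyl B) + mu (- bV d - ucyl B)"
      by (rule mu_Un_le) auto
    ultimately show ?thesis using AB(4,5) by linarith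
  qed
  then show ?thesis using le_zero_if_small measure_nonneg[of coin "bV c - bV d"] by (meson order_antisym)
qed

text \<open>A cover that belongs to \<open>M\<close> is an open set of \<open>M\<close>, so by
  \<open>approximable_outer\<close> it also covers the true set up to a null set.\<close>

lemma lebesgue_in_ge:
  assumes "c \<in> codes_in M"
  shows "ennreal (mu (bV c)) \<le> lebesgue_in M (bM c)"
  unfolding lebesgue_in_def
proof (rule Inf_greatest, safe)
  fix s :: "nat \<Rightarrow> bool list"
  assume s: "hseq (\<lambda>n. hstring (s n)) \<in> M" "bM c \<subseteq> (\<Union>n. cylinder (s n))"
  have "hset (range (\<lambda>n. hstring (s n))) \<in> M" using s(1) by (rule range_in_M)
  moreover have "hset (range (\<lambda>n. hstring (s n))) = hS (range s)" by (simp add: hS_def image_image)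
  ultimately have W: "range s \<in> OM" by (simp add: OM_def)
  have u: "ucyl (range s) = (\<Union>n. cylinder (s n))" by (simp add: ucyl_def)
  have "mu (bV c - ucyl (range s)) = 0"
    by (rule approximable_outer[OF approximable_code[OF assms] W]) (use s(2) u in simp)
  moreover have "mu (bV c) \<le> mu ((bV c - ucyl (range s)) \<union> ucyl (range s))" by (rule mu_mono) auto
  moreover have "\<dots> \<le> mu (bV c - ucyl (range s)) + mu (ucyl (range s))" by (rule mu_Un_le) auto
  ultimately have "ennreal (mu (bV c)) \<le> emeasure coin (\<Union>n. cylinder (s n))"
    unfolding u coin.emeasure_eq_measure by (intro ennreal_leI) linarith
  also have "\<dots> \<le> (\<Sum>n. emeasure coin (cylinder (s n)))"
    by (rule emeasure_subadditive_countably) auto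
  also have "\<dots> = (\<Sum>n. ennreal ((1 / 2) ^ length (s n)))"
    by (simp add: coin.emeasure_eq_measure)
  finally show "ennreal (mu (bV c)) \<le> (\<Sum>n. ennreal ((1 / 2) ^ length (s n)))" .
qed

text \<open>For each \<open>k\<close> an open code of measure at most 2^-k is turned into a covering
  sequence in \<open>M\<close> whose lengths of strings add up to at most 2 * 2^-k. Overlaps and
  repetitions must be removed, since the outer measure sums over the whole sequence.\<close>

lemma lebesgue_in_zero:
  assumes c: "c \<in> codes_in M" and null: "mu (bV c) = 0"
  shows "lebesgue_in M (bM c) = 0"
proof -
  have bound: "lebesgue_in M (bM c) \<le> ennreal (2 * (1 / 2) ^ k)" for k
  proof -
    obtain A B where AB: "A \<in> OM" "B \<in> OM" "bM c \<subseteq> ucyl A" "mu (ucyl A \<inter> ucyl B) \<le> (1 / 2) ^ k"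
      "mu (- bV c - ucyl B) = 0"
      using approximable_code[OF c] unfolding approximable_def by meson
    have "mu (ucyl A) \<le> mu ((ucyl A \<inter> ucyl B) \<union> (bV c \<union> (- bV c - ucyl B)))" by (rule mu_mono) auto
    also have "\<dots> \<le> mu (ucyl A \<inter> ucyl B) + mu (bV c \<union> (- bV c - ucyl B))" by (rule mu_Un_le) auto
    also have "mu (bV c \<union> (- bV c - ucyl B)) \<le> mu (bV c) + mu (- bV c - ucyl B)" by (rule mu_Un_le) auto
    finally have muA: "mu (ucyl A) \<le> (1 / 2) ^ k" using AB(4,5) null by linarith
    \<comment> \<open>Minimal strings generate the same open set, and their cylinders are
      disjoint.\<close>
    define A' where "A' = {s \<in> A. \<forall>t\<in>A. pre t s \<longrightarrow> t = s}"
    have A': "A' \<in> OM"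
      by (rule OM_I[where P = "\<lambda>s. s \<in> elts (hS A) \<and> (\<forall>t\<in>elts (hS A). elts t \<subseteq> elts s \<longrightarrow> t = s)"])
        (intro dfn_intros dft_const OM_D AB(1), auto simp: A'_def pre_hstring)
    \<comment> \<open>As \<open>hf_enum\<close> repeats, only first occurrences count, so that each
      string contributes once.\<close>
    define first where "first n \<longleftrightarrow> hf_enum n \<in> hstring ` A' \<and> (\<forall>m<n. hf_enum m \<noteq> hf_enum n)" for n
    \<comment> \<open>The idle places are filled with cylinders whose measures sum to at most
      2^-k.\<close>
    define s where "s n = (if first n then inv hstring (hf_enum n) else replicate (n + (k + 1)) False)" for n
    define L where "L = hseq (\<lambda>n. hnat (n + (k + 1)))"
    have LM: "L \<in> M" unfolding L_def by (rule shift_seq_in_M)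
    have "hseq (\<lambda>n. hstring (s n)) \<in> M"
    proof (rule hseqI)
      show "dft (\<lambda>e. if happ (hseq hf_enum) (e 0) \<in> elts (hS A') \<and>
          (\<forall>m\<in>elts (e 0). happ (hseq hf_enum) m \<noteq> happ (hseq hf_enum) (e 0))
        then happ (hseq hf_enum) (e 0) else hzeros (happ L (e 0)))"
        by (intro dfn_intros dft_const hf_enum_in_M OM_D A' LM)
      fix n
      have "(\<forall>m\<in>elts (hnat n). happ (hseq hf_enum) m \<noteq> happ (hseq hf_enum) (hnat n)) \<longleftrightarrow> (\<forall>m<n. hf_enum m \<noteq> hf_enum n)"
        by (auto simp: elts_hnat)
      then show "hstring (s n) = (if happ (hseq hf_enum) (hnat n) \<in> elts (hS A') \<and>
          (\<forall>m\<in>elts (hnat n). happ (hseq hf_enum) m \<noteq> happ (hseq hf_enum) (hnat n))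
        then happ (hseq hf_enum) (hnat n) else hzeros (happ L (hnat n)))"
        unfolding s_def L_def happ_hseq elts_hS first_def[symmetric] hzeros_hnat
        by (auto simp: first_def)
    qed
    moreover have "bM c \<subseteq> (\<Union>n. cylinder (s n))"
    proof
      fix x assume "x \<in> bM c"
      then have "\<exists>t. t \<in> A \<and> x \<in> cylinder t" using AB(3) unfolding ucyl_def by blast
      then obtain t where t: "t \<in> A" "x \<in> cylinder t" "\<And>t'. t' \<in> A \<Longrightarrow> x \<in> cylinder t' \<Longrightarrow> length t \<le> length t'"
        using ex_has_least_nat[of "\<lambda>t. t \<in> A \<and> x \<in> cylinder t" _ length] by blast
      have "t \<in> A'" unfolding A'_def
      proof (intro CollectI conjI ballI impI)
        fix t' assume t': "t' \<in> A" "pre t' t"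
        then have "x \<in> cylinder t'" using pre_cylinder t(2) by blast
        moreover have "length t' \<le> length t" using t'(2) unfolding pre_def by (meson not_le order_less_irrefl)
        ultimately show "t' = t" using t(2) t(3)[OF t'(1)] cylinder_same_length by fastforce
      qed (rule t(1))
      define n where "n = (LEAST n. hf_enum n = hstring t)"
      obtain m where m: "hf_enum m = hstring t" using hf_hstring[of t] by (auto simp: image_iff)
      have n: "hf_enum n = hstring t" unfolding n_def using m by (rule LeastI)
      have "first n" unfolding first_def
        using \<open>t \<in> A'\<close> n not_less_Least[where P = "\<lambda>n. hf_enum n = hstring t"] unfolding n_def[symmetric] by auto
      then have "s n = t" by (simp add: s_def n)
      then show "x \<in> (\<Union>n. cylinder (s n))" using t(2) by blast
    qed
    ultimately have "lebesgue_in M (bM c) \<le> (\<Sum>n. ennreal ((1 / 2) ^ length (s n)))"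
      unfolding lebesgue_in_def by (intro Inf_lower) blast
    also have "\<dots> \<le> (\<Sum>n. emeasure coin (if first n then cylinder (s n) else {}) + ennreal ((1 / 2) ^ (n + (k + 1))))"
    proof (rule suminf_le)
      show "ennreal ((1 / 2) ^ length (s n)) \<le>
        emeasure coin (if first n then cylinder (s n) else {}) + ennreal ((1 / 2) ^ (n + (k + 1)))" for n
        by (cases "first n") (simp_all add: s_def coin.emeasure_eq_measure)
    qed auto
    also have "\<dots> = (\<Sum>n. emeasure coin (if first n then cylinder (s n) else {})) + (\<Sum>n. ennreal ((1 / 2) ^ (n + (k + 1))))"
      by (rule suminf_add[symmetric]) auto
    finally have e1: "lebesgue_in M (bM c) \<le> (\<Sum>n. emeasure coin (if first n then cylinder (s n) else {})) +
      (\<Sum>n. ennreal ((1 / 2) ^ (n + (k + 1))))" .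
    have "(\<Sum>n. emeasure coin (if first n then cylinder (s n) else {})) =
        emeasure coin (\<Union>n. if first n then cylinder (s n) else {})"
    proof (rule suminf_emeasure)
      show "disjoint_family (\<lambda>n. if first n then cylinder (s n) else {})"
        unfolding disjoint_family_on_def
      proof (intro ballI impI)
        fix m n :: nat assume mn: "m \<noteq> n"
        have "cylinder (s m) \<inter> cylinder (s n) = {}" if f: "first m" "first n"
        proof (rule ccontr)
          assume "cylinder (s m) \<inter> cylinder (s n) \<noteq> {}"
          then obtain x where x: "x \<in> cylinder (s m)" "x \<in> cylinder (s n)" by blast
          have h: "hf_enum m = hstring (s m)" "hf_enum n = hstring (s n)" "s m \<in> A'" "s n \<in> A'"
            using f unfolding s_def first_def by auto
          have "pre (s m) (s n) \<or> pre (s n) (s m)"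
            using x unfolding pre_def cylinder_def by (cases "length (s m) \<le> length (s n)") auto
          then have "s m = s n" using h(3,4) unfolding A'_def by auto
          then have "hf_enum m = hf_enum n" using h by simp
          then show False using f mn unfolding first_def by (metis linorder_neqE_nat)
        qed
        then show "(if first m then cylinder (s m) else {}) \<inter> (if first n then cylinder (s n) else {}) = {}" by simp
      qed
    qed auto
    also have "emeasure coin (\<Union>n. if first n then cylinder (s n) else {}) \<le> emeasure coin (ucyl A)"
    proof (rule emeasure_mono)
      have "s n \<in> A" if "first n" for n using that unfolding s_def first_def A'_def by auto
      then show "(\<Union>n. if first n then cylinder (s n) else {}) \<subseteq> ucyl A" unfolding ucyl_def by (auto split: if_splits)
    qed simp
    also have "emeasure coin (ucyl A) \<le> ennreal ((1 / 2) ^ k)"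
      unfolding coin.emeasure_eq_measure using muA by (rule ennreal_leI)
    finally have e2: "(\<Sum>n. emeasure coin (if first n then cylinder (s n) else {})) \<le> ennreal ((1 / 2) ^ k)" .
    have e3: "(\<Sum>n. ennreal ((1 / 2) ^ (n + (k + 1)))) = ennreal ((1 / 2) ^ k)"
    proof -
      have "(\<lambda>n. (1 / 2 :: real) ^ n * (1 / 2) ^ (k + 1)) sums (2 * (1 / 2) ^ (k + 1))"
        using sums_mult2[OF geometric_sums[of "1 / 2 :: real"], of "(1 / 2) ^ (k + 1)"] by simp
      then have "(\<lambda>n. (1 / 2 :: real) ^ (n + (k + 1))) sums ((1 / 2) ^ k)" by (simp add: power_add)
      then show ?thesis by (intro suminf_ennreal_eq) simp_all
    qed
    have "lebesgue_in M (bM c) \<le> ennreal ((1 / 2) ^ k) + ennreal ((1 / 2) ^ k)"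
      using order_trans[OF e1 add_right_mono[OF e2]] unfolding e3 .
    also have "\<dots> = ennreal ((1 / 2) ^ k + (1 / 2) ^ k)" by (rule ennreal_plus[symmetric]) simp_all
    finally show ?thesis by (simp only: mult_2)
  qed
  have "(\<lambda>k. ennreal (2 * (1 / 2) ^ k)) \<longlonglongrightarrow> ennreal (2 * 0)"
    by (intro tendsto_ennrealI tendsto_mult_left LIMSEQ_realpow_zero) auto
  then have "lebesgue_in M (bM c) \<le> ennreal (2 * 0)"
    by (rule LIMSEQ_le_const) (use bound in auto)
  then show ?thesis by simp
qed

definition pos_codes :: "borel_code set" where "pos_codes = {c \<in> codes_in M. mu (bV c) > 0}"

text \<open>From here on \<open>mu\<close> alone decides which coded sets are conditions.\<close>

lemma lebesgue_in_pos_iff: "c \<in> codes_in M \<Longrightarrow> lebesgue_in M (bM c) > 0 \<longleftrightarrow> mu (bV c) > 0"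
  using lebesgue_in_ge[of c] lebesgue_in_zero[of c] measure_nonneg[of coin "bV c"]
  by (metis ennreal_less_zero_iff less_le_trans order_le_less zero_less_iff_neq_zero)

lemma random_forcing_eq: "random_forcing M = borel_cond M ` pos_codes"
  unfolding random_forcing_def pos_codes_def using lebesgue_in_pos_iff by auto

lemma random_filter_eq: "random_filter M x = borel_cond M ` {c \<in> pos_codes. x \<in> bV c}"
proof -
  have "c \<in> pos_codes" if c: "c \<in> codes_in M" "borel_cond M c \<in> random_forcing M" for c
  proof -
    obtain d where "d \<in> codes_in M" "lebesgue_in M (bM d) > 0" "borel_cond M c = borel_cond M d"
      using c(2) unfolding random_forcing_def by blast
    then have "lebesgue_in M (bM c) > 0" using borel_cond_eq_iff by simp
    then show ?thesis using c(1) lebesgue_in_pos_iff unfolding pos_codes_def by blast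
  qed
  moreover have "borel_cond M c \<in> random_forcing M" if "c \<in> pos_codes" for c
    using that unfolding random_forcing_eq by blast
  moreover have "pos_codes \<subseteq> codes_in M" unfolding pos_codes_def by blast
  ultimately show ?thesis unfolding random_filter_def by blast
qed

lemma incl_le_iff: "incl_le (borel_cond M c) (borel_cond M d) \<longleftrightarrow> bM c \<subseteq> bM d"
  unfolding incl_le_def elts_borel_cond by (rule inj_image_subset_iff) (simp add: inj_def)

text \<open>Brings a finite family that was selected outside into \<open>M\<close>, as an infinite
  sequence with padding.\<close>

lemma hseq_eventually_const:
  assumes "\<And>n. n < N \<Longrightarrow> h n \<in> M" "c \<in> M"
  shows "hseq (\<lambda>n. if n < N then h n else c) \<in> M"
proof -
  let ?F = "hset ((\<lambda>n. hpair (hnat n) (h n)) ` {..<N})"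
  have F: "?F \<in> M" by (rule finite_in_M) (use assms(1) in \<open>auto simp del: hnat.simps intro: hpair_in_M\<close>)
  have "hUn ?F (hset ((\<lambda>n. hpair n c) ` elts (hset {n \<in> elts homega. n \<notin> elts (hnat N)}))) \<in> M"
    by (rule dft_closed, intro dfn_intros dft_const F homega_in_M hnat_in_M assms(2))
  moreover have "hUn ?F (hset ((\<lambda>n. hpair n c) ` elts (hset {n \<in> elts homega. n \<notin> elts (hnat N)}))) =
      hseq (\<lambda>n. if n < N then h n else c)"
  proof (rule hc_ext)
    have "elts (hset {n \<in> elts homega. n \<notin> elts (hnat N)}) = hnat ` {N..}"
      unfolding elts_hset[OF countable_sep] by (auto simp: not_less)
    then show "elts (hUn ?F (hset ((\<lambda>n. hpair n c) ` elts (hset {n \<in> elts homega. n \<notin> elts (hnat N)})))) =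
      elts (hseq (\<lambda>n. if n < N then h n else c))"
      by (auto simp: elts_hseq image_image image_iff not_less)
  qed
  ultimately show ?thesis by simp
qed

text \<open>For each \<open>k\<close> the model chooses a finite family of closed sets below \<open>D\<close> meeting every closed
  set below \<open>D\<close> of measure at least \<open>2^-k\<close>; their union is conull, since otherwise density would
  provide a condition inside its complement.\<close>

lemma dense_AE:
  assumes DM: "D \<in> M" and dense: "dense_in (random_forcing M) incl_le (elts D)"
  shows "AE x in coin. random_filter M x \<inter> elts D \<noteq> {}"
proof -
  \<comment> \<open>Closed sets are handled through codes of their complements, so that families of
    closed subsets of conditions in \<open>D\<close> become families of sets of strings.\<close>
  define good where "good A \<longleftrightarrow> (\<exists>d\<in>elts D. hreal ` (XM - ucyl A) \<subseteq> elts d)" for A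
  define hgood where "hgood a \<longleftrightarrow> (\<exists>d\<in>elts D. \<forall>z\<in>elts (hX XM). (\<exists>s\<in>elts a. elts s \<subseteq> elts z) \<or> z \<in> elts d)" for a
  have hgood: "hgood (hS A) \<longleftrightarrow> good A" for A
    unfolding hgood_def good_def by (simp add: hstring_hreal_iff ucyl_def image_subset_iff) blast
  have dhgood: "dfn (\<lambda>e. hgood (e 0))"
    unfolding hgood_def by (intro dfn_intros dft_const DM reals_in_M)
  define P where "P = hPow (hS UNIV)"
  have PM: "P \<in> M" unfolding P_def by (rule hPow_in_M) simp
  have eP: "elts P = hS ` OM" unfolding P_def by (rule elts_hPow_strings)
  \<comment> \<open>The sequence \<open>y\<close> consists of closed sets below \<open>D\<close>,
    and each closed set below \<open>D\<close> of measure at least 2^-k meets one of them in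
    positive measure.\<close>
  define R where "R k y \<longleftrightarrow> (\<forall>n\<in>elts homega. happ y n \<in> elts P \<and> hgood (happ y n)) \<and>
    (\<forall>a\<in>elts P. hgood a \<and> hcosmall a k \<longrightarrow> (\<exists>n\<in>elts homega. \<exists>j\<in>elts homega. hcosmall (hUn a (happ y n)) j))" for k y
  have dR: "dfn (\<lambda>e. R (e 0) (e 1))"
    unfolding R_def by (intro dfn_intros dfn_subst1[OF dhgood] dft_const PM homega_in_M)
  \<comment> \<open>Choice in \<open>M\<close> needs a set to choose from: sequences in
    \<open>P\<close> are subsets of the product of \<omega> and \<open>P\<close>.\<close>
  define Y where "Y = hPow (hUnion (hset ((\<lambda>n. hset ((\<lambda>a. hpair n a) ` elts P)) ` elts homega)))"
  have YM: "Y \<in> M" unfolding Y_def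
    by (rule dft_closed, intro dfn_intros dft_const PM homega_in_M)
  have hUn_hS: "hUn (hS A) (hS B) = hS (A \<union> B)" for A B by (rule hc_ext) auto
  have less1: "(\<exists>j. mu (ucyl A) \<le> 1 - (1 / 2) ^ j) \<longleftrightarrow> mu (ucyl A) < 1" for A
  proof
    assume "\<exists>j. mu (ucyl A) \<le> 1 - (1 / 2) ^ j"
    then obtain j where "mu (ucyl A) \<le> 1 - (1 / 2) ^ j" ..
    moreover have "(0 :: real) < (1 / 2) ^ j" by simp
    ultimately show "mu (ucyl A) < 1" by linarith
  next
    assume "mu (ucyl A) < 1"
    then obtain j where "(1 / 2) ^ j < 1 - mu (ucyl A)" using ex_power_less[of "1 - mu (ucyl A)"] by auto
    then show "\<exists>j. mu (ucyl A) \<le> 1 - (1 / 2) ^ j" by (intro exI[of _ j]) linarith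
  qed
  have posD: "\<exists>c\<in>pos_codes. d = borel_cond M c" if "d \<in> elts D" for d
    using dense that unfolding dense_in_def random_forcing_eq by blast
  have "BCyl [] \<in> pos_codes" unfolding pos_codes_def by (simp add: cylinder_def)
  then have "elts D \<noteq> {}" using dense unfolding dense_in_def random_forcing_eq by blast
  moreover have "ucyl UNIV = UNIV" by (auto simp: ucyl_def cylinder_def intro!: exI[of _ "[]"])
  ultimately have goodU: "good UNIV" unfolding good_def by auto
  have "\<exists>y\<in>elts Y. R (hnat k) y" for k
  proof -
    \<comment> \<open>Pairwise almost disjoint sets of measure at least 2^-k number at most 2^k, so
      a largest such family exists; it is found outside, and being finite it is available in
      \<open>M\<close>.\<close>
    define F where "F \<A> \<longleftrightarrow> finite \<A> \<and> \<A> \<subseteq> {A \<in> OM. good A \<and> mu (ucyl A) \<le> 1 - (1 / 2) ^ k} \<and>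
      (\<forall>A\<in>\<A>. \<forall>B\<in>\<A>. A \<noteq> B \<longrightarrow> mu (ucyl A \<union> ucyl B) = 1)" for \<A>
    have "card \<A> < 2 ^ k + 1" if "F \<A>" for \<A>
    proof -
      have "card \<A> * (1 / 2) ^ k \<le> mu (\<Union>A\<in>\<A>. - ucyl A)"
        by (rule disjoint_family_card_bound) (use that in \<open>auto simp: F_def\<close>)
      then have "card \<A> * (1 / 2) ^ k \<le> 1" using mu_le_1[of "\<Union>A\<in>\<A>. - ucyl A"] by linarith
      then have "real (card \<A>) \<le> real (2 ^ k)" by (simp add: field_simps power_divide)
      then have "card \<A> \<le> 2 ^ k" by (simp only: of_nat_le_iff)
      then show ?thesis by linarith
    qed
    moreover have "F {}" by (simp add: F_def)
    ultimately obtain \<A> where A: "F \<A>" "\<And>\<B>. F \<B> \<Longrightarrow> card \<B> \<le> card \<A>"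
      using ex_has_greatest_nat[of F "{}" card "2 ^ k + 1"] by metis
    have fin: "finite \<A>" using A(1) unfolding F_def by blast
    then obtain xs where xs: "set xs = \<A>" using finite_list by blast
    \<comment> \<open>Padding with \<open>UNIV\<close>, the code of the empty closed set, which is
      good.\<close>
    define a where "a n = (if n < length xs then xs ! n else UNIV)" for n
    have aOM: "a n \<in> OM \<and> good (a n)" for n
      using A(1) nth_mem[of n xs] goodU unfolding a_def F_def xs by (auto simp: subset_iff)
    have "hseq (\<lambda>n. if n < length xs then hS (xs ! n) else hS UNIV) \<in> M"
      by (rule hseq_eventually_const) (use A(1) nth_mem[of _ xs] xs in \<open>auto simp: F_def OM_def\<close>)
    also have "(\<lambda>n. if n < length xs then hS (xs ! n) else hS UNIV) = (\<lambda>n. hS (a n))"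
      by (auto simp: a_def)
    finally have yM: "hseq (\<lambda>n. hS (a n)) \<in> M" .
    have "elts (hseq (\<lambda>n. hS (a n))) \<subseteq> elts (hUnion (hset ((\<lambda>n. hset ((\<lambda>a. hpair n a) ` elts P)) ` elts homega)))"
    proof
      fix p assume "p \<in> elts (hseq (\<lambda>n. hS (a n)))"
      then obtain n where p: "p = hpair (hnat n) (hS (a n))" unfolding elts_hseq by blast
      have "hS (a n) \<in> elts P" using aOM unfolding eP by blast
      then show "p \<in> elts (hUnion (hset ((\<lambda>n. hset ((\<lambda>a. hpair n a) ` elts P)) ` elts homega)))" by (auto simp: p)
    qed
    then have "hseq (\<lambda>n. hS (a n)) \<in> elts Y" using yM unfolding Y_def by simp
    moreover have "R (hnat k) (hseq (\<lambda>n. hS (a n)))"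
    proof -
      have "\<exists>n j. mu (ucyl (B \<union> a n)) \<le> 1 - (1 / 2) ^ j"
        if B: "B \<in> OM" "good B" "mu (ucyl B) \<le> 1 - (1 / 2) ^ k" for B
      proof -
        \<comment> \<open>By maximality: a good set almost disjoint from all members could be added
          to the family.\<close>
        have "\<exists>C\<in>\<A>. mu (ucyl (B \<union> C)) < 1"
        proof (cases "B \<in> \<A>")
          case True
          then show ?thesis using less1[of B] B(3) by (intro bexI[of _ B]) auto
        next
          case False
          show ?thesis
          proof (rule ccontr)
            assume "\<not> ?thesis"
            then have "mu (ucyl B \<union> ucyl C) = 1" if "C \<in> \<A>" for C
              using that mu_le_1[of "ucyl (B \<union> C)"] unfolding ucyl_Un by (meson not_less order_antisym)
            then have "F (insert B \<A>)" using A(1) B unfolding F_def by (auto simp: Un_commute)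
            then show False using A(2)[of "insert B \<A>"] False fin by simp
          qed
        qed
        then obtain C where "C \<in> \<A>" "mu (ucyl (B \<union> C)) < 1" by blast
        moreover from this obtain n where "a n = C" unfolding xs[symmetric] a_def by (metis in_set_conv_nth)
        ultimately show ?thesis using less1[of "B \<union> C"] by metis
      qed
      then show ?thesis
        unfolding R_def eP using aOM by (simp add: hgood hcosmall_iff hUn_hS del: hnat.simps)
    qed
    ultimately show ?thesis by blast
  qed
  then obtain y where y: "hseq y \<in> M" "\<And>k. R (hnat k) (y k)"
    using choose_seq[OF dR YM] by metis
  have "\<exists>A. A \<in> OM \<and> good A \<and> happ (y k) (hnat n) = hS A" for k n
  proof -
    have "happ (y k) (hnat n) \<in> elts P" "hgood (happ (y k) (hnat n))"
      using y(2)[of k] unfolding R_def by simp_all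
    then show ?thesis using hgood unfolding eP by force
  qed
  then obtain A where A: "\<And>k n. A k n \<in> OM" "\<And>k n. good (A k n)" "\<And>k n. happ (y k) (hnat n) = hS (A k n)"
    by metis
  define u where "u = BUnion (\<lambda>k. BUnion (\<lambda>n. BCompl (ocode (A k n))))"
  have "hseq (\<lambda>k. hcode (BUnion (\<lambda>n. BCompl (ocode (A k n))))) \<in> M"
  proof (rule hseqI)
    show "dft (\<lambda>e. hpair (hnat 2) (hset ((\<lambda>n. hpair n (hpair (hnat 1) (hocode (happ (happ (hseq y) (e 0)) n)))) ` elts homega)))"
      by (intro dfn_intros dft_const hnat_in_M homega_in_M y(1))
    fix k
    have "hset ((\<lambda>n. hpair n (t n)) ` elts homega) = hseq (\<lambda>n. t (hnat n))" for t
      by (rule hc_ext) (simp add: elts_hseq image_image)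
    then show "hcode (BUnion (\<lambda>n. BCompl (ocode (A k n)))) =
      hpair (hnat 2) (hset ((\<lambda>n. hpair n (hpair (hnat 1) (hocode (happ (happ (hseq y) (hnat k)) n)))) ` elts homega))"
      by (simp add: A(3) hocode_hS del: hnat.simps)
  qed
  then have u: "u \<in> codes_in M" unfolding u_def BUnion_codes .
  have bV_u: "bV u = (\<Union>k n. - ucyl (A k n))" and bM_u: "bM u = (\<Union>k n. XM - ucyl (A k n))"
    unfolding u_def by auto
  have "mu (- bV u) = 0"
  proof (rule ccontr)
    assume "mu (- bV u) \<noteq> 0"
    then have "BCompl u \<in> pos_codes" using u measure_nonneg[of coin "- bV u"]
      by (simp add: pos_codes_def BCompl_codes Compl_eq_Diff_UNIV zero_less_measure_iff)
    \<comment> \<open>Density gives a condition of \<open>D\<close> inside the complement of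
      \<open>u\<close>. A closed subset of it of positive measure has to meet a chosen closed set in
      positive measure, although in \<open>M\<close> it is disjoint from all of them.\<close>
    then obtain d where d: "d \<in> elts D" "incl_le d (borel_cond M (BCompl u))"
      using dense unfolding dense_in_def random_forcing_eq by blast
    then obtain c where c: "c \<in> pos_codes" "d = borel_cond M c" using posD by blast
    have sub: "bM c \<subseteq> bM (BCompl u)" using d(2) unfolding c(2) incl_le_iff .
    have cc: "c \<in> codes_in M" "mu (bV c) > 0" using c(1) unfolding pos_codes_def by auto
    obtain k where k: "(1 / 2) ^ k < mu (bV c)" using ex_power_less[OF cc(2)] by blast
    obtain A' B where AB: "A' \<in> OM" "B \<in> OM" "XM - bM c \<subseteq> ucyl B" "mu (ucyl A' \<inter> ucyl B) \<le> (1 / 2) ^ k"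
      "mu (bV c - ucyl A') = 0"
      using approximable_code[OF cc(1)] unfolding approximable_def by meson
    have "mu (bV c) \<le> mu (- ucyl B \<union> ((ucyl A' \<inter> ucyl B) \<union> (bV c - ucyl A')))" by (rule mu_mono) auto
    also have "\<dots> \<le> mu (- ucyl B) + mu ((ucyl A' \<inter> ucyl B) \<union> (bV c - ucyl A'))" by (rule mu_Un_le) auto
    also have "mu ((ucyl A' \<inter> ucyl B) \<union> (bV c - ucyl A')) \<le> mu (ucyl A' \<inter> ucyl B) + mu (bV c - ucyl A')"
      by (rule mu_Un_le) auto
    finally have "mu (ucyl B) < 1" using AB(4,5) k by (simp add: mu_compl)
    then obtain j where j: "mu (ucyl B) \<le> 1 - (1 / 2) ^ j" using less1 by blast
    have "good B" unfolding good_def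
      by (rule bexI[OF _ d(1)]) (use AB(3) in \<open>auto simp: c(2) elts_borel_cond\<close>)
    moreover have "\<forall>a\<in>elts P. hgood a \<and> hcosmall a (hnat j) \<longrightarrow>
        (\<exists>n\<in>elts homega. \<exists>i\<in>elts homega. hcosmall (hUn a (happ (y j) n)) i)"
      using y(2)[of j] unfolding R_def by (rule conjunct2)
    ultimately obtain n i where "hcosmall (hUn (hS B) (happ (y j) (hnat n))) (hnat i)"
      using AB(2) j unfolding eP hgood hcosmall_iff by (auto simp: hgood hcosmall_iff simp del: hnat.simps)
    then have "mu (ucyl (B \<union> A j n)) < 1" using less1 unfolding A(3) hUn_hS hcosmall_iff by blast
    \<comment> \<open>Two closed sets that are disjoint in \<open>M\<close> are disjoint in V, by
      compactness.\<close>
    moreover have "XM \<subseteq> ucyl (B \<union> A j n)" using AB(3) sub bM_u by (auto simp: ucyl_Un)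
    then have "ucyl (B \<union> A j n) = UNIV" using compact_OM Un_OM AB(2) A(1) by blast
    ultimately show False by simp
  qed
  then have ae1: "AE x in coin. x \<in> bV u" using AE_coin_not[of "- bV u"] by simp
  have "\<exists>c. c \<in> pos_codes \<and> borel_cond M c \<in> elts D \<and> XM - ucyl (A k n) \<subseteq> bM c" for k n
  proof -
    obtain d where d: "d \<in> elts D" "hreal ` (XM - ucyl (A k n)) \<subseteq> elts d" using A(2)[of k n] unfolding good_def by blast
    then obtain c where c: "c \<in> pos_codes" "d = borel_cond M c" using posD by blast
    have "hreal ` (XM - ucyl (A k n)) \<subseteq> hreal ` bM c" using d(2) unfolding c(2) elts_borel_cond .
    then have "XM - ucyl (A k n) \<subseteq> bM c" by (subst (asm) inj_image_subset_iff) (simp_all add: inj_def)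
    then show ?thesis using c d(1) by blast
  qed
  then obtain c where c: "\<And>k n. c k n \<in> pos_codes" "\<And>k n. borel_cond M (c k n) \<in> elts D"
    "\<And>k n. XM - ucyl (A k n) \<subseteq> bM (c k n)" by metis
  have ae2: "AE x in coin. \<forall>k n. x \<notin> ucyl (A k n) \<longrightarrow> x \<in> bV (c k n)"
  proof (subst AE_all_countable, intro allI, subst AE_all_countable, intro allI)
    fix k n
    have "mu (bV (BCompl (ocode (A k n))) - bV (c k n)) = 0"
    proof (rule null_diff)
      show "BCompl (ocode (A k n)) \<in> codes_in M" using A(1) ocode_codes BCompl_codes by blast
      show "c k n \<in> codes_in M" using c(1) unfolding pos_codes_def by blast
      show "bM (BCompl (ocode (A k n))) \<subseteq> bM (c k n)" using c(3)[of k n] by auto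
    qed
    then have "AE x in coin. x \<notin> bV (BCompl (ocode (A k n))) - bV (c k n)" by (intro AE_coin_not) auto
    then show "AE x in coin. x \<notin> ucyl (A k n) \<longrightarrow> x \<in> bV (c k n)" by eventually_elim auto
  qed
  show ?thesis using ae1 ae2
  proof eventually_elim
    case (elim x)
    then obtain k n where "x \<notin> ucyl (A k n)" unfolding bV_u by auto
    then have "x \<in> bV (c k n)" using elim(2) by blast
    then have "borel_cond M (c k n) \<in> random_filter M x" using c(1) unfolding random_filter_eq by blast
    then show ?case using c(2) by blast
  qed
qed

text \<open>As \<open>M\<close> is countable, countably many conull sets can be intersected: dense
  sets are met, coded null sets are avoided, and inclusions in \<open>M\<close> persist. The last
  gives upward closure; avoiding null sets gives, with \<open>bint\<close>, common lower
  bounds.\<close>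

lemma AE_random: "AE x in coin. x \<in> random_reals M"
proof -
  have cM: "countable {D \<in> M. dense_in (random_forcing M) incl_le (elts D)}"
    by simp
  have "AE x in coin. \<forall>D\<in>{D \<in> M. dense_in (random_forcing M) incl_le (elts D)}. random_filter M x \<inter> elts D \<noteq> {}"
    unfolding AE_ball_countable[OF cM] using dense_AE by blast
  moreover have "AE x in coin. \<forall>c\<in>codes_in M. mu (bV c) = 0 \<longrightarrow> x \<notin> bV c"
    unfolding AE_ball_countable[OF countable_codes]
  proof
    fix c
    show "AE x in coin. mu (bV c) = 0 \<longrightarrow> x \<notin> bV c"
      using AE_coin_not[of "bV c"] by (cases "mu (bV c) = 0") auto
  qed
  moreover have "AE x in coin. \<forall>c\<in>codes_in M. \<forall>d\<in>codes_in M. bM c \<subseteq> bM d \<longrightarrow> x \<in> bV c \<longrightarrow> x \<in> bV d"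
    unfolding AE_ball_countable[OF countable_codes]
  proof (intro ballI)
    fix c d assume cd: "c \<in> codes_in M" "d \<in> codes_in M"
    show "AE x in coin. bM c \<subseteq> bM d \<longrightarrow> x \<in> bV c \<longrightarrow> x \<in> bV d"
    proof (cases "bM c \<subseteq> bM d")
      case True
      then have "AE x in coin. x \<notin> bV c - bV d" using null_diff[OF cd] by (intro AE_coin_not) auto
      then show ?thesis by eventually_elim auto
    qed simp
  qed
  ultimately show ?thesis
  proof eventually_elim
    case (elim x)
    have pos: "c \<in> pos_codes" if "c \<in> codes_in M" "x \<in> bV c" for c
    proof -
      have "mu (bV c) \<noteq> 0" using elim(2) that by blast
      then show ?thesis using that(1) by (simp add: pos_codes_def zero_less_measure_iff)
    qed
    have "filter_in (random_forcing M) incl_le (random_filter M x)"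
      unfolding filter_in_def
    proof (intro conjI ballI impI)
      show "random_filter M x \<subseteq> random_forcing M" unfolding random_filter_eq random_forcing_eq by blast
      have "x \<in> bV (BCyl [])" by (simp add: cylinder_def)
      then show "random_filter M x \<noteq> {}" unfolding random_filter_eq using pos[of "BCyl []"] by auto
    next
      fix p q assume "p \<in> random_filter M x" "q \<in> random_forcing M" "incl_le p q"
      then obtain c d where cd: "c \<in> pos_codes" "x \<in> bV c" "d \<in> pos_codes" "p = borel_cond M c" "q = borel_cond M d" "bM c \<subseteq> bM d"
        unfolding random_filter_eq random_forcing_eq using incl_le_iff by blast
      then have "x \<in> bV d" using elim(3) unfolding pos_codes_def by blast
      then show "q \<in> random_filter M x" using cd unfolding random_filter_eq by blast
    next
      fix p q assume "p \<in> random_filter M x" "q \<in> random_filter M x"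
      then obtain c d where cd: "c \<in> codes_in M" "x \<in> bV c" "d \<in> codes_in M" "x \<in> bV d"
        "p = borel_cond M c" "q = borel_cond M d"
        unfolding random_filter_eq pos_codes_def by blast
      have "bint c d \<in> pos_codes" by (rule pos) (use cd bint_codes in auto)
      then have "borel_cond M (bint c d) \<in> random_filter M x" unfolding random_filter_eq using cd by auto
      moreover have "incl_le (borel_cond M (bint c d)) p" "incl_le (borel_cond M (bint c d)) q"
        unfolding cd(5,6) incl_le_iff by auto
      ultimately show "\<exists>r\<in>random_filter M x. incl_le r p \<and> incl_le r q" by blast
    qed
    then show ?case unfolding random_reals_def generic_filter_def using elim(1) by auto
  qed
qed

end

section \<open>Borel definability of generic extensions\<close>

lemma pred_countable_Bex:
  assumes "countable X" "\<And>i. i \<in> X \<Longrightarrow> Measurable.pred N (\<lambda>\<omega>. P \<omega> i)"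
  shows "Measurable.pred N (\<lambda>\<omega>. \<exists>i\<in>X. P \<omega> i)"
proof -
  have "{\<omega> \<in> space N. \<exists>i\<in>X. P \<omega> i} = (\<Union>i\<in>X. {\<omega> \<in> space N. P \<omega> i})" by auto
  also have "\<dots> \<in> sets N"
    by (rule sets.countable_UN'[OF assms(1)]) (use assms(2) in \<open>auto simp: pred_def\<close>)
  finally show ?thesis by (simp add: pred_def)
qed

lemma pred_countable_Ball:
  assumes "countable X" "\<And>i. i \<in> X \<Longrightarrow> Measurable.pred N (\<lambda>\<omega>. P \<omega> i)"
  shows "Measurable.pred N (\<lambda>\<omega>. \<forall>i\<in>X. P \<omega> i)"
proof -
  have "Measurable.pred N (\<lambda>\<omega>. \<not> (\<exists>i\<in>X. \<not> P \<omega> i))"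
    by (intro pred_intros_logic(2) pred_countable_Bex assms)
  then show ?thesis by simp
qed

lemma pred_constant: "Measurable.pred N (\<lambda>\<omega>. b)"
  by simp

lemmas pred_intros = pred_intros_logic(2-5) pred_countable_Ball pred_countable_Bex

definition name_pairs :: "hc \<Rightarrow> (hc \<times> hc) set" where "name_pairs t = {(u, p). hpair u p \<in> elts t}"

lemma countable_pairs: "countable (name_pairs t)"
  unfolding name_pairs_def
proof (rule countable_image_inj_on)
  show "countable ((\<lambda>(s, p). hpair s p) ` {(s, p). hpair s p \<in> elts t})"
    by (rule countable_subset[OF _ countable_elts[of t]]) auto
qed (auto simp: inj_on_def)

lemma elts_name_val_image: "elts (name_val G t) = (\<lambda>a. name_val G (fst a)) ` {a \<in> name_pairs t. snd a \<in> G}"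
proof (intro set_eqI iffI)
  fix z assume "z \<in> elts (name_val G t)"
  then obtain u p where "z = name_val G u" "p \<in> G" "hpair u p \<in> elts t" unfolding elts_name_val by blast
  then show "z \<in> (\<lambda>a. name_val G (fst a)) ` {a \<in> name_pairs t. snd a \<in> G}"
    by (intro image_eqI[of _ _ "(u, p)"]) (simp_all add: name_pairs_def)
next
  fix z assume "z \<in> (\<lambda>a. name_val G (fst a)) ` {a \<in> name_pairs t. snd a \<in> G}"
  then obtain u p where "z = name_val G u" "p \<in> G" "hpair u p \<in> elts t" by (auto simp: name_pairs_def)
  then show "z \<in> elts (name_val G t)" unfolding elts_name_val by blast
qed

lemma name_val_eq_iff:
  "name_val G s = name_val H t \<longleftrightarrow>
    (\<forall>a\<in>name_pairs s. snd a \<in> G \<longrightarrow>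
      (\<exists>b\<in>name_pairs t. snd b \<in> H \<and> name_val G (fst a) = name_val H (fst b))) \<and>
    (\<forall>b\<in>name_pairs t. snd b \<in> H \<longrightarrow>
      (\<exists>a\<in>name_pairs s. snd a \<in> G \<and> name_val H (fst b) = name_val G (fst a)))"
proof -
  have "name_val G s = name_val H t \<longleftrightarrow> elts (name_val G s) = elts (name_val H t)"
    using hc_ext by metis
  then show ?thesis
    unfolding elts_name_val_image set_eq_subset image_subset_iff image_iff by blast
qed

text \<open>Equality of two values unfolds into countably many equalities in which the first name
  has become smaller. Two different filters are allowed so that the extensions by two reals can be
  compared.\<close>

lemma pred_name_val_eq:
  assumes G: "\<And>p. Measurable.pred N (\<lambda>\<omega>. p \<in> G \<omega>)" and H: "\<And>p. Measurable.pred N (\<lambda>\<omega>. p \<in> H \<omega>)"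
  shows "Measurable.pred N (\<lambda>\<omega>. name_val (G \<omega>) s = name_val (H \<omega>) t)"
proof (induction s arbitrary: t rule: wf_induct[OF wf_trancl[OF wf_elts]])
  case (1 s)
  have IH: "Measurable.pred N (\<lambda>\<omega>. name_val (G \<omega>) (fst a) = name_val (H \<omega>) u)" if "a \<in> name_pairs s" for a u
  proof -
    have "(fst a, s) \<in> hmem\<^sup>+" using that unfolding name_pairs_def by (auto intro: hpair_fst_trancl)
    then show ?thesis using 1 by blast
  qed
  have IH': "Measurable.pred N (\<lambda>\<omega>. name_val (H \<omega>) u = name_val (G \<omega>) (fst a))" if "a \<in> name_pairs s" for a u
    using IH[OF that, of u] by (simp only: eq_commute)
  show ?case
    by (subst name_val_eq_iff)
      (intro pred_intros countable_pairs G H IH IH'; assumption)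
qed

context ctm
begin

abbreviation GM :: "(nat \<Rightarrow> bool) \<Rightarrow> hc set" where "GM x \<equiv> random_filter M x"

lemma countable_pos_codes: "countable pos_codes"
  by (rule countable_subset[OF _ countable_codes]) (auto simp: pos_codes_def)

lemma pred_in_filter:
  assumes "X \<in> N \<rightarrow>\<^sub>M coin"
  shows "Measurable.pred N (\<lambda>\<omega>. p \<in> GM (X \<omega>))"
proof -
  have "Measurable.pred coin (\<lambda>x. x \<in> bV c)" for c
    by (rule pred_sets2[of _ coin]) auto
  then have "Measurable.pred coin (\<lambda>x. p \<in> GM x)"
  proof -
    assume bV: "\<And>c. Measurable.pred coin (\<lambda>x. x \<in> bV c)"
    have eq: "p \<in> GM x \<longleftrightarrow> (\<exists>c\<in>pos_codes. x \<in> bV c \<and> p = borel_cond M c)" for x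
      unfolding random_filter_eq by blast
    show ?thesis unfolding eq by (intro pred_intros countable_pos_codes bV pred_constant)
  qed
  then show ?thesis by (rule measurable_compose[OF assms])
qed

lemma pred_in_filter_self: "Measurable.pred coin (\<lambda>x. p \<in> GM x)"
  by (rule pred_in_filter) simp

lemma countable_forcing: "countable (random_forcing M)"
  unfolding random_forcing_eq using countable_pos_codes by simp

lemma filter_subset_forcing: "GM x \<subseteq> random_forcing M"
  unfolding random_filter_eq random_forcing_eq by blast

lemma random_reals_borel: "random_reals M \<in> sets borel"
proof -
  let ?P = "random_forcing M"
  have eq: "x \<in> random_reals M \<longleftrightarrow> (\<exists>p\<in>?P. p \<in> GM x) \<and>
      (\<forall>p\<in>?P. p \<in> GM x \<longrightarrow> (\<forall>q\<in>?P. incl_le p q \<longrightarrow> q \<in> GM x)) \<and>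
      (\<forall>p\<in>?P. p \<in> GM x \<longrightarrow> (\<forall>q\<in>?P. q \<in> GM x \<longrightarrow> (\<exists>r\<in>?P. r \<in> GM x \<and> incl_le r p \<and> incl_le r q))) \<and>
      (\<forall>D\<in>M. dense_in ?P incl_le (elts D) \<longrightarrow> (\<exists>p\<in>elts D. p \<in> GM x))" for x
    unfolding random_reals_def generic_filter_def filter_in_def using filter_subset_forcing[of x] by blast
  have "Measurable.pred coin (\<lambda>x. x \<in> random_reals M)"
    unfolding eq
    by (intro pred_intros countable_forcing countable_M countable_elts pred_in_filter_self pred_constant)
  then show ?thesis by (simp add: pred_def)
qed

lemma random_equiv_borel: "random_equiv M \<in> sets borel"
proof -
  have F: "Measurable.pred (coin \<Otimes>\<^sub>M coin) (\<lambda>z. p \<in> GM (fst z))"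
    "Measurable.pred (coin \<Otimes>\<^sub>M coin) (\<lambda>z. p \<in> GM (snd z))" for p
    by (rule pred_in_filter, simp)+
  have R: "Measurable.pred coin (\<lambda>x. x \<in> random_reals M)"
    by (rule pred_sets2[of _ coin]) (auto simp: random_reals_borel)
  have eq: "z \<in> random_equiv M \<longleftrightarrow> fst z \<in> random_reals M \<and> snd z \<in> random_reals M \<and>
      (\<forall>t\<in>M. \<exists>s\<in>M. name_val (GM (fst z)) t = name_val (GM (snd z)) s) \<and>
      (\<forall>s\<in>M. \<exists>t\<in>M. name_val (GM (fst z)) t = name_val (GM (snd z)) s)" for z
    unfolding random_equiv_def generic_extension_def by (cases z) (auto simp: set_eq_iff image_iff; metis)
  have "Measurable.pred (coin \<Otimes>\<^sub>M coin) (\<lambda>z. z \<in> random_equiv M)"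
    unfolding eq
    by (intro pred_intros countable_M pred_name_val_eq F
        measurable_compose[OF measurable_fst R] measurable_compose[OF measurable_snd R])
  then have "random_equiv M \<in> sets (coin \<Otimes>\<^sub>M coin)" by (simp add: pred_def space_pair_measure)
  also have "sets (coin \<Otimes>\<^sub>M coin) = sets ((borel :: (nat \<Rightarrow> bool) measure) \<Otimes>\<^sub>M (borel :: (nat \<Rightarrow> bool) measure))"
    by (rule sets_pair_measure_cong) simp_all
  also have "\<dots> = sets (borel :: ((nat \<Rightarrow> bool) \<times> (nat \<Rightarrow> bool)) measure)"
    by (rule arg_cong[OF borel_prod])
  finally show ?thesis .
qed

section \<open>A name for the generic real, and decoding of reals from names\<close>

definition one_cond :: hc where "one_cond = borel_cond M (BCyl [])"

text \<open>Canonical names of the naturals: only the largest condition occurs, so all filters that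
  contain it evaluate them alike.\<close>

primrec check_nat :: "nat \<Rightarrow> hc" where
  "check_nat 0 = hset {}"
| "check_nat (Suc n) = hUn (check_nat n) (hup (hpair (check_nat n) one_cond) (hpair (check_nat n) one_cond))"

lemma one_cond_eq: "one_cond = hX XM"
  by (simp add: one_cond_def borel_cond_hX cylinder_def)

lemma check_nat_in_M: "hseq check_nat \<in> M"
proof (rule hseq_iterate)
  show "dft (\<lambda>e. hUn (e 0) (hup (hpair (e 0) one_cond) (hpair (e 0) one_cond)))"
    unfolding one_cond_eq by (intro dfn_intros dft_const reals_in_M)
qed (simp_all add: hempty_in_M)

lemma name_val_check_nat:
  assumes "one_cond \<in> G" shows "name_val G (check_nat n) = hnat n"
proof (induction n)
  case 0
  show ?case by (rule hc_ext) (simp add: elts_name_val)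
next
  case (Suc n)
  have "elts (name_val G (check_nat (Suc n))) = insert (name_val G (check_nat n)) (elts (name_val G (check_nat n)))"
    unfolding elts_name_val using assms by auto
  then show ?case using Suc by (intro hc_ext) simp
qed

text \<open>Among the indices of strings in \<open>hf_enum\<close>, the value contains exactly those
  of initial segments of the generic real. Presenting the real by indices keeps canonical names
  limited to naturals.\<close>

definition real_name :: hc where
  "real_name = hset ((\<lambda>n. hpair (happ (hseq check_nat) n)
     (hset {z \<in> elts (hX XM). elts (happ (hseq hf_enum) n) \<subseteq> elts z})) ` elts homega)"

lemma real_name_in_M: "real_name \<in> M"
  unfolding real_name_def
  by (rule dft_closed, intro dfn_intros dft_const reals_in_M homega_in_M check_nat_in_M hf_enum_in_M)

lemma one_cond_in_filter: "one_cond \<in> GM x"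
proof -
  have "BCyl [] \<in> pos_codes" by (simp add: pos_codes_def cylinder_def)
  moreover have "x \<in> bV (BCyl [])" by (simp add: cylinder_def)
  ultimately show ?thesis unfolding one_cond_def random_filter_eq by blast
qed

text \<open>A condition may be in the filter thanks to another code with the same interpretation in
  \<open>M\<close>, so the forward direction needs an argument: the condition has a common lower
  bound with the true initial segment of that length, and distinct strings of equal length have
  disjoint cylinders.\<close>

lemma cylinder_in_filter_iff:
  assumes "y \<in> random_reals M"
  shows "borel_cond M (BCyl s) \<in> GM y \<longleftrightarrow> y \<in> cylinder s"
proof -
  have pos: "BCyl s \<in> pos_codes" for s by (simp add: pos_codes_def zero_less_measure_iff[symmetric])
  have mem: "borel_cond M (BCyl s) \<in> GM y" if "y \<in> cylinder s" for s
    unfolding random_filter_eq using pos that by auto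
  show ?thesis
  proof (intro iffI mem)
    assume s: "borel_cond M (BCyl s) \<in> GM y"
    show "y \<in> cylinder s"
    proof (rule ccontr)
      assume y: "y \<notin> cylinder s"
      let ?t = "map y [0..<length s]"
      have "borel_cond M (BCyl ?t) \<in> GM y" by (rule mem) (rule cylinder_restrict)
      then obtain r where r: "r \<in> GM y" "incl_le r (borel_cond M (BCyl s))" "incl_le r (borel_cond M (BCyl ?t))"
        using assms s unfolding random_reals_def generic_filter_def filter_in_def by blast
      then obtain c where c: "c \<in> pos_codes" "r = borel_cond M c" unfolding random_filter_eq by blast
      have "bM c \<subseteq> bM (bint (BCyl s) (BCyl ?t))" using r(2,3) unfolding c(2) incl_le_iff by simp
      moreover have "bV (bint (BCyl s) (BCyl ?t)) = {}"
        using y cylinder_restrict[of y "length s"] cylinder_same_length[of _ s ?t] by fastforce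
      ultimately have "mu (bV c) = 0"
        using null_diff[of c "bint (BCyl s) (BCyl ?t)"] bint_codes[of "BCyl s" "BCyl ?t"] c(1)
        by (simp add: pos_codes_def)
      then show False using c(1) by (simp add: pos_codes_def)
    qed
  qed
qed

lemma real_name_val:
  assumes y: "y \<in> random_reals M" and m: "hf_enum m = hstring s"
  shows "hnat m \<in> elts (name_val (GM y) real_name) \<longleftrightarrow> y \<in> cylinder s"
proof -
  let ?p = "\<lambda>n. hset {z \<in> elts (hX XM). elts (hf_enum n) \<subseteq> elts z}"
  have "elts real_name = range (\<lambda>n. hpair (check_nat n) (?p n))"
    unfolding real_name_def elts_hset[OF countable_image[OF countable_elts]] by (simp add: image_image)
  then have "hpair u p \<in> elts real_name \<longleftrightarrow> (\<exists>n. u = check_nat n \<and> p = ?p n)" for u p by auto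
  then have "hnat m \<in> elts (name_val (GM y) real_name) \<longleftrightarrow> (\<exists>n. name_val (GM y) (check_nat n) = hnat m \<and> ?p n \<in> GM y)"
    unfolding elts_name_val mem_Collect_eq by (auto simp: eq_commute)
  also have "\<dots> \<longleftrightarrow> ?p m \<in> GM y" by (simp add: name_val_check_nat one_cond_in_filter)
  also have "?p m = borel_cond M (BCyl s)"
  proof -
    have "{z \<in> hreal ` XM. elts (hstring s) \<subseteq> elts z} = hreal ` (XM \<inter> cylinder s)"
      using hstring_hreal_iff by (auto simp del: elts_hset)
    then show ?thesis by (simp add: m borel_cond_def)
  qed
  also have "\<dots> \<in> GM y \<longleftrightarrow> y \<in> cylinder s" using y by (rule cylinder_in_filter_iff)
  finally show ?thesis .
qed

text \<open>A total map for every \<open>t\<close>, whether or not the value of \<open>t\<close>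
  describes a real. The bit at \<open>n\<close> is the last one of an initial segment of length
  \<open>Suc n\<close>.\<close>

definition decode :: "hc \<Rightarrow> (nat \<Rightarrow> bool) \<Rightarrow> nat \<Rightarrow> bool" where
  "decode t x n \<longleftrightarrow> (\<exists>s. length s = Suc n \<and> s ! n \<and>
     (\<exists>m. hf_enum m = hstring s \<and> hnat m \<in> elts (name_val (GM x) t)))"

text \<open>The value of \<open>real_name\<close> at \<open>y\<close> belongs to the extension by
  \<open>y\<close>, which is that by \<open>x\<close>, so some name \<open>t\<close> has the same
  value at \<open>x\<close>.\<close>

lemma decode_surj:
  assumes "(x, y) \<in> random_equiv M" obtains t where "t \<in> M" "decode t x = y"
proof -
  have y: "y \<in> random_reals M" and ext: "generic_extension M (GM x) = generic_extension M (GM y)"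
    using assms unfolding random_equiv_def by auto
  have "name_val (GM y) real_name \<in> generic_extension M (GM x)"
    unfolding ext unfolding generic_extension_def using real_name_in_M by blast
  then obtain t where t: "t \<in> M" "name_val (GM x) t = name_val (GM y) real_name"
    unfolding generic_extension_def by force
  have "decode t x n \<longleftrightarrow> (\<exists>s. length s = Suc n \<and> s ! n \<and> y \<in> cylinder s)" for n
  proof -
    have "\<exists>m. hf_enum m = hstring s" for s using hf_hstring[of s] by auto
    then show ?thesis unfolding decode_def t(2) using real_name_val[OF y] by blast
  qed
  also have "(\<exists>s. length s = Suc n \<and> s ! n \<and> y \<in> cylinder s) \<longleftrightarrow> y n" for n
  proof
    assume "y n"
    then show "\<exists>s. length s = Suc n \<and> s ! n \<and> y \<in> cylinder s"
      by (intro exI[of _ "map y [0..<Suc n]"]) (simp add: cylinder_restrict nth_append del: upt_Suc)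
  qed (auto simp: cylinder_def)
  finally show ?thesis using that t(1) by blast
qed

lemma decode_measurable: "decode t \<in> coin \<rightarrow>\<^sub>M coin"
proof -
  have mem: "Measurable.pred coin (\<lambda>x. hnat m \<in> elts (name_val (GM x) t))" for m
  proof -
    \<comment> \<open>Writing \<open>hnat m\<close> as the value of a name under a constant filter
      reduces membership to equalities covered by \<open>pred_name_val_eq\<close>.\<close>
    have eq: "hnat m \<in> elts (name_val (GM x) t) \<longleftrightarrow> (\<exists>a\<in>name_pairs t. snd a \<in> GM x \<and>
        name_val (GM x) (fst a) = name_val {one_cond} (check_nat m))" for x
    proof -
      have "hnat m \<in> elts (name_val (GM x) t) \<longleftrightarrow> (\<exists>a\<in>{a \<in> name_pairs t. snd a \<in> GM x}. hnat m = name_val (GM x) (fst a))"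
        unfolding elts_name_val_image image_iff ..
      then show ?thesis
        by (simp only: name_val_check_nat[OF singletonI] Bex_def mem_Collect_eq conj_assoc eq_commute[of "hnat m"])
    qed
    show ?thesis unfolding eq
      by (intro pred_intros countable_pairs pred_name_val_eq pred_in_filter_self) simp
  qed
  have "Measurable.pred coin (\<lambda>x. decode t x n)" for n
    unfolding decode_def by (intro pred_intros_logic pred_intros_countable mem) simp_all
  then show ?thesis
    unfolding coin_def[abs_def]
    by (intro measurable_PiM_single') (simp_all add: coin_def[symmetric] space_PiM)
qed

end

section \<open>Coordinate permutations of the model preserve generic extensions\<close>

lemma AE_permute:
  fixes \<pi> :: "nat \<Rightarrow> nat"
  assumes "inj \<pi>" "AE x in coin. Q x" shows "AE x in coin. Q (\<lambda>n. x (\<pi> n))"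
  by (rule AE_distrD[OF measurable_permute[of \<pi>]], subst distr_coin_permute[OF assms(1)]) (rule assms(2))

lemma sets_permute:
  fixes \<pi> :: "nat \<Rightarrow> nat" and S :: "(nat \<Rightarrow> bool) set"
  shows "S \<in> sets borel \<Longrightarrow> {x. (\<lambda>n. x (\<pi> n)) \<in> S} \<in> sets borel"
  using measurable_sets[OF measurable_permute[of \<pi>], of S] by (simp add: vimage_def)

lemma mu_permute:
  fixes \<pi> :: "nat \<Rightarrow> nat"
  assumes "inj \<pi>" "S \<in> sets borel" shows "mu {x. (\<lambda>n. x (\<pi> n)) \<in> S} = mu S"
  using measure_distr[OF measurable_permute[of \<pi>], of S] assms by (simp add: distr_coin_permute vimage_def)

text \<open>A code for the preimage of \<open>ucyl A\<close> under precomposition with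
  \<open>\<pi>\<close>: strings long enough to decide that the permuted real extends some
  \<open>a\<close>.\<close>

definition permute_strings :: "(nat \<Rightarrow> nat) \<Rightarrow> bool list set \<Rightarrow> bool list set" where
  "permute_strings \<pi> A = {t. \<exists>a\<in>A. \<forall>i<length a. \<pi> i < length t \<and> t ! \<pi> i = a ! i}"

lemma ucyl_permute: "ucyl (permute_strings \<pi> A) = {x. (\<lambda>n. x (\<pi> n)) \<in> ucyl A}"
proof (intro set_eqI iffI)
  fix x assume "x \<in> ucyl (permute_strings \<pi> A)"
  then obtain t a where "x \<in> cylinder t" "a \<in> A" "\<forall>i<length a. \<pi> i < length t \<and> t ! \<pi> i = a ! i"
    unfolding ucyl_def permute_strings_def by blast
  then have "(\<lambda>n. x (\<pi> n)) \<in> cylinder a" by (simp add: cylinder_def)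
  then show "x \<in> {x. (\<lambda>n. x (\<pi> n)) \<in> ucyl A}" using \<open>a \<in> A\<close> unfolding ucyl_def by blast
next
  fix x assume "x \<in> {x. (\<lambda>n. x (\<pi> n)) \<in> ucyl A}"
  then obtain a where a: "a \<in> A" "(\<lambda>n. x (\<pi> n)) \<in> cylinder a" unfolding ucyl_def by blast
  have "finite (\<pi> ` {..<length a})" by simp
  then obtain m where m: "\<And>i. i < length a \<Longrightarrow> \<pi> i < m" unfolding finite_nat_set_iff_bounded by blast
  then have "map x [0..<m] \<in> permute_strings \<pi> A"
    unfolding permute_strings_def using a
    by (intro CollectI bexI[of _ a]) (simp_all add: cylinder_def)
  then show "x \<in> ucyl (permute_strings \<pi> A)" unfolding ucyl_def using cylinder_restrict by blast
qed

definition hact :: "hc \<Rightarrow> hc \<Rightarrow> hc" where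
  "hact p z = hset ((\<lambda>n. hpair n (happ z (happ p n))) ` elts homega)"

lemma hact_hreal: "hact (hseq (\<lambda>n. hnat (\<pi> n))) (hreal x) = hreal (\<lambda>n. x (\<pi> n))"
  unfolding hact_def hreal_def by (rule hc_ext) (simp add: elts_hseq image_image)

text \<open>\<open>M\<close> has to recognize Borel codes, since only sets given by a code can be
  conditions. The recursion returns sets, so the verdict is 1 or 0 as a natural number.\<close>

definition icode_body :: "(hc \<Rightarrow> hc) \<Rightarrow> hc \<Rightarrow> hc" where
  "icode_body F x = (if x = hpair (hfst x) (hsnd x) then
     if hfst x = hnat 0 then if hsnd x \<in> elts (hS UNIV) then hnat 1 else hnat 0
     else if hfst x = hnat 1 then F (hsnd x)
     else if hfst x = hnat 2 \<and> (\<forall>u\<in>elts (hsnd x). \<exists>n\<in>elts homega. u = hpair n (happ (hsnd x) n)) \<and>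
       (\<forall>n\<in>elts homega. hpair n (happ (hsnd x) n) \<in> elts (hsnd x) \<and> F (happ (hsnd x) n) = hnat 1) then hnat 1
     else hnat 0 else hnat 0)"

definition icode :: "hc \<Rightarrow> hc" where "icode = wfrec (hmem\<^sup>+) icode_body"

lemma icode_body_cong:
  assumes "\<And>y. (y, x) \<in> hmem\<^sup>+ \<Longrightarrow> F y = G y"
  shows "icode_body F x = icode_body G x"
proof (cases "x = hpair (hfst x) (hsnd x)")
  case True
  have s: "(hsnd x, x) \<in> hmem\<^sup>+" by (subst (2) True) (rule hpair_snd_below)
  have "F v = G v" if "hpair u v \<in> elts (hsnd x)" for u v
  proof (rule assms)
    show "(v, x) \<in> hmem\<^sup>+" using hpair_snd_below[of v u] elts_below[OF that] s by (meson trancl_trans)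
  qed
  then have "hpair n (happ (hsnd x) n) \<in> elts (hsnd x) \<and> F (happ (hsnd x) n) = hnat 1 \<longleftrightarrow>
      hpair n (happ (hsnd x) n) \<in> elts (hsnd x) \<and> G (happ (hsnd x) n) = hnat 1" for n by metis
  then show ?thesis unfolding icode_body_def assms[OF s] by (simp only:)
next
  case False
  then show ?thesis unfolding icode_body_def by (simp only: if_False)
qed

lemma icode_unfold: "icode x = icode_body icode x"
  unfolding icode_def by (rule wfrec_hmem) (rule icode_body_cong)

lemma icode_hcode: "icode (hcode c) = hnat 1"
proof (induction c)
  case (BCyl s)
  show ?case by (subst icode_unfold) (simp add: icode_body_def del: hnat.simps)
next
  case (BCompl c)
  then show ?case by (subst icode_unfold) (simp add: icode_body_def del: hnat.simps)
next
  case (BUnion f)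
  have "\<forall>u\<in>elts (hseq (\<lambda>n. hcode (f n))). \<exists>n\<in>elts homega. u = hpair n (happ (hseq (\<lambda>n. hcode (f n))) n)"
    by (auto simp: elts_hseq)
  then show ?case using BUnion by (subst icode_unfold) (simp add: icode_body_def del: hnat.simps)
qed

text \<open>Membership is well-founded, so a set that passes the local tests at all levels is built
  up from codes of the datatype.\<close>

lemma icode_D: "icode x = hnat 1 \<Longrightarrow> \<exists>c. x = hcode c"
proof (induction x rule: wf_induct[OF wf_trancl[OF wf_elts]])
  case (1 x)
  have body: "icode_body icode x = hnat 1" using 1(2) icode_unfold by metis
  have pair: "x = hpair (hfst x) (hsnd x)"
    by (rule ccontr) (use body in \<open>simp add: icode_body_def del: hnat.simps\<close>)
  have s: "(hsnd x, x) \<in> hmem\<^sup>+" by (subst (2) pair) (rule hpair_snd_below)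
  note body' = body[unfolded icode_body_def, folded pair, simplified if_P[OF pair]]
  consider "hfst x = hnat 0" "hsnd x \<in> range hstring" | "hfst x = hnat 1" "icode (hsnd x) = hnat 1"
    | "hfst x = hnat 2" "\<forall>u\<in>elts (hsnd x). \<exists>n\<in>elts homega. u = hpair n (happ (hsnd x) n)"
      "\<forall>n\<in>elts homega. hpair n (happ (hsnd x) n) \<in> elts (hsnd x) \<and> icode (happ (hsnd x) n) = hnat 1"
    using body pair unfolding icode_body_def by (simp split: if_splits del: hnat.simps)
  then show ?case
  proof cases
    case 1
    then obtain t where "hsnd x = hstring t" by blast
    then have "x = hcode (BCyl t)" using pair 1 by (simp del: hnat.simps)
    then show ?thesis ..
  next
    case 2
    then obtain c where "hsnd x = hcode c" using 1(1) s by blast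
    then have "x = hcode (BCompl c)" using pair 2 by (simp del: hnat.simps)
    then show ?thesis ..
  next
    case 3
    let ?g = "\<lambda>n. happ (hsnd x) (hnat n)"
    have mem: "hpair (hnat n) (?g n) \<in> elts (hsnd x)" "icode (?g n) = hnat 1" for n using 3(3) by auto
    have "(?g n, x) \<in> hmem\<^sup>+" for n
      using hpair_snd_below[of "?g n" "hnat n"] elts_below[OF mem(1)[of n]] s by (meson trancl_trans)
    then have "\<exists>c. ?g n = hcode c" for n using 1(1) mem(2)[of n] by blast
    then obtain f where f: "\<And>n. ?g n = hcode (f n)" by metis
    have "hsnd x = hseq ?g"
    proof (rule hc_ext)
      show "elts (hsnd x) = elts (hseq ?g)" using 3(2) mem(1) unfolding elts_hseq by auto
    qed
    then have "x = hcode (BUnion f)" using pair 3(1) by (simp add: f del: hnat.simps)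
    then show ?thesis ..
  qed
qed

text \<open>Each pair of a name with condition \<open>p\<close> is replaced by all pairs with a
  condition \<open>q\<close> in \<open>Q\<close> related to \<open>p\<close>. The relation is meant
  to say that \<open>q\<close> in one filter puts \<open>p\<close> into the other.\<close>

definition trans_body :: "hc \<Rightarrow> (hc \<Rightarrow> hc \<Rightarrow> bool) \<Rightarrow> (hc \<Rightarrow> hc) \<Rightarrow> hc \<Rightarrow> hc" where
  "trans_body Q rel F t = hUnion (hset ((\<lambda>u. if u = hpair (hfst u) (hsnd u)
     then hset ((\<lambda>q. hpair (F (hfst u)) q) ` elts (hset {q \<in> elts Q. rel (hsnd u) q})) else hset {}) ` elts t))"

definition name_trans :: "hc \<Rightarrow> (hc \<Rightarrow> hc \<Rightarrow> bool) \<Rightarrow> hc \<Rightarrow> hc" where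
  "name_trans Q rel = wfrec (hmem\<^sup>+) (trans_body Q rel)"

lemma trans_body_cong:
  assumes "\<And>y. (y, t) \<in> hmem\<^sup>+ \<Longrightarrow> F y = G y"
  shows "trans_body Q rel F t = trans_body Q rel G t"
proof -
  have "F (hfst u) = G (hfst u)" if "u \<in> elts t" "u = hpair (hfst u) (hsnd u)" for u
  proof (rule assms)
    have "hpair (hfst u) (hsnd u) \<in> elts t" using that by simp
    then show "(hfst u, t) \<in> hmem\<^sup>+" by (rule hpair_fst_trancl)
  qed
  then have "(\<lambda>u. if u = hpair (hfst u) (hsnd u)
     then hset ((\<lambda>q. hpair (F (hfst u)) q) ` elts (hset {q \<in> elts Q. rel (hsnd u) q})) else hset {}) ` elts t =
     (\<lambda>u. if u = hpair (hfst u) (hsnd u)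
     then hset ((\<lambda>q. hpair (G (hfst u)) q) ` elts (hset {q \<in> elts Q. rel (hsnd u) q})) else hset {}) ` elts t"
    by (intro image_cong refl if_cong) auto
  then show ?thesis unfolding trans_body_def by (simp only:)
qed

lemma name_trans_unfold: "name_trans Q rel t = trans_body Q rel (name_trans Q rel) t"
  unfolding name_trans_def by (rule wfrec_hmem) (rule trans_body_cong)

lemma hpair_name_trans:
  "hpair s' q \<in> elts (name_trans Q rel t) \<longleftrightarrow>
    (\<exists>s p. hpair s p \<in> elts t \<and> s' = name_trans Q rel s \<and> q \<in> elts Q \<and> rel p q)"
proof -
  let ?B = "\<lambda>u. if u = hpair (hfst u) (hsnd u)
     then hset ((\<lambda>q. hpair (name_trans Q rel (hfst u)) q) ` elts (hset {q \<in> elts Q. rel (hsnd u) q})) else hset {}"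
  have B: "elts (?B (hpair s p)) = hpair (name_trans Q rel s) ` {q \<in> elts Q. rel p q}" for s p
    by simp
  have "hpair s' q \<in> elts (name_trans Q rel t) \<longleftrightarrow> (\<exists>u\<in>elts t. hpair s' q \<in> elts (?B u))"
    by (subst name_trans_unfold)
      (unfold trans_body_def elts_hUnion elts_hset[OF countable_image[OF countable_elts]], blast)
  also have "\<dots> \<longleftrightarrow> (\<exists>s p. hpair s p \<in> elts t \<and> hpair s' q \<in> elts (?B (hpair s p)))"
  proof
    assume "\<exists>u\<in>elts t. hpair s' q \<in> elts (?B u)"
    then obtain u where u: "u \<in> elts t" "hpair s' q \<in> elts (?B u)" by blast
    then have "u = hpair (hfst u) (hsnd u)" by (auto split: if_splits)
    then show "\<exists>s p. hpair s p \<in> elts t \<and> hpair s' q \<in> elts (?B (hpair s p))" using u by metis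
  qed blast
  also have "\<dots> \<longleftrightarrow> (\<exists>s p. hpair s p \<in> elts t \<and> s' = name_trans Q rel s \<and> q \<in> elts Q \<and> rel p q)"
  proof -
    have "hpair s' q \<in> hpair a ` S \<longleftrightarrow> s' = a \<and> q \<in> S" for a S by auto
    then show ?thesis unfolding B by (simp only: mem_Collect_eq)
  qed
  finally show ?thesis .
qed

text \<open>At each level the same subnames survive, since \<open>p\<close> is in \<open>H\<close>
  exactly if a related \<open>q\<close> is in \<open>G\<close>. \<open>below\<close> is a transitive
  class to which the hypothesis on conditions is confined; it is used with \<open>M\<close>.\<close>

lemma name_val_trans:
  assumes "\<And>p. p \<in> below \<Longrightarrow> p \<in> H \<longleftrightarrow> (\<exists>q\<in>G. q \<in> elts Q \<and> rel p q)"
    and "\<And>x y. y \<in> below \<Longrightarrow> x \<in> elts y \<Longrightarrow> x \<in> below" "t \<in> below"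
  shows "name_val G (name_trans Q rel t) = name_val H t"
  using assms(3)
proof (induction t rule: wf_induct[OF wf_trancl[OF wf_elts]])
  case (1 t)
  have IH: "name_val G (name_trans Q rel s) = name_val H s" and pb: "p \<in> below" if "hpair s p \<in> elts t" for s p
  proof -
    have "hpair s p \<in> below" using assms(2) 1(2) that by blast
    then have "hup s p \<in> below" using assms(2) by (simp add: elts_hpair)
    then have "s \<in> below" "p \<in> below" using assms(2) by simp_all
    then show "name_val G (name_trans Q rel s) = name_val H s" "p \<in> below"
      using 1(1) hpair_fst_trancl[OF that] by blast+
  qed
  have "elts (name_val G (name_trans Q rel t)) =
      {name_val G (name_trans Q rel s) | s. \<exists>p. hpair s p \<in> elts t \<and> (\<exists>q\<in>G. q \<in> elts Q \<and> rel p q)}"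
    unfolding elts_name_val hpair_name_trans by blast
  also have "\<dots> = {name_val H s | s. \<exists>p\<in>H. hpair s p \<in> elts t}"
  proof -
    have "v = name_val G (name_trans Q rel s) \<and> (\<exists>p. hpair s p \<in> elts t \<and> (\<exists>q\<in>G. q \<in> elts Q \<and> rel p q)) \<longleftrightarrow>
        v = name_val H s \<and> (\<exists>p\<in>H. hpair s p \<in> elts t)" for v s
      using IH[of s] pb[of s] assms(1) by metis
    then show ?thesis by (simp only:)
  qed
  finally show ?case by (intro hc_ext) (simp only: elts_name_val)
qed

section \<open>Filters and names under a permutation of the coordinates\<close>

context ctm
begin

lemma dft_hact [dfn_intros]:
  assumes "dft s" "dft t" shows "dft (\<lambda>e. hact (s e) (t e))"
  by (rule dft_subst2[OF _ assms]) (unfold hact_def, intro dfn_intros dft_const homega_in_M)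

lemma dft_icode [dfn_intros]:
  assumes "dft s" shows "dft (\<lambda>e. icode (s e))"
proof (rule dft_subst1[OF _ assms])
  show "dft (\<lambda>e. icode (e 0))"
    unfolding icode_def
  proof (rule wfrec_dft)
    show "dft (\<lambda>e. icode_body (\<lambda>y. happ (e 1) y) (e 0))"
      unfolding icode_body_def by (intro dfn_intros dft_const hnat_in_M homega_in_M strings_in_M)
  qed (rule icode_body_cong)
qed

lemma permute_OM:
  assumes pi: "hseq (\<lambda>n. hnat (\<pi> n)) \<in> M" and A: "A \<in> OM"
  shows "permute_strings \<pi> A \<in> OM"
proof (rule OM_I)
  let ?p = "hseq (\<lambda>n. hnat (\<pi> n))"
  show "dfn (\<lambda>e. \<exists>a\<in>elts (hS A). \<forall>i\<in>elts (hlen a). happ ?p i \<in> elts (hlen (e 0)) \<and> happ (e 0) (happ ?p i) = happ a i)"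
    by (intro dfn_intros dft_const pi OM_D A)
  have happ: "happ (hstring t) (hnat j) = hbool (t ! j)" if "j < length t" for t j
  proof (rule happ_eq)
    fix w assume "hpair (hnat j) w \<in> elts (hstring t)"
    then show "w = hbool (t ! j)" unfolding elts_hstring by auto
  qed (use that in simp)
  have "(\<forall>i\<in>elts (hlen (hstring a)). happ ?p i \<in> elts (hlen (hstring t)) \<and> happ (hstring t) (happ ?p i) = happ (hstring a) i) \<longleftrightarrow>
      (\<forall>i<length a. \<pi> i < length t \<and> t ! \<pi> i = a ! i)" for a t
  proof -
    have "happ ?p (hnat i) \<in> elts (hlen (hstring t)) \<and> happ (hstring t) (happ ?p (hnat i)) = happ (hstring a) (hnat i) \<longleftrightarrow>
        \<pi> i < length t \<and> t ! \<pi> i = a ! i" if "i < length a" for i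
      using happ[OF that] happ[of "\<pi> i" t] by (cases "\<pi> i < length t") (simp_all del: hnat.simps)
    then show ?thesis unfolding hlen_hstring elts_hnat[of "length a"] by auto
  qed
  then show "t \<in> permute_strings \<pi> A \<longleftrightarrow> (\<exists>a\<in>elts (hS A). \<forall>i\<in>elts (hlen a).
      happ ?p i \<in> elts (hlen (hstring t)) \<and> happ (hstring t) (happ ?p i) = happ a i)" for t
    unfolding permute_strings_def by simp
qed

lemma permute_reals:
  assumes pi: "hseq (\<lambda>n. hnat (\<pi> n)) \<in> M" and x: "x \<in> XM"
  shows "(\<lambda>n. x (\<pi> n)) \<in> XM"
proof -
  have "hact (hseq (\<lambda>n. hnat (\<pi> n))) (hreal x) \<in> M"
    by (rule dft_closed, intro dfn_intros dft_const pi) (use x in \<open>simp add: reals_in_def\<close>)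
  then show ?thesis by (simp add: hact_hreal reals_in_def)
qed

text \<open>A condition is in the filter of the permuted real iff the filter of \<open>x\<close>
  contains a closed set that the permutation maps into the condition. Inner regularity gives one
  direction, compactness the other, and only open codes have to be permuted.\<close>

lemma filter_permute_AE:
  assumes pi: "hseq (\<lambda>n. hnat (\<pi> n)) \<in> M" and inj: "inj \<pi>"
  shows "AE x in coin. \<forall>c\<in>codes_in M. borel_cond M c \<in> GM (\<lambda>n. x (\<pi> n)) \<longleftrightarrow>
    (\<exists>A\<in>OM. borel_cond M (BCompl (ocode A)) \<in> GM x \<and> (\<forall>y\<in>XM - ucyl A. (\<lambda>n. y (\<pi> n)) \<in> bM c))"
proof -
  have ae_pos: "AE x in coin. \<forall>c\<in>codes_in M. x \<in> bV c \<longrightarrow> c \<in> pos_codes"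
    unfolding AE_ball_countable[OF countable_codes]
  proof
    fix c assume c: "c \<in> codes_in M"
    show "AE x in coin. x \<in> bV c \<longrightarrow> c \<in> pos_codes"
    proof (cases "mu (bV c) = 0")
      case True
      then have "AE x in coin. x \<notin> bV c" by (intro AE_coin_not) auto
      then show ?thesis by eventually_elim auto
    qed (use c in \<open>simp add: pos_codes_def zero_less_measure_iff\<close>)
  qed
  have ae_incl: "AE x in coin. \<forall>c\<in>codes_in M. \<forall>d\<in>codes_in M. bM c \<subseteq> bM d \<longrightarrow> x \<in> bV c \<longrightarrow> x \<in> bV d"
    unfolding AE_ball_countable[OF countable_codes]
  proof (intro ballI)
    fix c d assume cd: "c \<in> codes_in M" "d \<in> codes_in M"
    show "AE x in coin. bM c \<subseteq> bM d \<longrightarrow> x \<in> bV c \<longrightarrow> x \<in> bV d"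
    proof (cases "bM c \<subseteq> bM d")
      case True
      then have "AE x in coin. x \<notin> bV c - bV d" using null_diff[OF cd] by (intro AE_coin_not) auto
      then show ?thesis by eventually_elim auto
    qed simp
  qed
  have countable_OM: "countable OM"
  proof -
    have "countable (hS ` OM)" by (rule countable_subset[OF _ countable_M]) (auto simp: OM_def)
    then show ?thesis by (rule countable_image_inj_on) (simp add: inj_on_def)
  qed
  \<comment> \<open>The closed subsets obtained from the approximations for all \<open>k\<close>
    exhaust a coded set up to a null set.\<close>
  have ae1: "AE x in coin. \<forall>c\<in>codes_in M. (\<lambda>n. x (\<pi> n)) \<in> bV c \<longrightarrow>
      (\<exists>B\<in>OM. XM - bM c \<subseteq> ucyl B \<and> (\<lambda>n. x (\<pi> n)) \<notin> ucyl B)"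
  proof (rule AE_permute[OF inj], unfold AE_ball_countable[OF countable_codes], rule ballI)
    fix c assume c: "c \<in> codes_in M"
    have "\<exists>A B. A \<in> OM \<and> B \<in> OM \<and> XM - bM c \<subseteq> ucyl B \<and> mu (ucyl A \<inter> ucyl B) \<le> (1 / 2) ^ k \<and> mu (bV c - ucyl A) = 0" for k
      using approximable_code[OF c] unfolding approximable_def by meson
    then obtain A B where AB: "\<And>k. A k \<in> OM" "\<And>k. B k \<in> OM" "\<And>k. XM - bM c \<subseteq> ucyl (B k)"
      "\<And>k. mu (ucyl (A k) \<inter> ucyl (B k)) \<le> (1 / 2) ^ k" "\<And>k. mu (bV c - ucyl (A k)) = 0" by metis
    let ?N = "bV c \<inter> (\<Inter>k. ucyl (B k))"
    have N: "?N \<in> sets borel" by auto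
    have "mu ?N \<le> (1 / 2) ^ k" for k
    proof -
      have "mu ?N \<le> mu ((ucyl (A k) \<inter> ucyl (B k)) \<union> (bV c - ucyl (A k)))" by (rule mu_mono) auto
      also have "\<dots> \<le> mu (ucyl (A k) \<inter> ucyl (B k)) + mu (bV c - ucyl (A k))" by (rule mu_Un_le) auto
      finally show ?thesis using AB(4)[of k] AB(5)[of k] by linarith
    qed
    then have "mu ?N = 0" using le_zero_if_small measure_nonneg[of coin ?N] by (meson order_antisym)
    then have "AE x in coin. x \<notin> ?N" using N by (rule AE_coin_not[rotated])
    then show "AE x in coin. x \<in> bV c \<longrightarrow> (\<exists>B\<in>OM. XM - bM c \<subseteq> ucyl B \<and> x \<notin> ucyl B)"
      by eventually_elim (use AB(2,3) in blast)
  qed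
  \<comment> \<open>No code of the preimage of \<open>c\<close> is at hand; an open hull of
    \<open>c\<close> is permuted in its place, and compactness moves the covering from
    \<open>M\<close> to V.\<close>
  have ae2: "AE x in coin. \<forall>c\<in>codes_in M. \<forall>A\<in>OM. (\<forall>y\<in>XM - ucyl A. (\<lambda>n. y (\<pi> n)) \<in> bM c) \<longrightarrow>
      x \<notin> ucyl A \<longrightarrow> (\<lambda>n. x (\<pi> n)) \<in> bV c"
    unfolding AE_ball_countable[OF countable_codes] AE_ball_countable[OF countable_OM]
  proof (intro ballI)
    fix c A assume c: "c \<in> codes_in M" and A: "A \<in> OM"
    show "AE x in coin. (\<forall>y\<in>XM - ucyl A. (\<lambda>n. y (\<pi> n)) \<in> bM c) \<longrightarrow> x \<notin> ucyl A \<longrightarrow> (\<lambda>n. x (\<pi> n)) \<in> bV c"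
    proof (cases "\<forall>y\<in>XM - ucyl A. (\<lambda>n. y (\<pi> n)) \<in> bM c")
      case True
      let ?D = "{x. (\<lambda>n. x (\<pi> n)) \<in> - bV c} - ucyl A"
      have sD: "?D \<in> sets borel" by (intro sets.Diff sets_permute) auto
      have "mu ?D \<le> (1 / 2) ^ k" for k
      proof -
        obtain C B where CB: "C \<in> OM" "B \<in> OM" "bM c \<subseteq> ucyl C" "mu (ucyl C \<inter> ucyl B) \<le> (1 / 2) ^ k"
          "mu (- bV c - ucyl B) = 0"
          using approximable_code[OF c] unfolding approximable_def by meson
        have "XM \<subseteq> ucyl (A \<union> permute_strings \<pi> C)"
          unfolding ucyl_Un ucyl_permute using True CB(3) by auto
        then have "ucyl (A \<union> permute_strings \<pi> C) = UNIV"
          using compact_OM Un_OM[OF A permute_OM[OF pi CB(1)]] by blast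
        then have "?D \<subseteq> {x. (\<lambda>n. x (\<pi> n)) \<in> (ucyl C \<inter> ucyl B) \<union> (- bV c - ucyl B)}"
          unfolding ucyl_Un ucyl_permute by auto
        then have "mu ?D \<le> mu {x. (\<lambda>n. x (\<pi> n)) \<in> (ucyl C \<inter> ucyl B) \<union> (- bV c - ucyl B)}"
          by (rule mu_mono) (rule sets_permute, auto)
        also have "\<dots> = mu ((ucyl C \<inter> ucyl B) \<union> (- bV c - ucyl B))" by (rule mu_permute[OF inj]) auto
        also have "\<dots> \<le> mu (ucyl C \<inter> ucyl B) + mu (- bV c - ucyl B)" by (rule mu_Un_le) auto
        finally show ?thesis using CB(4,5) by linarith
      qed
      then have "mu ?D = 0" using le_zero_if_small measure_nonneg[of coin ?D] by (meson order_antisym)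
      then have "AE x in coin. x \<notin> ?D" using sD by (rule AE_coin_not[rotated])
      then show ?thesis by eventually_elim auto
    next
      case False
      show ?thesis by (rule AE_I2) (use False in blast)
    qed
  qed
  show ?thesis using ae_pos AE_permute[OF inj ae_pos] ae_incl ae1 ae2
  proof eventually_elim
    case (elim x)
    let ?gx = "\<lambda>n. x (\<pi> n)"
    show ?case
    proof (intro ballI iffI)
      fix c assume c: "c \<in> codes_in M" and "borel_cond M c \<in> GM ?gx"
      \<comment> \<open>Membership in the filter may be due to another code \<open>d\<close> of the
        same condition.\<close>
      then obtain d where d: "d \<in> pos_codes" "?gx \<in> bV d" "bM c = bM d"
        unfolding random_filter_eq using borel_cond_eq_iff by blast
      then obtain B where B: "B \<in> OM" "XM - bM d \<subseteq> ucyl B" "?gx \<notin> ucyl B"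
        using elim(4) unfolding pos_codes_def by blast
      let ?A = "permute_strings \<pi> B"
      have A: "?A \<in> OM" by (rule permute_OM[OF pi B(1)])
      have x: "x \<in> bV (BCompl (ocode ?A))" using B(3) by (simp add: ucyl_permute)
      moreover have "BCompl (ocode ?A) \<in> codes_in M" using ocode_codes[OF A] BCompl_codes by blast
      ultimately have "borel_cond M (BCompl (ocode ?A)) \<in> GM x" using elim(1) unfolding random_filter_eq by blast
      moreover have "\<forall>y\<in>XM - ucyl ?A. (\<lambda>n. y (\<pi> n)) \<in> bM c"
        unfolding ucyl_permute d(3) using B(2) permute_reals[OF pi] by blast
      ultimately show "\<exists>A\<in>OM. borel_cond M (BCompl (ocode A)) \<in> GM x \<and> (\<forall>y\<in>XM - ucyl A. (\<lambda>n. y (\<pi> n)) \<in> bM c)"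
        using A by blast
    next
      fix c assume c: "c \<in> codes_in M"
        and "\<exists>A\<in>OM. borel_cond M (BCompl (ocode A)) \<in> GM x \<and> (\<forall>y\<in>XM - ucyl A. (\<lambda>n. y (\<pi> n)) \<in> bM c)"
      then obtain A where A: "A \<in> OM" "borel_cond M (BCompl (ocode A)) \<in> GM x"
        "\<forall>y\<in>XM - ucyl A. (\<lambda>n. y (\<pi> n)) \<in> bM c" by blast
      obtain d where d: "d \<in> pos_codes" "x \<in> bV d" "bM (BCompl (ocode A)) = bM d"
        using A(2) unfolding random_filter_eq using borel_cond_eq_iff by blast
      have "BCompl (ocode A) \<in> codes_in M" using ocode_codes[OF A(1)] BCompl_codes by blast
      then have "x \<in> bV (BCompl (ocode A))" using elim(3) d unfolding pos_codes_def by blast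
      then have "x \<notin> ucyl A" by simp
      then have gx: "?gx \<in> bV c" using elim(5) c A by blast
      then have "c \<in> pos_codes" using elim(2) c by blast
      then show "borel_cond M c \<in> GM ?gx" unfolding random_filter_eq using gx by blast
    qed
  qed
qed

text \<open>Almost surely the filter of the permuted real is obtained from that of \<open>x\<close>
  by a relation definable in \<open>M\<close>, so names for the former translate inside
  \<open>M\<close> into names for the latter.\<close>

lemma permute_extension_AE:
  assumes pi: "hseq (\<lambda>n. hnat (\<pi> n)) \<in> M" and inj: "inj \<pi>"
  shows "AE x in coin. generic_extension M (GM (\<lambda>n. x (\<pi> n))) \<subseteq> generic_extension M (GM x)"
  using filter_permute_AE[OF assms]
proof eventually_elim
  case (elim x)
  let ?p = "hseq (\<lambda>n. hnat (\<pi> n))" and ?gx = "\<lambda>n. x (\<pi> n)"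
  define Q where "Q = hset ((\<lambda>a. hset {z \<in> elts (hX XM). \<not> (\<exists>s\<in>elts a. elts s \<subseteq> elts z)}) ` elts (hPow (hS UNIV)))"
  have QM: "Q \<in> M" unfolding Q_def
    by (rule dft_closed, intro dfn_intros dft_const reals_in_M strings_in_M)
  have cl: "hset {z \<in> elts (hX XM). \<not> (\<exists>s\<in>elts (hS A). elts s \<subseteq> elts z)} = borel_cond M (BCompl (ocode A))" for A
  proof -
    have "{z \<in> elts (hX XM). \<not> (\<exists>s\<in>elts (hS A). elts s \<subseteq> elts z)} = hreal ` {x \<in> XM. x \<notin> ucyl A}"
      by (auto simp: hstring_hreal_iff ucyl_def simp del: elts_hset)
    also have "{x \<in> XM. x \<notin> ucyl A} = bM (BCompl (ocode A))" by auto
    finally show ?thesis by (simp only: borel_cond_def)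
  qed
  have Q: "elts Q = (\<lambda>A. borel_cond M (BCompl (ocode A))) ` OM"
  proof -
    have "elts Q = (\<lambda>a. hset {z \<in> elts (hX XM). \<not> (\<exists>s\<in>elts a. elts s \<subseteq> elts z)}) ` elts (hPow (hS UNIV))"
      unfolding Q_def by (rule elts_hset[OF countable_image[OF countable_elts]])
    then show ?thesis unfolding elts_hPow_strings image_image cl .
  qed
  \<comment> \<open>Names mention arbitrary sets \<open>p\<close>. The clause on codes excludes
    those that are no conditions although they contain the image of one.\<close>
  define rel where "rel p q \<longleftrightarrow> (\<exists>c\<in>M. icode c = hnat 1 \<and> cval (hX XM) c = p) \<and> (\<forall>z\<in>elts q. hact ?p z \<in> elts p)" for p q
  have drel: "dfn (\<lambda>e. rel (e 0) (e 1))"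
    unfolding rel_def by (intro dfn_intros dft_const hnat_in_M reals_in_M pi)
  have dtr: "dft (\<lambda>e. name_trans Q rel (e 0))"
    unfolding name_trans_def
  proof (rule wfrec_dft)
    show "dft (\<lambda>e. trans_body Q rel (\<lambda>y. happ (e 1) y) (e 0))"
      unfolding trans_body_def by (intro dfn_intros dfn_subst2[OF drel] dft_const QM hempty_in_M)
  qed (rule trans_body_cong)
  have rel_iff: "rel p q \<longleftrightarrow> (\<exists>c\<in>codes_in M. p = borel_cond M c) \<and> (\<forall>z\<in>elts q. hact ?p z \<in> elts p)" for p q
  proof -
    have "(\<exists>c\<in>M. icode c = hnat 1 \<and> cval (hX XM) c = p) \<longleftrightarrow> (\<exists>c\<in>codes_in M. p = borel_cond M c)"
    proof
      assume "\<exists>c\<in>M. icode c = hnat 1 \<and> cval (hX XM) c = p"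
      then obtain c d where "c \<in> M" "cval (hX XM) c = p" "c = hcode d" using icode_D by blast
      then show "\<exists>c\<in>codes_in M. p = borel_cond M c" unfolding codes_in_def using cval_hcode by auto
    next
      assume "\<exists>c\<in>codes_in M. p = borel_cond M c"
      then show "\<exists>c\<in>M. icode c = hnat 1 \<and> cval (hX XM) c = p"
        unfolding codes_in_def using cval_hcode icode_hcode by blast
    qed
    then show ?thesis unfolding rel_def by (rule arg_cong2[OF _ refl])
  qed
  have hact_iff: "(\<forall>z\<in>elts (borel_cond M (BCompl (ocode A))). hact ?p z \<in> elts (borel_cond M c)) \<longleftrightarrow>
      (\<forall>y\<in>XM - ucyl A. (\<lambda>n. y (\<pi> n)) \<in> bM c)" for A c
    unfolding elts_borel_cond by (auto simp: hact_hreal inj_image_mem_iff[OF injI])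
  have key: "p \<in> GM ?gx \<longleftrightarrow> (\<exists>q\<in>GM x. q \<in> elts Q \<and> rel p q)" for p
  proof (cases "\<exists>c\<in>codes_in M. p = borel_cond M c")
    case True
    then obtain c where c: "c \<in> codes_in M" "p = borel_cond M c" by blast
    have "rel p q \<longleftrightarrow> (\<forall>z\<in>elts q. hact ?p z \<in> elts (borel_cond M c))" for q
    proof -
      have "rel p q \<longleftrightarrow> (\<forall>z\<in>elts q. hact ?p z \<in> elts p)" using rel_iff[of p q] True by argo
      then show ?thesis unfolding c(2) .
    qed
    then have "(\<exists>q\<in>GM x. q \<in> elts Q \<and> rel p q) \<longleftrightarrow>
        (\<exists>A\<in>OM. borel_cond M (BCompl (ocode A)) \<in> GM x \<and> (\<forall>y\<in>XM - ucyl A. (\<lambda>n. y (\<pi> n)) \<in> bM c))"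
      unfolding Q hact_iff[symmetric] by blast
    then show ?thesis using elim c by blast
  next
    case False
    then show ?thesis unfolding random_filter_eq rel_iff pos_codes_def by blast
  qed
  show ?case
  proof
    fix v assume "v \<in> generic_extension M (GM ?gx)"
    then obtain t where t: "t \<in> M" "v = name_val (GM ?gx) t" unfolding generic_extension_def by blast
    have "name_val (GM x) (name_trans Q rel t) = name_val (GM ?gx) t"
      by (rule name_val_trans[where below = M]) (use key elts_in_M t in auto)
    moreover have "name_trans Q rel t \<in> M" using dft_in_M[OF dtr, of "\<lambda>_. t"] t(1) by auto
    ultimately show "v \<in> generic_extension M (GM x)" unfolding generic_extension_def t(2) by (metis imageI)
  qed
qed

text \<open>One inclusion of extensions at \<open>x\<close>, and the same at the permuted real,
  which the involution takes back to \<open>x\<close>.\<close>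

lemma involution_equiv_AE:
  assumes pi: "hseq (\<lambda>n. hnat (\<pi> n)) \<in> M" and inv: "\<And>n. \<pi> (\<pi> n) = n"
  shows "AE x in coin. (x, \<lambda>n. x (\<pi> n)) \<in> random_equiv M"
proof -
  have inj: "inj \<pi>" by (metis injI inv)
  show ?thesis
    using AE_random AE_permute[OF inj AE_random] permute_extension_AE[OF pi inj]
      AE_permute[OF inj permute_extension_AE[OF pi inj]]
    by eventually_elim (simp add: random_equiv_def inv subset_antisym)
qed

end

section \<open>Three free involutions\<close>

text \<open>The coordinates are indexed by pairs \<open>(w, j)\<close> of a hereditarily finite set and a natural number.
  The \<open>i\<close>-th involution swaps \<open>(w, j)\<close> and \<open>(w, j + 1)\<close> if \<open>(j, i)\<close> belongs to \<open>w\<close> and neither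
  neighbour \<open>(j - 1, i)\<close>, \<open>(j + 1, i)\<close> does. So a reduced word moves the coordinate \<open>(w, 0)\<close> to the far
  end of the path of any \<open>w\<close> that codes it.\<close>

definition hedge :: "hc \<Rightarrow> hc \<Rightarrow> hc \<Rightarrow> bool" where
  "hedge i w j \<longleftrightarrow> hpair j i \<in> elts w \<and> hpair (hsucc j) i \<notin> elts w \<and> (j = hnat 0 \<or> hpair (hUnion j) i \<notin> elts w)"

definition hstep :: "hc \<Rightarrow> hc \<Rightarrow> hc" where
  "hstep i z = (if z = hpair (hfst z) (hsnd z) \<and> hsnd z \<in> elts homega then
     if hedge i (hfst z) (hsnd z) then hpair (hfst z) (hsucc (hsnd z))
     else if hsnd z \<noteq> hnat 0 \<and> hedge i (hfst z) (hUnion (hsnd z)) then hpair (hfst z) (hUnion (hsnd z))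
     else z else z)"

lemma hedge_0: "hedge i w (hnat 0) \<longleftrightarrow> hpair (hnat 0) i \<in> elts w \<and> hpair (hnat 1) i \<notin> elts w"
  by (simp add: hedge_def)

lemma hedge_Suc: "hedge i w (hnat (Suc j)) \<longleftrightarrow> hpair (hnat (Suc j)) i \<in> elts w \<and>
    hpair (hnat (Suc (Suc j))) i \<notin> elts w \<and> hpair (hnat j) i \<notin> elts w"
  unfolding hedge_def hUnion_hsucc_hnat by (simp del: hnat.simps add: hnat.simps(2)[symmetric])

lemma hstep_0: "hstep i (hpair w (hnat 0)) = (if hedge i w (hnat 0) then hpair w (hnat 1) else hpair w (hnat 0))"
  unfolding hstep_def by (simp add: hnat.simps(2)[symmetric] del: hnat.simps)

lemma hstep_Suc: "hstep i (hpair w (hnat (Suc j))) =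
    (if hedge i w (hnat (Suc j)) then hpair w (hnat (Suc (Suc j)))
     else if hedge i w (hnat j) then hpair w (hnat j) else hpair w (hnat (Suc j)))"
  unfolding hstep_def by (simp add: hnat.simps(2)[symmetric] del: hnat.simps)

lemma hstep_other: "\<not> (z = hpair (hfst z) (hsnd z) \<and> hsnd z \<in> elts homega) \<Longrightarrow> hstep i z = z"
  unfolding hstep_def by (rule if_not_P)

lemma hedge_alternate: "hedge i w (hnat j) \<Longrightarrow> \<not> hedge i w (hnat (Suc j))"
  unfolding hedge_Suc by (simp add: hedge_def)

text \<open>Consecutive edges are never both active for the same letter
  (\<open>hedge_alternate\<close>), so the active edges form a matching.\<close>

lemma hstep_hstep: "hstep i (hstep i z) = z"
proof (cases "z = hpair (hfst z) (hsnd z) \<and> hsnd z \<in> elts homega")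
  case True
  then obtain w j where z: "z = hpair w (hnat j)" by auto
  show ?thesis
  proof (cases j)
    case 0
    have "hstep i (hpair w (hnat 1)) = hpair w (hnat 0)" if "hedge i w (hnat 0)"
      using hstep_Suc[of i w 0] hedge_alternate[OF that] that by (simp del: hnat.simps)
    then show ?thesis unfolding z 0 by (simp add: hstep_0 del: hnat.simps)
  next
    case (Suc k)
    have up: "hstep i (hpair w (hnat (Suc (Suc k)))) = hpair w (hnat (Suc k))" if "hedge i w (hnat (Suc k))"
      using hstep_Suc[of i w "Suc k"] hedge_alternate[OF that] that by (simp del: hnat.simps)
    have down: "hstep i (hpair w (hnat k)) = hpair w (hnat (Suc k))" if "hedge i w (hnat k)"
      using that by (cases k) (simp_all add: hstep_0 hstep_Suc del: hnat.simps)
    show ?thesis unfolding z Suc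
      using hedge_alternate by (auto simp: hstep_Suc up down simp del: hnat.simps)
  qed
next
  case False
  then show ?thesis using hstep_other by metis
qed

lemma hf_transitive: "x \<in> elts (hf_enum n) \<Longrightarrow> x \<in> range hf_enum"
proof (induction n rule: less_induct)
  case (less n)
  show ?case
  proof (cases n)
    case (Suc m)
    have "fst (pair_enum m) < n" using pair_enum_bound[of m] Suc by linarith
    then show ?thesis using less Suc by auto
  qed (use less in simp)
qed

lemma hf_hpair_iff: "hpair a b \<in> range hf_enum \<longleftrightarrow> a \<in> range hf_enum \<and> b \<in> range hf_enum"
proof
  assume "hpair a b \<in> range hf_enum"
  moreover have "hup a b \<in> elts (hpair a b)" by (simp add: elts_hpair)
  ultimately have "hup a b \<in> range hf_enum" using hf_transitive by (metis rangeE)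
  moreover have "a \<in> elts (hup a b)" "b \<in> elts (hup a b)" by simp_all
  ultimately show "a \<in> range hf_enum \<and> b \<in> range hf_enum" using hf_transitive by (metis rangeE)
qed (simp add: hf_hpair)

lemma hf_hstep:
  assumes "z \<in> range hf_enum" shows "hstep i z \<in> range hf_enum"
proof (cases "z = hpair (hfst z) (hsnd z) \<and> hsnd z \<in> elts homega")
  case True
  then obtain w j where z: "z = hpair w (hnat j)" by auto
  have "\<exists>k. hstep i z = hpair w (hnat k)"
    unfolding z by (cases j) (auto simp: hstep_0 hstep_Suc simp del: hnat.simps)
  then show ?thesis using assms hf_hnat unfolding z hf_hpair_iff by (metis hf_hpair_iff)
next
  case False
  then show ?thesis using assms hstep_other by metis
qed

section \<open>Words acting on the coordinates\<close>

definition hf_index :: "hc \<Rightarrow> nat" where "hf_index z = (LEAST n. hf_enum n = z)"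

lemma hf_enum_index: "z \<in> range hf_enum \<Longrightarrow> hf_enum (hf_index z) = z"
  unfolding hf_index_def by (rule LeastI_ex) auto

text \<open>As \<open>hf_enum\<close> repeats, the least index of a set stands for it; all other
  coordinates stay fixed.\<close>

definition flip :: "nat \<Rightarrow> nat \<Rightarrow> nat" where
  "flip i n = (if n = hf_index (hf_enum n) then hf_index (hstep (hnat i) (hf_enum n)) else n)"

lemma flip_index: "z \<in> range hf_enum \<Longrightarrow> flip i (hf_index z) = hf_index (hstep (hnat i) z)"
  by (simp add: flip_def hf_enum_index)

lemma flip_flip: "flip i (flip i n) = n"
proof (cases "n = hf_index (hf_enum n)")
  case True
  then have "flip i n = hf_index (hstep (hnat i) (hf_enum n))" by (simp add: flip_def)
  then have "flip i (flip i n) = hf_index (hstep (hnat i) (hstep (hnat i) (hf_enum n)))"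
    using flip_index[OF hf_hstep] by simp
  then show ?thesis using True by (simp add: hstep_hstep)
qed (simp add: flip_def)

text \<open>Normal forms in the free product of three groups of order 2.\<close>

definition reduced :: "nat list \<Rightarrow> bool" where
  "reduced w \<longleftrightarrow> set w \<subseteq> {..<3} \<and> (\<forall>j. Suc j < length w \<longrightarrow> w ! j \<noteq> w ! Suc j)"

primrec act :: "(nat \<Rightarrow> 'a \<Rightarrow> 'a) \<Rightarrow> nat list \<Rightarrow> 'a \<Rightarrow> 'a" where
  "act g [] x = x"
| "act g (i # w) x = g i (act g w x)"

abbreviation flip_real :: "nat \<Rightarrow> (nat \<Rightarrow> bool) \<Rightarrow> nat \<Rightarrow> bool" where
  "flip_real i x \<equiv> \<lambda>n. x (flip i n)"

text \<open>A letter \<open>3\<close> is added to the code of a word to obtain infinitely many disjoint paths.\<close>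

definition word_code :: "nat \<Rightarrow> nat list \<Rightarrow> hc" where
  "word_code k w = hset ((\<lambda>j. hpair (hnat j) (hnat (w ! j))) ` {..<length w} \<union> {hpair (hnat k) (hnat 3)})"

lemma elts_word_code: "elts (word_code k w) = (\<lambda>j. hpair (hnat j) (hnat (w ! j))) ` {..<length w} \<union> {hpair (hnat k) (hnat 3)}"
  unfolding word_code_def by (rule elts_hset) (simp add: countable_finite)

lemma hf_word_code: "word_code k w \<in> range hf_enum"
  unfolding word_code_def by (rule hf_finite) (auto simp del: hnat.simps intro!: hf_hpair hf_hnat)

lemma word_code_iff: "i < 3 \<Longrightarrow> hpair (hnat j) (hnat i) \<in> elts (word_code k w) \<longleftrightarrow> j < length w \<and> w ! j = i"
  unfolding elts_word_code by (auto simp del: hnat.simps)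

lemma word_code_inject: "set w \<subseteq> {..<3} \<Longrightarrow> word_code k w = word_code l w \<longleftrightarrow> k = l"
proof
  assume w: "set w \<subseteq> {..<3}" and eq: "word_code k w = word_code l w"
  have "hpair (hnat k) (hnat 3) \<in> elts (word_code l w)" unfolding eq[symmetric] elts_word_code by simp
  then show "k = l" unfolding elts_word_code using w nth_mem[of _ w] by (fastforce simp del: hnat.simps)
qed simp

text \<open>Adjacent letters of a reduced word differ, so no neighbour blocks the edge at
  \<open>j\<close>; the marker 3 cannot block it either, being none of the three letters.\<close>

lemma hstep_word_code:
  assumes "reduced w" "j < length w"
  shows "hstep (hnat (w ! j)) (hpair (word_code k w) (hnat j)) = hpair (word_code k w) (hnat (Suc j))"
proof -
  have i: "w ! j < 3" using assms nth_mem[of j w] unfolding reduced_def by blast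
  have r: "w ! l \<noteq> w ! Suc l" if "Suc l < length w" for l using assms(1) that unfolding reduced_def by blast
  have "hedge (hnat (w ! j)) (word_code k w) (hnat j)"
  proof (cases j)
    case 0
    then show ?thesis using assms(2) i r[of 0] by (auto simp: hedge_0 word_code_iff simp del: hnat.simps)
  next
    case (Suc l)
    then show ?thesis using assms(2) i r[of l] r[of j] by (auto simp: hedge_Suc word_code_iff simp del: hnat.simps)
  qed
  then show ?thesis by (cases j) (simp_all add: hstep_0 hstep_Suc del: hnat.simps)
qed

text \<open>The involutions act by precomposition, so at a given coordinate the head of the word is
  read first. Each letter moves the coordinate one step along the path.\<close>

lemma act_word_code:
  assumes w: "reduced w" and "v = drop j w" "j \<le> length w"
  shows "act flip_real v x (hf_index (hpair (word_code k w) (hnat j))) =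
    x (hf_index (hpair (word_code k w) (hnat (length w))))"
  using assms(2,3)
proof (induction v arbitrary: j)
  case Nil
  then have "j = length w" by simp
  then show ?case by simp
next
  case (Cons i v)
  have j: "j < length w" using Cons.prems by (metis drop_eq_Nil list.distinct(1) not_le)
  then have iv: "i = w ! j" "v = drop (Suc j) w" using Cons.prems(1) Cons_nth_drop_Suc[OF j] by (metis list.inject)+
  have "hpair (word_code k w) (hnat j) \<in> range hf_enum" by (intro hf_hpair hf_word_code hf_hnat)
  from flip_index[OF this, of i]
  have "flip i (hf_index (hpair (word_code k w) (hnat j))) = hf_index (hpair (word_code k w) (hnat (Suc j)))"
    unfolding iv(1) hstep_word_code[OF w j] .
  then show ?case using Cons.IH[OF iv(2)] j by simp
qed

text \<open>A fixed point agrees with itself at both ends of the path for every marker position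
  \<open>k\<close>. These are infinitely many disjoint pairs of coordinates, so such points form a
  null set.\<close>

lemma free_AE:
  assumes w: "reduced w" "w \<noteq> []"
  shows "AE x in coin. act flip_real w x \<noteq> x"
proof -
  define a where "a k = hf_index (hpair (word_code k w) (hnat 0))" for k
  define b where "b k = hf_index (hpair (word_code k w) (hnat (length w)))" for k
  have set: "set w \<subseteq> {..<3}" using w unfolding reduced_def by blast
  have hf: "hpair (word_code k w) (hnat j) \<in> range hf_enum" for k j by (intro hf_hpair hf_word_code hf_hnat)
  have inj: "hf_index (hpair (word_code k w) (hnat j)) = hf_index (hpair (word_code l w) (hnat i)) \<longleftrightarrow> k = l \<and> j = i" for k l j i
    using hf_enum_index[OF hf[of k j]] hf_enum_index[OF hf[of l i]] word_code_inject[OF set]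
    by (metis hnat_inject hpair_inject)
  let ?N = "{x :: nat \<Rightarrow> bool. \<forall>k. x (a k) = x (b k)}"
  have "Measurable.pred coin (\<lambda>x. \<forall>k. x (a k) = x (b k))"
    unfolding coin_def by measurable
  then have sN: "?N \<in> sets borel" by (simp add: pred_def)
  have "mu ?N \<le> (1 / 2) ^ n" for n
  proof -
    have "Measurable.pred coin (\<lambda>x. \<forall>k\<in>{..<n}. x (a k) = x (b k))"
      unfolding coin_def by measurable
    then have "{x \<in> space coin. \<forall>k\<in>{..<n}. x (a k) = x (b k)} \<in> sets coin" unfolding pred_def .
    moreover have "{x \<in> space coin. \<forall>k\<in>{..<n}. x (a k) = x (b k)} = {x :: nat \<Rightarrow> bool. \<forall>k<n. x (a k) = x (b k)}" by auto
    ultimately have s: "{x :: nat \<Rightarrow> bool. \<forall>k<n. x (a k) = x (b k)} \<in> sets borel" by (simp only: sets_coin)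
    have "mu ?N \<le> mu {x. \<forall>k<n. x (a k) = x (b k)}" by (rule mu_mono[OF _ s]) auto
    also have "\<dots> \<le> (1 / 2) ^ n"
      by (rule mu_coincidences) (use w(2) in \<open>auto simp: inj_on_def a_def b_def inj simp del: hnat.simps\<close>)
    finally show ?thesis .
  qed
  then have "mu ?N = 0" using le_zero_if_small measure_nonneg[of coin ?N] by (meson order_antisym)
  then have "AE x in coin. x \<notin> ?N" using sN by (rule AE_coin_not[rotated])
  then show ?thesis
  proof eventually_elim
    case (elim x)
    have "act flip_real w x (a k) = x (b k)" for k
      unfolding a_def b_def using act_word_code[OF w(1), of w 0] by simp
    then show ?case using elim by auto
  qed
qed

context ctm
begin

lemma flip_in_M: "hseq (\<lambda>n. hnat (flip i n)) \<in> M"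
proof -
  let ?H = "hseq hf_enum"
  \<comment> \<open>The least index of \<open>z\<close>, described as the union of the singleton
    that contains it.\<close>
  define hidx where "hidx z = hUnion (hset {n \<in> elts homega. happ ?H n = z \<and> (\<forall>m\<in>elts n. happ ?H m \<noteq> z)})" for z
  have d: "dft (\<lambda>e. hidx (e 0))"
    unfolding hidx_def by (intro dfn_intros dft_const hf_enum_in_M homega_in_M)
  have hidx: "hidx z = hnat (hf_index z)" if "z \<in> range hf_enum" for z
  proof -
    have "hf_enum n = z \<and> (\<forall>m<n. hf_enum m \<noteq> z) \<longleftrightarrow> n = hf_index z" for n
    proof
      assume "hf_enum n = z \<and> (\<forall>m<n. hf_enum m \<noteq> z)"
      then show "n = hf_index z" unfolding hf_index_def
        by (intro Least_equality[symmetric]) (auto simp: not_less[symmetric])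
    next
      assume "n = hf_index z"
      then show "hf_enum n = z \<and> (\<forall>m<n. hf_enum m \<noteq> z)"
        using hf_enum_index[OF that] not_less_Least unfolding hf_index_def by blast
    qed
    moreover have "(\<forall>m\<in>elts (hnat n). happ ?H m \<noteq> z) \<longleftrightarrow> (\<forall>m<n. hf_enum m \<noteq> z)" for n
      unfolding elts_hnat by auto
    then have "{n \<in> elts homega. happ ?H n = z \<and> (\<forall>m\<in>elts n. happ ?H m \<noteq> z)} =
        {hnat n | n. hf_enum n = z \<and> (\<forall>m<n. hf_enum m \<noteq> z)}" by auto
    ultimately have "{n \<in> elts homega. happ ?H n = z \<and> (\<forall>m\<in>elts n. happ ?H m \<noteq> z)} = {hnat (hf_index z)}"
      by simp
    then show ?thesis by (simp only: hidx_def hUnion_singleton)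
  qed
  show ?thesis
  proof (rule hseqI)
    show "dft (\<lambda>e. if e 0 = hidx (happ ?H (e 0)) then hidx (hstep (hnat i) (happ ?H (e 0))) else e 0)"
      unfolding hstep_def hedge_def
      by (intro dfn_intros dft_subst1[OF d] dft_const hf_enum_in_M homega_in_M hnat_in_M)
    show "hnat (flip i n) = (if hnat n = hidx (happ ?H (hnat n)) then hidx (hstep (hnat i) (happ ?H (hnat n))) else hnat n)" for n
      unfolding happ_hseq hidx[OF rangeI] hidx[OF hf_hstep[OF rangeI]] hnat_inject flip_def by (rule if_distrib)
  qed
qed

end

section \<open>Free measure-preserving involutions obstruct amenability\<close>

lemma reduced_iff: "reduced w \<longleftrightarrow> set w \<subseteq> {..<3} \<and> distinct_adj w"
  by (simp add: reduced_def distinct_adj_conv_nth)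

lemma act_append: "act g (u @ v) x = act g u (act g v x)"
  by (induction u) simp_all

text \<open>An upper bound for the limes superior along an iterated Frechet filter, for which the reverse
  Fatou lemma survives.\<close>

lemma frechet_fatou:
  assumes "frechet_iterate \<alpha> \<F>" "\<And>n. h n \<in> borel_measurable coin" "\<And>n x. h n x \<le> (2 :: ennreal)"
  shows "\<exists>H\<in>borel_measurable coin. (\<forall>x y. eventually (\<lambda>n. h n x \<le> y) \<F> \<longrightarrow> H x \<le> y) \<and>
    (\<forall>y. (\<integral>\<^sup>+x. H x \<partial>coin) < y \<longrightarrow> eventually (\<lambda>n. (\<integral>\<^sup>+x. h n x \<partial>coin) < y) \<F>)"
proof -
  have base: "\<exists>H\<in>borel_measurable coin. (\<forall>x y. eventually (\<lambda>n. h n x \<le> y) sequentially \<longrightarrow> H x \<le> y) \<and>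
    (\<forall>y. (\<integral>\<^sup>+x. H x \<partial>coin) < y \<longrightarrow> eventually (\<lambda>n. (\<integral>\<^sup>+x. h n x \<partial>coin) < y) sequentially)"
    if [measurable]: "\<And>n. h n \<in> borel_measurable coin" and h: "\<And>n x. h n x \<le> (2 :: ennreal)" for h
  proof (intro bexI[of _ "\<lambda>x. limsup (\<lambda>n. h n x)"] conjI allI impI)
    fix x y assume "eventually (\<lambda>n. h n x \<le> y) sequentially"
    then show "limsup (\<lambda>n. h n x) \<le> y" by (rule Limsup_bounded)
  next
    fix y assume y: "(\<integral>\<^sup>+x. limsup (\<lambda>n. h n x) \<partial>coin) < y"
    have "limsup (\<lambda>n. \<integral>\<^sup>+x. h n x \<partial>coin) \<le> (\<integral>\<^sup>+x. limsup (\<lambda>n. h n x) \<partial>coin)"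
    proof (rule nn_integral_limsup[where w = "\<lambda>_. 2"])
      show "(\<integral>\<^sup>+x. 2 \<partial>coin) < \<infinity>" by (simp add: coin.emeasure_space_1[simplified])
    qed (use h in auto)
    then have "limsup (\<lambda>n. \<integral>\<^sup>+x. h n x \<partial>coin) < y" using y by simp
    then show "eventually (\<lambda>n. (\<integral>\<^sup>+x. h n x \<partial>coin) < y) sequentially" by (rule Limsup_lessD)
  qed measurable
  have sum: "\<exists>H\<in>borel_measurable coin. (\<forall>x y. eventually (\<lambda>n. h n x \<le> y) (frechet_sum \<F>) \<longrightarrow> H x \<le> y) \<and>
    (\<forall>y. (\<integral>\<^sup>+x. H x \<partial>coin) < y \<longrightarrow> eventually (\<lambda>n. (\<integral>\<^sup>+x. h n x \<partial>coin) < y) (frechet_sum \<F>))"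
    if IH: "\<And>m h. (\<And>n. h n \<in> borel_measurable coin) \<Longrightarrow> (\<And>n x. h n x \<le> (2 :: ennreal)) \<Longrightarrow>
      \<exists>H\<in>borel_measurable coin. (\<forall>x y. eventually (\<lambda>n. h n x \<le> y) (\<F> m) \<longrightarrow> H x \<le> y) \<and>
      (\<forall>y. (\<integral>\<^sup>+x. H x \<partial>coin) < y \<longrightarrow> eventually (\<lambda>n. (\<integral>\<^sup>+x. h n x \<partial>coin) < y) (\<F> m))"
    and h: "\<And>n. h n \<in> borel_measurable coin" "\<And>n x. h n x \<le> (2 :: ennreal)" for h and \<F> :: "nat \<Rightarrow> nat filter"
  proof -
    define Q where "Q m H \<longleftrightarrow> H \<in> borel_measurable coin \<and>
      (\<forall>x y. eventually (\<lambda>n. h (prod_encode (m, n)) x \<le> y) (\<F> m) \<longrightarrow> H x \<le> y) \<and>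
      (\<forall>y. (\<integral>\<^sup>+x. H x \<partial>coin) < y \<longrightarrow>
        eventually (\<lambda>n. (\<integral>\<^sup>+x. h (prod_encode (m, n)) x \<partial>coin) < y) (\<F> m))" for m H
    have "\<exists>H. Q m H" for m
      using IH[where m = m and h = "\<lambda>n. h (prod_encode (m, n))", OF h] unfolding Q_def by blast
    then obtain H where "\<And>m. Q m (H m)" by metis
    then have H: "\<And>m. H m \<in> borel_measurable coin"
      "\<And>m x y. eventually (\<lambda>n. h (prod_encode (m, n)) x \<le> y) (\<F> m) \<Longrightarrow> H m x \<le> y"
      "\<And>m y. (\<integral>\<^sup>+x. H m x \<partial>coin) < y \<Longrightarrow>
        eventually (\<lambda>n. (\<integral>\<^sup>+x. h (prod_encode (m, n)) x \<partial>coin) < y) (\<F> m)"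
      unfolding Q_def by blast+
    \<comment> \<open>The first property hands the bound 2 on to \<open>H m\<close>, so the base
      case applies to the sequence of the \<open>H m\<close>.\<close>
    have H2: "H m x \<le> 2" for m x by (rule H(2)) (simp add: h(2))
    obtain K where K: "K \<in> borel_measurable coin"
      "\<And>x y. eventually (\<lambda>m. H m x \<le> y) sequentially \<Longrightarrow> K x \<le> y"
      "\<And>y. (\<integral>\<^sup>+x. K x \<partial>coin) < y \<Longrightarrow> eventually (\<lambda>m. (\<integral>\<^sup>+x. H m x \<partial>coin) < y) sequentially"
      using base[where h = H, OF H(1) H2] by blast
    show ?thesis
    proof (intro bexI[OF _ K(1)] conjI allI impI)
      fix x y assume "eventually (\<lambda>n. h n x \<le> y) (frechet_sum \<F>)"
      then have "eventually (\<lambda>m. eventually (\<lambda>n. h (prod_encode (m, n)) x \<le> y) (\<F> m)) sequentially"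
        unfolding eventually_frechet_sum .
      then have "eventually (\<lambda>m. H m x \<le> y) sequentially" by (rule eventually_mono) (rule H(2))
      then show "K x \<le> y" by (rule K(2))
    next
      fix y assume "(\<integral>\<^sup>+x. K x \<partial>coin) < y"
      then have "eventually (\<lambda>m. (\<integral>\<^sup>+x. H m x \<partial>coin) < y) sequentially" by (rule K(3))
      then show "eventually (\<lambda>n. (\<integral>\<^sup>+x. h n x \<partial>coin) < y) (frechet_sum \<F>)"
        unfolding eventually_frechet_sum by (rule eventually_mono) (rule H(3))
    qed
  qed
  show ?thesis
    using assms
  proof (induction arbitrary: h rule: frechet_iterate.induct)
    case one
    then show ?case by (intro base)
  next
    case (succ \<alpha> \<F>)
    show ?case by (rule sum[OF succ.IH succ.prems])
  next
    case (lim \<alpha> \<F>)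
    show ?case by (rule sum[OF lim.IH lim.prems])
  qed
qed

text \<open>Lets a statement that holds eventually along the filter produce an actual index.\<close>

lemma frechet_iterate_nontrivial: "frechet_iterate \<alpha> \<F> \<Longrightarrow> \<F> \<noteq> bot"
proof (induction rule: frechet_iterate.induct)
  case (succ \<alpha> \<F>)
  then show ?case by (simp add: trivial_limit_def eventually_frechet_sum)
next
  case (lim \<alpha> \<F>)
  then show ?case by (simp add: trivial_limit_def eventually_frechet_sum)
qed simp

lemma pred_eq_coin:
  assumes "F \<in> N \<rightarrow>\<^sub>M coin" "G \<in> N \<rightarrow>\<^sub>M coin"
  shows "Measurable.pred N (\<lambda>\<omega>. F \<omega> = G \<omega>)"
proof -
  have "Measurable.pred N (\<lambda>\<omega>. F \<omega> n = G \<omega> n)" for n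
  proof -
    have c: "(\<lambda>x. x n) \<in> coin \<rightarrow>\<^sub>M count_space UNIV"
      unfolding coin_def using measurable_component_singleton[of n UNIV "\<lambda>_. measure_pmf (bernoulli_pmf (1 / 2))"]
      by (simp add: measurable_cong_sets)
    show ?thesis
      using measurable_compose[OF assms(1) c] measurable_compose[OF assms(2) c] by (intro pred_intros_logic)
  qed
  then show ?thesis unfolding fun_eq_iff by (intro pred_intros_countable)
qed

lemma measurable_pair_borel:
  assumes "F \<in> N \<rightarrow>\<^sub>M coin" "G \<in> N \<rightarrow>\<^sub>M coin"
  shows "(\<lambda>\<omega>. (F \<omega>, G \<omega>)) \<in> N \<rightarrow>\<^sub>M (borel :: ((nat \<Rightarrow> bool) \<times> (nat \<Rightarrow> bool)) measure)"
proof -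
  have "F \<in> N \<rightarrow>\<^sub>M borel" "G \<in> N \<rightarrow>\<^sub>M borel" using assms unfolding measurable_cong_sets[OF refl sets_coin] .
  then show ?thesis by (rule borel_measurable_Pair)
qed

text \<open>The maps \<open>T k\<close> may leave the class of a point; they only have to exhaust
  it. In the application they decode all names of the model.\<close>

locale countable_borel_equiv =
  fixes X :: "(nat \<Rightarrow> bool) set" and E :: "((nat \<Rightarrow> bool) \<times> (nat \<Rightarrow> bool)) set"
    and T :: "nat \<Rightarrow> (nat \<Rightarrow> bool) \<Rightarrow> nat \<Rightarrow> bool"
  assumes equiv_E: "equiv X E" and X_borel: "X \<in> sets borel" and E_borel: "E \<in> sets borel"
    and T_measurable: "\<And>k. T k \<in> coin \<rightarrow>\<^sub>M coin"
    and T_onto: "\<And>x y. (x, y) \<in> E \<Longrightarrow> \<exists>k. T k x = y"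
begin

text \<open>Keeping first occurrences only, \<open>k\<close> enumerates the class without
  repetition. The relation is a parameter because finite subrelations are counted in the same
  way.\<close>

definition idx :: "((nat \<Rightarrow> bool) \<times> (nat \<Rightarrow> bool)) set \<Rightarrow> (nat \<Rightarrow> bool) \<Rightarrow> nat set" where
  "idx R x = {k. (x, T k x) \<in> R \<and> (\<forall>j<k. T j x \<noteq> T k x)}"

text \<open>A sum over the class of \<open>x\<close>, written as a series over \<open>\<nat>\<close> in order to have measurability in \<open>x\<close>.\<close>

definition csum :: "(nat \<Rightarrow> bool) \<Rightarrow> ((nat \<Rightarrow> bool) \<Rightarrow> ennreal) \<Rightarrow> ennreal" where
  "csum x h = (\<Sum>k. if k \<in> idx E x then h (T k x) else 0)"

lemma idx_bij: "R \<subseteq> E \<Longrightarrow> bij_betw (\<lambda>k. T k x) (idx R x) (R `` {x})"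
proof -
  assume R: "R \<subseteq> E"
  have "inj_on (\<lambda>k. T k x) (idx R x)"
  proof (rule inj_onI)
    fix i j assume ij: "i \<in> idx R x" "j \<in> idx R x" "T i x = T j x"
    then have "\<not> i < j" "\<not> j < i" unfolding idx_def mem_Collect_eq by metis+
    then show "i = j" by simp
  qed
  moreover have "y \<in> (\<lambda>k. T k x) ` idx R x" if y: "(x, y) \<in> R" for y
  proof -
    obtain k where "T k x = y" using T_onto y R by blast
    define j where "j = (LEAST k. T k x = y)"
    have L: "T j x = y" unfolding j_def by (rule LeastI[of "\<lambda>k. T k x = y", OF \<open>T k x = y\<close>])
    have "T i x \<noteq> T j x" if "i < j" for i
      unfolding L using that not_less_Least[of i "\<lambda>k. T k x = y"] unfolding j_def by blast
    then have "j \<in> idx R x" using y L unfolding idx_def by simp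
    then show ?thesis using L by (metis imageI)
  qed
  moreover have "T k x \<in> R `` {x}" if "k \<in> idx R x" for k using that unfolding idx_def by simp
  ultimately show ?thesis unfolding bij_betw_def by (intro conjI subset_antisym image_subsetI subsetI) auto
qed

lemma pred_E:
  assumes "F \<in> N \<rightarrow>\<^sub>M coin" "G \<in> N \<rightarrow>\<^sub>M coin" "R \<in> sets borel"
  shows "Measurable.pred N (\<lambda>\<omega>. (F \<omega>, G \<omega>) \<in> R)"
  by (rule pred_sets2[OF assms(3) measurable_pair_borel[OF assms(1,2)]])

lemma pred_idx: "R \<in> sets borel \<Longrightarrow> Measurable.pred coin (\<lambda>x. k \<in> idx R x)"
  unfolding idx_def mem_Collect_eq
  by (intro pred_intros pred_intros_countable pred_E pred_eq_coin T_measurable pred_constant measurable_ident_sets) simp_all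

lemma E_sym: "(x, y) \<in> E \<Longrightarrow> (y, x) \<in> E" and E_trans: "(x, y) \<in> E \<Longrightarrow> (y, z) \<in> E \<Longrightarrow> (x, z) \<in> E"
  and E_X: "(x, y) \<in> E \<Longrightarrow> x \<in> X"
  using equiv_E unfolding equiv_def sym_def trans_def refl_on_def by blast+

text \<open>The series depends on the enumeration that starts from \<open>x\<close>, the integral
  only on the class; this is the reason for \<open>csum_class\<close>.\<close>

lemma csum_eq_integral: "csum x h = (\<integral>\<^sup>+z. h z \<partial>count_space (E `` {x}))"
proof -
  have "(\<integral>\<^sup>+z. h z \<partial>count_space (E `` {x})) = (\<integral>\<^sup>+k. h (T k x) \<partial>count_space (idx E x))"
    by (rule nn_integral_bij_count_space[symmetric]) (rule idx_bij[OF order_refl])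
  also have "\<dots> = (\<integral>\<^sup>+k. (if k \<in> idx E x then h (T k x) else 0) \<partial>count_space (idx E x))"
    by (rule nn_integral_cong) simp
  also have "\<dots> = (\<integral>\<^sup>+k. (if k \<in> idx E x then h (T k x) else 0) \<partial>count_space UNIV)"
    by (rule nn_integral_count_space_eq) auto
  finally show ?thesis unfolding csum_def nn_integral_count_space_nat ..
qed

lemma csum_class: "(x, y) \<in> E \<Longrightarrow> csum x h = csum y h"
  unfolding csum_eq_integral using equiv_class_eq[OF equiv_E] by metis

lemma csum_mono: "(\<And>z. (x, z) \<in> E \<Longrightarrow> h z \<le> h' z) \<Longrightarrow> csum x h \<le> csum x h'"
  unfolding csum_eq_integral by (intro nn_integral_mono) simp

lemma csum_add: "csum x (\<lambda>z. h z + h' z) = csum x h + csum x h'"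
  unfolding csum_eq_integral by (intro nn_integral_add) simp_all

lemma csum_has_sum:
  assumes "(h has_sum s) (E `` {x})" "\<And>z. (x, z) \<in> E \<Longrightarrow> 0 \<le> h z"
  shows "csum x (\<lambda>z. ennreal (h z)) = ennreal s"
proof -
  have "((\<lambda>k. h (T k x)) has_sum s) (idx E x)"
    using has_sum_reindex_bij_betw[OF idx_bij[OF order_refl], of h] assms(1) by blast
  then have "((\<lambda>k. if k \<in> idx E x then h (T k x) else 0) has_sum s) UNIV"
    by (subst (asm) has_sum_cong_neutral[where T = UNIV and g = "\<lambda>k. if k \<in> idx E x then h (T k x) else 0"]) auto
  then have "(\<lambda>k. if k \<in> idx E x then h (T k x) else 0) sums s" by (rule has_sum_imp_sums)
  then have "(\<Sum>k. ennreal (if k \<in> idx E x then h (T k x) else 0)) = ennreal s"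
    by (intro suminf_ennreal_eq) (use assms(2) in \<open>auto simp: idx_def\<close>)
  moreover have "ennreal (if k \<in> idx E x then h (T k x) else 0) = (if k \<in> idx E x then ennreal (h (T k x)) else 0)" for k
    by simp
  ultimately show ?thesis unfolding csum_def by simp
qed

text \<open>The uniform distributions on the finite \<open>F n\<close>-classes work: equivalent
  points have the same class from some stage on, so the distance is eventually 0.\<close>

lemma hyperfinite_imp_amenable:
  assumes "hyperfinite_on X E" shows "amenable_wrt sequentially X E"
proof -
  obtain F :: "nat \<Rightarrow> ((nat \<Rightarrow> bool) \<times> (nat \<Rightarrow> bool)) set" where
    F: "\<And>n. equiv X (F n)" "\<And>n. F n \<in> sets (restrict_space borel (X \<times> X))"
      "\<And>n x. x \<in> X \<Longrightarrow> finite (F n `` {x})" "\<And>n. F n \<subseteq> F (Suc n)" and E: "E = (\<Union>n. F n)"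
    using assms unfolding hyperfinite_on_def by auto
  have sF: "F n \<in> sets borel" for n
  proof -
    have "X \<times> X \<in> sets borel"
      using pair_measureI[OF X_borel X_borel] unfolding borel_prod .
    then show ?thesis using F(2)[of n] by (simp add: sets_restrict_space_iff)
  qed
  have FE: "F n \<subseteq> E" for n using E by blast
  \<comment> \<open>The size of the finite class, written as a series over indices so that it is
    Borel in \<open>x\<close>.\<close>
  define c where "c n x = (\<Sum>k. if k \<in> idx (F n) x then 1 else 0 :: ennreal)" for n x
  have cm: "c n \<in> borel_measurable coin" for n
  proof -
    have "(\<lambda>x. if k \<in> idx (F n) x then 1 else 0 :: ennreal) \<in> borel_measurable coin" for k
      by (rule measurable_If) (use pred_idx[OF sF] in \<open>simp_all add: pred_def\<close>)
    then show ?thesis unfolding c_def by (rule borel_measurable_suminf_order)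
  qed
  have c: "c n x = ennreal (card (F n `` {x}))" if "x \<in> X" for n x
  proof -
    have fin: "finite (idx (F n) x)" using bij_betw_finite[OF idx_bij[OF FE]] F(3)[OF that] by blast
    have "c n x = (\<Sum>k\<in>idx (F n) x. if k \<in> idx (F n) x then 1 else 0)"
      unfolding c_def by (rule suminf_finite[OF fin]) auto
    also have "\<dots> = of_nat (card (idx (F n) x))" by simp
    also have "card (idx (F n) x) = card (F n `` {x})" by (rule bij_betw_same_card[OF idx_bij[OF FE]])
    finally show ?thesis by (simp add: ennreal_of_nat_eq_real_of_nat)
  qed
  define f where "f n p = indicator (F n) p / enn2real (c n (fst p))" for n and p :: "(nat \<Rightarrow> bool) \<times> (nat \<Rightarrow> bool)"
  have fval: "f n (x, z) = (if (x, z) \<in> F n then 1 / card (F n `` {x}) else 0)" if "x \<in> X" for n x z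
    unfolding f_def using c[OF that] by (simp add: indicator_def)
  have self: "(x, x) \<in> F n" if "x \<in> X" for n x using F(1)[of n] that unfolding equiv_def refl_on_def by blast
  show ?thesis unfolding amenable_wrt_def
  proof (intro exI[of _ f] conjI allI ballI)
    fix n
    have "fst \<in> (borel :: ((nat \<Rightarrow> bool) \<times> (nat \<Rightarrow> bool)) measure) \<rightarrow>\<^sub>M coin"
      using borel_measurable_continuous_onI[OF continuous_on_fst[OF continuous_on_id]]
      by (simp add: measurable_cong_sets[OF refl sets_coin])
    then have "(\<lambda>p :: (nat \<Rightarrow> bool) \<times> (nat \<Rightarrow> bool). c n (fst p)) \<in> borel_measurable borel" by (rule measurable_compose[OF _ cm])
    then show "f n \<in> borel_measurable (restrict_space borel E)"
      unfolding f_def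
      by (intro measurable_restrict_space1 borel_measurable_divide borel_measurable_indicator sF)
        (rule borel_measurable_enn2real)
    show "0 \<le> f n p" for p unfolding f_def by simp
  next
    fix n x assume x: "x \<in> X"
    let ?S = "F n `` {x}"
    have "((\<lambda>z. f n (x, z)) has_sum (\<Sum>z\<in>?S. f n (x, z))) ?S" by (rule has_sum_finite[OF F(3)[OF x]])
    also have "(\<Sum>z\<in>?S. f n (x, z)) = (\<Sum>z\<in>?S. 1 / card ?S)" by (rule sum.cong) (auto simp: fval[OF x])
    also have "\<dots> = 1" using F(3)[OF x] self[OF x] by (auto simp: card_gt_0_iff)
    finally show "((\<lambda>z. f n (x, z)) has_sum 1) (E `` {x})"
      by (subst has_sum_cong_neutral[where T = ?S and g = "\<lambda>z. f n (x, z)"]) (use FE in \<open>auto simp: fval[OF x]\<close>)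
  next
    fix p assume p: "p \<in> E"
    obtain x y where xy: "p = (x, y)" by (cases p)
    obtain m where m: "(x, y) \<in> F m" using p xy E by blast
    have X: "x \<in> X" "y \<in> X" using p xy E_X E_sym by blast+
    have "eventually (\<lambda>n. (\<Sum>\<^sub>\<infinity>z\<in>E `` {x}. \<bar>f n (x, z) - f n (y, z)\<bar>) = 0) sequentially"
    proof (rule eventually_sequentiallyI[of m])
      fix n assume "m \<le> n"
      then have "F m \<subseteq> F n" using F(4) by (rule lift_Suc_mono_le[rotated])
      then have "(x, y) \<in> F n" using m by blast
      then have "F n `` {x} = F n `` {y}" by (rule equiv_class_eq[OF F(1)])
      then have "f n (x, z) = f n (y, z)" for z unfolding fval[OF X(1)] fval[OF X(2)] by auto
      then show "(\<Sum>\<^sub>\<infinity>z\<in>E `` {x}. \<bar>f n (x, z) - f n (y, z)\<bar>) = 0" by (simp add: infsum_0)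
    qed
    then show "case p of (x, y) \<Rightarrow> ((\<lambda>n. \<Sum>\<^sub>\<infinity>z\<in>E `` {x}. \<bar>f n (x, z) - f n (y, z)\<bar>) \<longlongrightarrow> 0) sequentially"
      unfolding xy prod.case by (rule tendsto_eventually)
  qed
qed

end

section \<open>The counting argument for three free involutions\<close>

locale free_involutions = countable_borel_equiv +
  fixes g :: "nat \<Rightarrow> (nat \<Rightarrow> bool) \<Rightarrow> nat \<Rightarrow> bool"
  assumes g_measurable: "\<And>i. g i \<in> coin \<rightarrow>\<^sub>M coin" and g_distr: "\<And>i. distr coin coin (g i) = coin"
    and g_invol: "\<And>i x. g i (g i x) = x" and g_E: "\<And>i. AE x in coin. (x, g i x) \<in> E"
    and g_free: "\<And>w. reduced w \<Longrightarrow> w \<noteq> [] \<Longrightarrow> AE x in coin. act g w x \<noteq> x"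
begin

definition free_at :: "(nat \<Rightarrow> bool) \<Rightarrow> bool" where
  "free_at x \<longleftrightarrow> (\<forall>w. reduced w \<and> w \<noteq> [] \<longrightarrow> act g w x \<noteq> x)"

lemma AE_free_at: "AE x in coin. free_at x"
  unfolding free_at_def AE_all_countable using g_free by auto

lemma act_rev: "act g (rev w) (act g w x) = x"
  by (induction w arbitrary: x) (simp_all add: act_append g_invol)

lemma act_measurable: "act g w \<in> coin \<rightarrow>\<^sub>M coin"
proof (induction w)
  case Nil
  show ?case using measurable_ident by (simp add: id_def)
next
  case (Cons i w)
  have "act g (i # w) = (\<lambda>x. g i (act g w x))" by (rule ext) simp
  then show ?case using measurable_compose[OF Cons g_measurable[of i]] by (simp only:)
qed

lemma reduced_snoc: "reduced (w @ [i]) \<longleftrightarrow> reduced w \<and> i < 3 \<and> (w = [] \<or> last w \<noteq> i)"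
  unfolding reduced_iff by (auto simp: distinct_adj_append_iff)

text \<open>Freeness only speaks of fixed points. After common heads are cancelled, the reversal of
  one word followed by the other is reduced and fixes \<open>x\<close>.\<close>

lemma act_inj:
  assumes "free_at x" "reduced u" "reduced v" "act g u x = act g v x" shows "u = v"
  using assms(2-)
proof (induction u arbitrary: v)
  case Nil
  then show ?case using assms(1) unfolding free_at_def by (metis act.simps(1))
next
  case (Cons a u)
  show ?case
  proof (cases v)
    case Nil
    then show ?thesis using assms(1) Cons.prems unfolding free_at_def by (metis act.simps(1))
  next
    case v: (Cons b v')
    show ?thesis
    proof (cases "a = b")
      case True
      have "act g u x = act g v' x" using Cons.prems(3) unfolding v True act.simps by (metis g_invol)
      moreover have "reduced u" "reduced v'"
        using Cons.prems(1,2) unfolding v reduced_iff by (auto dest: distinct_adj_ConsD)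
      ultimately show ?thesis using Cons.IH[of v'] v True by simp
    next
      case False
      have "act g (rev v @ a # u) x = x" unfolding act_append Cons.prems(3) act_rev ..
      moreover have "reduced (rev v @ a # u)"
        using Cons.prems(1,2) False last_rev[of v] unfolding v reduced_iff
        by (auto simp: distinct_adj_append_iff simp del: rev.simps)
      ultimately show ?thesis using assms(1) unfolding free_at_def by blast
    qed
  qed
qed

definition orb :: "(nat \<Rightarrow> bool) \<Rightarrow> (nat \<Rightarrow> bool) set" where
  "orb x = {act g w x | w. reduced w}"

text \<open>The class of \<open>x\<close> splits into free orbits. Each element \<open>z\<close> determines a point of the orbit of \<open>x\<close>,
  namely the first \<open>T m z\<close> that lies there, and \<open>z\<close> belongs to the \<open>i\<close>-th piece if the reduced word that
  leads from \<open>x\<close> to this point ends with \<open>i\<close>.\<close>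

definition piece :: "nat \<Rightarrow> (nat \<Rightarrow> bool) \<Rightarrow> (nat \<Rightarrow> bool) \<Rightarrow> bool" where
  "piece i x z \<longleftrightarrow> (\<exists>m. (\<exists>w. reduced (w @ [i]) \<and> T m z = act g (w @ [i]) x) \<and>
    (\<forall>j<m. \<forall>w. reduced w \<longrightarrow> T j z \<noteq> act g w x))"

text \<open>Changing the base point from \<open>x\<close> to \<open>g i x\<close> cancels a final
  letter \<open>i\<close> or appends one.\<close>

lemma act_invol_cases:
  assumes "i < 3" "reduced w" obtains v where "reduced v" "act g w x = act g v (g i x)"
proof (cases "w \<noteq> [] \<and> last w = i")
  case True
  then obtain v where w: "w = v @ [i]" by (metis append_butlast_last_id)
  then show thesis using that[of v] assms(2) by (simp add: reduced_snoc act_append)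
next
  case False
  then have "reduced (w @ [i])" using assms by (auto simp: reduced_snoc)
  moreover have "act g w x = act g (w @ [i]) (g i x)" by (simp add: act_append g_invol)
  ultimately show thesis by (rule that)
qed

lemma orb_invol: "i < 3 \<Longrightarrow> orb (g i x) = orb x"
proof -
  assume i: "i < 3"
  have sub: "orb y \<subseteq> orb (g i y)" for y
  proof
    fix z assume "z \<in> orb y"
    then obtain w where w: "reduced w" "z = act g w y" unfolding orb_def by blast
    obtain v where "reduced v" "act g w y = act g v (g i y)" using act_invol_cases[OF i w(1)] .
    then show "z \<in> orb (g i y)" unfolding orb_def w(2) by blast
  qed
  show ?thesis using sub[of x] sub[of "g i x"] unfolding g_invol by (rule subset_antisym[rotated])
qed

text \<open>The points \<open>x\<close> and \<open>g i x\<close> have the same orbit, hence select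
  the same point \<open>T m z\<close>. If the word that leads there from \<open>x\<close> does not
  end with \<open>i\<close>, the word from \<open>g i x\<close> does.\<close>

lemma piece_cover:
  assumes "i < 3" "(x, z) \<in> E" shows "piece i x z \<or> piece i (g i x) z"
proof -
  \<comment> \<open>The search along the enumeration from \<open>z\<close> reaches the orbit, since
    \<open>x\<close> itself occurs in it.\<close>
  obtain k where "T k z = x" using T_onto[OF E_sym[OF assms(2)]] by blast
  moreover have "x \<in> orb x" unfolding orb_def using reduced_iff[of "[]"] by (auto intro!: exI[of _ "[]"])
  ultimately have ex: "T k z \<in> orb x" by simp
  define m where "m = (LEAST k. T k z \<in> orb x)"
  have m: "T m z \<in> orb x" unfolding m_def using ex by (rule LeastI)
  have min: "\<forall>j<m. \<forall>w. reduced w \<longrightarrow> T j z \<noteq> act g w y" if y: "orb y = orb x" for y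
  proof (intro allI impI notI)
    fix j w assume j: "j < m" and w: "reduced w" "T j z = act g w y"
    then have "T j z \<in> orb y" unfolding orb_def by blast
    then show False using not_less_Least[OF j[unfolded m_def]] y by simp
  qed
  obtain w where w: "reduced w" "T m z = act g w x" using m unfolding orb_def by blast
  show ?thesis
  proof (cases "w \<noteq> [] \<and> last w = i")
    case True
    then obtain v where v: "w = v @ [i]" by (metis append_butlast_last_id)
    then have "piece i x z" unfolding piece_def
      by (intro exI[of _ m] exI[of _ v] conjI w[unfolded v] min[OF refl])
    then show ?thesis ..
  next
    case False
    then have "reduced (w @ [i])" using assms w(1) by (auto simp: reduced_snoc)
    moreover have "T m z = act g (w @ [i]) (g i x)" using w(2) by (simp add: act_append g_invol)
    ultimately have "piece i (g i x) z" unfolding piece_def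
      by (intro exI[of _ m] exI[of _ w] conjI min[OF orb_invol[OF assms(1)]])
    then show ?thesis ..
  qed
qed

text \<open>The selected point depends only on \<open>z\<close> and the orbit, and by freeness a
  single reduced word leads to it.\<close>

lemma piece_disjoint:
  assumes "free_at x" "piece i x z" "piece j x z" shows "i = j"
proof -
  obtain m w where m: "reduced (w @ [i])" "T m z = act g (w @ [i]) x"
    "\<And>k w. k < m \<Longrightarrow> reduced w \<Longrightarrow> T k z \<noteq> act g w x" using assms(2) unfolding piece_def by blast
  obtain n v where n: "reduced (v @ [j])" "T n z = act g (v @ [j]) x"
    "\<And>k w. k < n \<Longrightarrow> reduced w \<Longrightarrow> T k z \<noteq> act g w x" using assms(3) unfolding piece_def by blast
  have "m = n" using m n by (metis linorder_neqE_nat)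
  then have "w @ [i] = v @ [j]" using act_inj[OF assms(1) m(1) n(1)] m(2) n(2) by simp
  then show ?thesis by simp
qed

lemma pred_piece: "F \<in> coin \<rightarrow>\<^sub>M coin \<Longrightarrow> Measurable.pred coin (\<lambda>x. piece i x (F x))"
  unfolding piece_def
  by (intro pred_intros pred_intros_countable pred_eq_coin pred_constant act_measurable
      measurable_compose[OF _ T_measurable])

lemma csum_measurable:
  assumes "\<And>k. (\<lambda>x. h x (T k x)) \<in> borel_measurable coin"
  shows "(\<lambda>x. csum x (h x)) \<in> borel_measurable coin"
  unfolding csum_def
proof (rule borel_measurable_suminf_order)
  fix k
  show "(\<lambda>x. if k \<in> idx E x then h x (T k x) else 0) \<in> borel_measurable coin"
    by (rule measurable_If) (use assms pred_idx[OF E_borel] in \<open>simp_all add: pred_def\<close>)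
qed

text \<open>Each \<open>a i\<close> is at least 3/8, and 9/8 exceeds 1. Any error bound below 1/3
  would serve.\<close>

lemma three_thirds_contradiction:
  fixes a b :: "nat \<Rightarrow> ennreal"
  assumes "\<And>i. i < 3 \<Longrightarrow> 1 \<le> a i + a i + b i" "a 0 + a 1 + a 2 \<le> 1" "\<And>i. i < 3 \<Longrightarrow> b i < ennreal (1 / 4)"
  shows False
proof -
  have a: "a i \<noteq> \<top>" if "i < 3" for i 
  proof -
    consider "i = 0" | "i = 1" | "i = 2" using \<open>i < 3\<close> by linarith
    then show ?thesis using assms(2) by cases (auto simp: top_unique)
  qed
  have b: "b i \<noteq> \<top>" if "i < 3" for i using assms(3)[OF that] by auto
  have *: "1 \<le> enn2real (a i) + enn2real (a i) + enn2real (b i)" if "i < 3" for i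
  proof -
    have "enn2real 1 \<le> enn2real (a i + a i + b i)"
      by (rule enn2real_mono[OF assms(1)[OF that]]) (use a[OF that] b[OF that] in \<open>simp add: less_top\<close>)
    then show ?thesis using a[OF that] b[OF that] by (simp add: enn2real_plus less_top)
  qed
  have "enn2real (a 0 + a 1 + a 2) \<le> enn2real 1" by (rule enn2real_mono[OF assms(2)]) simp
  then have s: "enn2real (a 0) + enn2real (a 1) + enn2real (a 2) \<le> 1"
    using a[of 0] a[of 1] a[of 2] by (simp add: enn2real_plus less_top)
  have q: "enn2real (b i) \<le> 1 / 4" if "i < 3" for i
    by (rule enn2real_leI) (use assms(3)[OF that] in simp_all)
  have lt: "(0::nat) < 3" "(1::nat) < 3" "(2::nat) < 3" by simp_all
  show False using s q[OF lt(1)] q[OF lt(2)] q[OF lt(3)] *[OF lt(1)] *[OF lt(2)] *[OF lt(3)] by linarith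
qed

lemma not_amenable:
  assumes iter: "frechet_iterate \<alpha> \<F>" and am: "amenable_wrt \<F> X E"
  shows False
proof -
  obtain f0 :: "nat \<Rightarrow> (nat \<Rightarrow> bool) \<times> (nat \<Rightarrow> bool) \<Rightarrow> real" where
    f0: "\<And>n. f0 n \<in> borel_measurable (restrict_space borel E)" "\<And>n p. p \<in> E \<Longrightarrow> 0 \<le> f0 n p"
      "\<And>n x. x \<in> X \<Longrightarrow> ((\<lambda>z. f0 n (x, z)) has_sum 1) (E `` {x})"
      "\<And>x y. (x, y) \<in> E \<Longrightarrow> ((\<lambda>n. \<Sum>\<^sub>\<infinity>z\<in>E `` {x}. \<bar>f0 n (x, z) - f0 n (y, z)\<bar>) \<longlongrightarrow> 0) \<F>"
  proof -
    obtain f0 :: "nat \<Rightarrow> (nat \<Rightarrow> bool) \<times> (nat \<Rightarrow> bool) \<Rightarrow> real" where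
      "(\<forall>n. f0 n \<in> borel_measurable (restrict_space borel E)) \<and> (\<forall>n. \<forall>p\<in>E. 0 \<le> f0 n p) \<and>
        (\<forall>n. \<forall>x\<in>X. ((\<lambda>z. f0 n (x, z)) has_sum 1) (E `` {x})) \<and>
        (\<forall>(x, y)\<in>E. ((\<lambda>n. \<Sum>\<^sub>\<infinity>z\<in>E `` {x}. \<bar>f0 n (x, z) - f0 n (y, z)\<bar>) \<longlongrightarrow> 0) \<F>)"
      using am unfolding amenable_wrt_def by (elim exE) (rule that)
    then have "\<And>n. f0 n \<in> borel_measurable (restrict_space borel E)" "\<And>n p. p \<in> E \<Longrightarrow> 0 \<le> f0 n p"
      "\<And>n x. x \<in> X \<Longrightarrow> ((\<lambda>z. f0 n (x, z)) has_sum 1) (E `` {x})"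
      "\<And>x y. (x, y) \<in> E \<Longrightarrow> ((\<lambda>n. \<Sum>\<^sub>\<infinity>z\<in>E `` {x}. \<bar>f0 n (x, z) - f0 n (y, z)\<bar>) \<longlongrightarrow> 0) \<F>"
      by simp_all (elim conjE, drule bspec, assumption, simp)
    then show thesis by (rule that)
  qed
  \<comment> \<open>Extension by 0 off \<open>E\<close> makes the functions Borel on the whole
    product, so that they can be composed with Borel maps.\<close>
  define f where "f n p = indicator E p *\<^sub>R f0 n p" for n p
  have fE: "f n p = f0 n p" if "p \<in> E" for n p using that by (simp add: f_def)
  have f_borel: "f n \<in> borel_measurable borel" for n
    using f0(1)[of n] E_borel unfolding f_def by (subst (asm) borel_measurable_restrict_space_iff) simp_all
  have f_nonneg: "0 \<le> f n p" for n p using f0(2)[of p n] by (simp add: f_def indicator_def)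
  have f_sum: "((\<lambda>z. f n (x, z)) has_sum 1) (E `` {x})" if "x \<in> X" for n x
    using f0(3)[OF that, of n] by (subst has_sum_cong[where g = "\<lambda>z. f0 n (x, z)"]) (simp_all add: fE)
  have f_lim: "((\<lambda>n. \<Sum>\<^sub>\<infinity>z\<in>E `` {x}. \<bar>f n (x, z) - f n (y, z)\<bar>) \<longlongrightarrow> 0) \<F>" if "(x, y) \<in> E" for x y
  proof -
    have "(\<Sum>\<^sub>\<infinity>z\<in>E `` {x}. \<bar>f n (x, z) - f n (y, z)\<bar>) = (\<Sum>\<^sub>\<infinity>z\<in>E `` {x}. \<bar>f0 n (x, z) - f0 n (y, z)\<bar>)" for n
      by (rule infsum_cong) (use E_trans[OF E_sym[OF that]] in \<open>simp add: fE\<close>)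
    then show ?thesis using f0(4)[OF that] by simp
  qed
  have csum_f: "csum x (\<lambda>z. ennreal (f n (x, z))) = 1" if "x \<in> X" for n x
    using csum_has_sum[OF f_sum[OF that] f_nonneg] by simp
  \<comment> \<open>\<open>S\<close> is the mass of the \<open>i\<close>-th piece under the
    distribution at \<open>x\<close>, and \<open>D\<close> the defect of invariance under the
    \<open>i\<close>-th involution.\<close>
  define S where "S n i x = csum x (\<lambda>z. if piece i x z then ennreal (f n (x, z)) else 0)" for n i x
  define D where "D n i x = csum x (\<lambda>z. ennreal \<bar>f n (x, z) - f n (g i x, z)\<bar>)" for n i x
  have fm: "(\<lambda>x. f n (F x, T k x)) \<in> borel_measurable coin" if "F \<in> coin \<rightarrow>\<^sub>M coin" for n k F
    by (rule measurable_compose[OF measurable_pair_borel[OF that T_measurable] f_borel])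
  have Id: "(\<lambda>x. x) \<in> coin \<rightarrow>\<^sub>M coin" by (rule measurable_ident_sets) simp
  have S_meas: "S n i \<in> borel_measurable coin" for n i
    unfolding S_def
  proof (rule csum_measurable)
    fix k
    show "(\<lambda>x. if piece i x (T k x) then ennreal (f n (x, T k x)) else 0) \<in> borel_measurable coin"
      by (rule measurable_If) (use fm[OF Id] pred_piece[OF T_measurable] in \<open>simp_all add: pred_def\<close>)
  qed
  have D_meas: "D n i \<in> borel_measurable coin" for n i
    unfolding D_def
    by (intro csum_measurable measurable_compose[OF _ measurable_ennreal] borel_measurable_abs
        borel_measurable_diff fm Id g_measurable)
  have S_sum: "S n 0 x + S n 1 x + S n 2 x \<le> 1" if "free_at x" "x \<in> X" for n x
  proof -
    have "S n 0 x + S n 1 x + S n 2 x = csum x (\<lambda>z. (if piece 0 x z then ennreal (f n (x, z)) else 0) +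
        (if piece 1 x z then ennreal (f n (x, z)) else 0) + (if piece 2 x z then ennreal (f n (x, z)) else 0))"
      unfolding S_def csum_add ..
    also have "\<dots> \<le> csum x (\<lambda>z. ennreal (f n (x, z)))"
    proof (rule csum_mono)
      fix z
      have "\<not> (piece 0 x z \<and> piece 1 x z)" "\<not> (piece 0 x z \<and> piece 2 x z)" "\<not> (piece 1 x z \<and> piece 2 x z)"
        using piece_disjoint[OF that(1), of _ z] by (metis numeral_One numeral_eq_iff semiring_norm(85) zero_neq_one zero_neq_numeral)+
      then show "(if piece 0 x z then ennreal (f n (x, z)) else 0) +
        (if piece 1 x z then ennreal (f n (x, z)) else 0) + (if piece 2 x z then ennreal (f n (x, z)) else 0)
        \<le> ennreal (f n (x, z))" by auto
    qed
    finally show ?thesis unfolding csum_f[OF that(2)] .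
  qed
  \<comment> \<open>Where \<open>z\<close> lies only in the piece seen from \<open>g i x\<close>,
    its weight at \<open>x\<close> is exchanged for its weight at \<open>g i x\<close>, at the cost
    of their difference.\<close>
  have S_ge: "1 \<le> S n i x + S n i (g i x) + D n i x" if "(x, g i x) \<in> E" "i < 3" for n i x
  proof -
    have "1 = csum x (\<lambda>z. ennreal (f n (x, z)))" using csum_f[OF E_X[OF that(1)]] by simp
    also have "\<dots> \<le> csum x (\<lambda>z. (if piece i x z then ennreal (f n (x, z)) else 0) +
        (if piece i (g i x) z then ennreal (f n (g i x, z)) else 0) + ennreal \<bar>f n (x, z) - f n (g i x, z)\<bar>)"
    proof (rule csum_mono)
      fix z assume z: "(x, z) \<in> E"
      show "ennreal (f n (x, z)) \<le> (if piece i x z then ennreal (f n (x, z)) else 0) +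
        (if piece i (g i x) z then ennreal (f n (g i x, z)) else 0) + ennreal \<bar>f n (x, z) - f n (g i x, z)\<bar>"
      proof (cases "piece i x z")
        case True
        then show ?thesis by (simp add: add.assoc)
      next
        case False
        then have "piece i (g i x) z" using piece_cover[OF that(2) z] by blast
        moreover have "ennreal (f n (x, z)) \<le> ennreal (f n (g i x, z)) + ennreal \<bar>f n (x, z) - f n (g i x, z)\<bar>"
          unfolding ennreal_plus[OF f_nonneg abs_ge_zero, symmetric] by (rule ennreal_leI) arith
        ultimately show ?thesis using False by simp
      qed
    qed
    also have "\<dots> = S n i x + S n i (g i x) + D n i x"
      unfolding csum_add S_def D_def csum_class[OF that(1), of "\<lambda>z. if piece i (g i x) z then ennreal (f n (g i x, z)) else 0"] ..
    finally show ?thesis .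
  qed
  have D_le: "D n i x \<le> 2" if "(x, g i x) \<in> E" for n i x
  proof -
    have "D n i x \<le> csum x (\<lambda>z. ennreal (f n (x, z)) + ennreal (f n (g i x, z)))"
      unfolding D_def
    proof (rule csum_mono)
      fix z
      show "ennreal \<bar>f n (x, z) - f n (g i x, z)\<bar> \<le> ennreal (f n (x, z)) + ennreal (f n (g i x, z))"
        using f_nonneg[of n "(x, z)"] f_nonneg[of n "(g i x, z)"]
        unfolding ennreal_plus[OF f_nonneg f_nonneg, symmetric] by (intro ennreal_leI) arith
    qed
    also have "\<dots> = csum x (\<lambda>z. ennreal (f n (x, z))) + csum (g i x) (\<lambda>z. ennreal (f n (g i x, z)))"
      unfolding csum_add csum_class[OF that, of "\<lambda>z. ennreal (f n (g i x, z))"] ..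
    also have "\<dots> = 2" using csum_f[OF E_X[OF that]] csum_f[OF E_X[OF E_sym[OF that]]] by simp
    finally show ?thesis .
  qed
  have D_lim: "eventually (\<lambda>n. D n i x \<le> ennreal e) \<F>" if "(x, g i x) \<in> E" "0 < e" for i x e
  proof -
    have "E `` {x} = E `` {g i x}" by (rule equiv_class_eq[OF equiv_E that(1)])
    then have "((\<lambda>z. f n (g i x, z)) has_sum 1) (E `` {x})" for n
      using f_sum[OF E_X[OF E_sym[OF that(1)]]] by simp
    then have "((\<lambda>z. f n (x, z) + - f n (g i x, z)) has_sum 1 + - 1) (E `` {x})" for n
      using f_sum[OF E_X[OF that(1)], of n] by (intro has_sum_add) (simp_all add: has_sum_uminus)
    then have "(\<lambda>z. f n (x, z) - f n (g i x, z)) summable_on E `` {x}" for n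
      unfolding summable_on_def by auto
    then have "(\<lambda>z. \<bar>f n (x, z) - f n (g i x, z)\<bar>) summable_on E `` {x}" for n
      using summable_on_iff_abs_summable_on_real by fastforce
    then have "D n i x = ennreal (\<Sum>\<^sub>\<infinity>z\<in>E `` {x}. \<bar>f n (x, z) - f n (g i x, z)\<bar>)" for n
      unfolding D_def by (intro csum_has_sum has_sum_infsum) simp_all
    moreover have "eventually (\<lambda>n. (\<Sum>\<^sub>\<infinity>z\<in>E `` {x}. \<bar>f n (x, z) - f n (g i x, z)\<bar>) < e) \<F>"
      using order_tendstoD(2)[OF f_lim[OF that(1)] that(2)] .
    ultimately show ?thesis by (auto elim!: eventually_mono intro!: ennreal_leI)
  qed
  \<comment> \<open>\<open>frechet_fatou\<close> asks for the bound 2 everywhere, while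
    \<open>D_le\<close> gives it where \<open>x\<close> and \<open>g i x\<close> are equivalent;
    hence the truncation.\<close>
  define h where "h i n x = min 2 (D n i x)" for i n x
  have small: "eventually (\<lambda>n. (\<integral>\<^sup>+x. h i n x \<partial>coin) < ennreal (1 / 4)) \<F>" for i
  proof -
    obtain H where H: "H \<in> borel_measurable coin" "\<And>x y. eventually (\<lambda>n. h i n x \<le> y) \<F> \<Longrightarrow> H x \<le> y"
      "\<And>y. (\<integral>\<^sup>+x. H x \<partial>coin) < y \<Longrightarrow> eventually (\<lambda>n. (\<integral>\<^sup>+x. h i n x \<partial>coin) < y) \<F>"
      using frechet_fatou[OF iter, of "h i"] D_meas unfolding h_def by auto
    have "AE x in coin. H x = 0"
      using g_E[of i]
    proof (rule AE_mp, intro AE_I2 impI)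
      fix x assume x: "(x, g i x) \<in> E"
      have "H x \<le> 0 + ennreal e" if "0 < e" for e
        unfolding add_0 by (rule H(2)) (rule eventually_mono[OF D_lim[OF x that]], simp add: h_def min.coboundedI2)
      then have "H x \<le> 0" by (rule ennreal_le_epsilon[rotated])
      then show "H x = 0" by simp
    qed
    then have "(\<integral>\<^sup>+x. H x \<partial>coin) = 0" by (subst nn_integral_cong_AE[where v = "\<lambda>_. 0"]) auto
    then show ?thesis by (intro H(3)) simp
  qed
  \<comment> \<open>Finitely many eventual conditions hold together, so one \<open>n\<close> serves
    all three involutions.\<close>
  have "eventually (\<lambda>n. \<forall>i\<in>{..<3}. (\<integral>\<^sup>+x. h i n x \<partial>coin) < ennreal (1 / 4)) \<F>"
    by (rule eventually_ball_finite) (use small in simp_all)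
  then obtain n where n: "\<And>i. i < 3 \<Longrightarrow> (\<integral>\<^sup>+x. h i n x \<partial>coin) < ennreal (1 / 4)"
    using eventually_happens'[OF frechet_iterate_nontrivial[OF iter]] by fastforce
  define I where "I i = (\<integral>\<^sup>+x. S n i x \<partial>coin)" for i
  have one: "(\<integral>\<^sup>+x. 1 \<partial>coin) = (1 :: ennreal)" using coin.emeasure_space_1 by simp
  have "1 \<le> I i + I i + (\<integral>\<^sup>+x. h i n x \<partial>coin)" if "i < 3" for i
  proof -
    have gS: "(\<lambda>x. S n i (g i x)) \<in> borel_measurable coin" by (rule measurable_compose[OF g_measurable S_meas])
    have hm: "h i n \<in> borel_measurable coin"
      unfolding h_def by (intro borel_measurable_min borel_measurable_const D_meas)
    have "(\<integral>\<^sup>+x. 1 \<partial>coin) \<le> (\<integral>\<^sup>+x. S n i x + S n i (g i x) + h i n x \<partial>coin)"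
    proof (rule nn_integral_mono_AE, rule AE_mp[OF g_E[of i]], intro AE_I2 impI)
      fix x assume x: "(x, g i x) \<in> E"
      show "1 \<le> S n i x + S n i (g i x) + h i n x"
        using S_ge[OF x that, of n] unfolding h_def min_absorb2[OF D_le[OF x]] .
    qed
    also have "\<dots> = I i + (\<integral>\<^sup>+x. S n i (g i x) \<partial>coin) + (\<integral>\<^sup>+x. h i n x \<partial>coin)"
      unfolding I_def nn_integral_add[OF borel_measurable_add[OF S_meas gS] hm] nn_integral_add[OF S_meas gS] ..
    \<comment> \<open>Here the invariance of the measure enters: both pieces have the same mean
      mass.\<close>
    also have "(\<integral>\<^sup>+x. S n i (g i x) \<partial>coin) = I i"
      unfolding I_def using nn_integral_distr[OF g_measurable[of i], of "S n i"] S_meas unfolding g_distr by metis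
    finally show ?thesis unfolding one .
  qed
  moreover have "I 0 + I 1 + I 2 \<le> 1"
  proof -
    have "I 0 + I 1 + I 2 = (\<integral>\<^sup>+x. S n 0 x + S n 1 x + S n 2 x \<partial>coin)"
      unfolding I_def nn_integral_add[OF borel_measurable_add[OF S_meas S_meas] S_meas]
        nn_integral_add[OF S_meas S_meas] ..
    also have "\<dots> \<le> (\<integral>\<^sup>+x. 1 \<partial>coin)"
    proof (rule nn_integral_mono_AE, rule AE_mp[OF g_E[of 0]], rule AE_mp[OF AE_free_at], intro AE_I2 impI)
      fix x assume "free_at x" "(x, g 0 x) \<in> E"
      then show "S n 0 x + S n 1 x + S n 2 x \<le> 1" using S_sum E_X by blast
    qed
    finally show ?thesis unfolding one .
  qed
  ultimately show False using three_thirds_contradiction[of I "\<lambda>i. \<integral>\<^sup>+x. h i n x \<partial>coin"] n by blast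
qed

end

theorem theorem4p4:
  fixes M :: "hc set"
  assumes "ctm_ZFC M"
  shows "\<not> frechet_amenable_on (random_reals M) (random_equiv M) \<and>
         \<not> hyperfinite_on (random_reals M) (random_equiv M)"
proof -
  interpret ctm M by (rule ctm.intro) (rule assms)
  interpret free_involutions "random_reals M" "random_equiv M" "\<lambda>k. decode (from_nat_into M k)" flip_real
  proof
    show "equiv (random_reals M) (random_equiv M)"
      unfolding equiv_def refl_on_def sym_def trans_def random_equiv_def by auto
  next
    fix x y assume "(x, y) \<in> random_equiv M"
    then obtain t where t: "t \<in> M" "decode t x = y" by (rule decode_surj)
    have "countable M" using assms unfolding ctm_ZFC_def by blast
    then obtain k where "from_nat_into M k = t" by (rule from_nat_into_surj[OF _ t(1), THEN exE])
    then show "\<exists>k. decode (from_nat_into M k) x = y" using t(2) by (intro exI[of _ k]) simp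
  next
    fix i
    show "flip_real i \<in> coin \<rightarrow>\<^sub>M coin" by (rule measurable_permute)
    have "inj (flip i)" by (rule inj_on_inverseI) (rule flip_flip)
    then show "distr coin coin (flip_real i) = coin" by (rule distr_coin_permute)
    show "flip_real i (flip_real i x) = x" for x unfolding flip_flip ..
    show "AE x in coin. (x, flip_real i x) \<in> random_equiv M"
      by (rule involution_equiv_AE[OF flip_in_M flip_flip])
  qed (fact random_reals_borel random_equiv_borel decode_measurable free_AE)+
  \<comment> \<open>Hyperfiniteness yields amenability along the Frechet filter itself, which is the
    first iterate.\<close>
  show ?thesis
    unfolding frechet_amenable_on_def using not_amenable hyperfinite_imp_amenable frechet_iterate.one by blast
qed

end
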